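(* Let $(D,\mathcal{D},\varrho)$ be a probability space, let $\mathcal{P}\subset L^2_{\varrho}(D)$ be an $n$-dimensional linear subspace containing the constant function $1$, and let $\mu\ll\varrho$ be a probability measure on $D$ with $v=\mathrm{d}\mu/\mathrm{d}\varrho$ and $w=1/v : D\to[0,\infty]$. Let $\Omega\subseteq D$ be a $\varrho$-measurable set with $\varrho(\Omega)>0$ and suppose that $v$ is strictly positive almost everywhere on $\Omega$. Let $f\in L^2_{\varrho}(D)$, $0<\epsilon<1$, let $$m\geq 8\cdot\kappa_w(\mathcal{P},L^2_{\varrho}(\Omega))\cdot\log(3n/\epsilon),$$ and let $x_1,\ldots,x_m$ be drawn i.i.d. from $\mu$. Then the following holds with probability at least $1-\epsilon$. For any $e=(e_i)_{i=1}^m\in\mathbb{C}^m$ and any minimizer $\hat f$ of the weighted least-squares problem $$\min_{p\in\mathcal{P}}\frac1m\sum_{i=1}^m w(x_i)|y_i-p(x_i)|^2,\qquad y_i=f(x_i)+e_i,$$ one has $$\|f-\hat f\|_{L^2_{\varrho}(D)}\leq\|f-f_n\|_{L^2_{\varrho}(D)}+\frac{8\,\mathcal{R}(\mathcal{P},L^2_{\varrho}(\Omega),L^2_{\varrho}(D))}{\sqrt{\epsilon}}\left(\|f-f_n\|_{L^2_{\varrho}(D)}+\|e\|_2\right)$$ and $$\|f-\hat f\|_{L^{\infty}_{\varrho}(D)}\leq\|f-f_n\|_{L^{\infty}_{\varrho}(D)}+\frac{8\,\mathcal{R}(\mathcal{P},L^{\infty}_{\varrho}(\Omega),L^2_{\varrho}(D))}{\sqrt{\epsilon}}\left(\|f-f_n\|_{L^2_{\varrho}(D)}+\|e\|_2\right),$$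 where $f_n\in\mathcal{P}$ is the best approximation to $f$ from $\mathcal{P}$ in the $L^2_{\varrho}(D)$-norm.
   Context: Functions are complex-valued. $L^q_\varrho(\Omega)$ denotes the Lebesgue space over $\Omega$ with respect to the (unnormalized) restriction $\varrho|_\Omega$. The (reciprocal) Christoffel function of $\mathcal{P}$ over $\Omega$ is $\mathcal{K}(\mathcal{P},L^2_{\varrho}(\Omega))(x)=\sup\{|p(x)|^2:p\in\mathcal{P},\ \|p\|_{L^2_{\varrho}(\Omega)}^2=1\}$, $x\in\Omega$ (equivalently, $\varrho$-a.e. on $\Omega$, $\sum_i|p_i(x)|^2$ for any orthonormal basis $\{p_i\}$ of $\mathcal{P}$ regarded as a subspace of $L^2_\varrho(\Omega)$), and $$\kappa_w(\mathcal{P},L^2_{\varrho}(\Omega))=\operatorname{ess\,sup}_{x\sim\varrho|_{\Omega}}\{w(x)\,\mathcal{K}(\mathcal{P},L^2_{\varrho}(\Omega))(x)\}.$$ For $1\le q,r\le\infty$ the Remez constant is $$\mathcal{R}(\mathcal{P},L^q_{\varrho}(\Omega),L^r_{\varrho}(D))=\sup\{\|p\|_{L^q_{\varrho}(D)}:p\in\mathcal{P},\ 0<\|p\|_{L^r_{\varrho}(\Omega)}\leq1\}$$ (so the $L^q$-norm is taken over $D$ and the $L^r$-norm over $\Omega$). If a Remez constant is $+\infty$, the corresponding error bound is regarded as vacuous. $\|e\|_2$ is the Euclidean norm. The least-squares problem is well defined with probability one since $\mu\ll\varrho$. *)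

theory Defs
  imports "HOL-Probability.Probability" "HOL-Library.Function_Algebras"
begin

interpretation cfun: vector_space "\<lambda>(c::complex) (f::'a \<Rightarrow> complex) x. c * f x"
  by unfold_locales (auto simp: fun_eq_iff algebra_simps)

text \<open>The \<open>L\<^sup>q\<close>-norm for \<open>1 \<le> q \<le> \<infinity>\<close>, with value \<open>\<infinity>\<close> if the function is not in \<open>L\<^sup>q\<close>.
  The norm over a subset \<open>\<Omega>\<close> is taken with respect to \<open>restrict_space M \<Omega>\<close>, which is not
  renormalized.\<close>

definition Lnorm :: "ennreal \<Rightarrow> 'a measure \<Rightarrow> ('a \<Rightarrow> complex) \<Rightarrow> ennreal" where
  "Lnorm q M f =
    (if q = \<infinity> then esssup M (\<lambda>x. ennreal (cmod (f x)))
     else let I = (\<integral>\<^sup>+x. ennreal (cmod (f x) powr enn2real q) \<partial>M)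
          in if I = \<infinity> then \<infinity> else ennreal (enn2real I powr (1 / enn2real q)))"

definition L2 :: "'a measure \<Rightarrow> ('a \<Rightarrow> complex) set" where
  "L2 M = {f \<in> borel_measurable M. Lnorm 2 M f < \<infinity>}"

text \<open>Elements of \<open>L\<^sup>2\<close> are classes of functions modulo equality almost everywhere, but least-squares
  fitting evaluates them at points. A finite-dimensional subspace of \<open>L\<^sup>2\<close> is therefore given by a
  linear choice of representatives: a space of functions containing exactly one function of each
  class. The finite spanning set is required because \<open>cfun.dim\<close> is \<open>0\<close> on spaces of infinite
  dimension.\<close>

definition L2_subspace :: "'a measure \<Rightarrow> nat \<Rightarrow> ('a \<Rightarrow> complex) set \<Rightarrow> bool" where
  "L2_subspace M n P \<longleftrightarrow>
     cfun.subspace P \<and> P \<subseteq> L2 M \<and>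
     (\<forall>p\<in>P. \<forall>q\<in>P. (AE x in M. p x = q x) \<longrightarrow> p = q) \<and>
     (\<exists>B. finite B \<and> cfun.span B = P) \<and> cfun.dim P = n"

definition christoffel :: "('a \<Rightarrow> complex) set \<Rightarrow> 'a measure \<Rightarrow> 'a \<Rightarrow> ennreal" where
  "christoffel P M x = (SUP p\<in>{p \<in> P. (Lnorm 2 M p)\<^sup>2 = 1}. ennreal ((cmod (p x))\<^sup>2))"

definition kappa :: "('a \<Rightarrow> ennreal) \<Rightarrow> ('a \<Rightarrow> complex) set \<Rightarrow> 'a measure \<Rightarrow> ennreal" where
  "kappa w P M = esssup M (\<lambda>x. w x * christoffel P M x)"

text \<open>Note the roles of the exponents: the \<open>L\<^sup>q\<close>-norm is taken over the whole space, the
  \<open>L\<^sup>r\<close>-norm over \<open>\<Omega>\<close>.\<close>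

definition remez :: "('a \<Rightarrow> complex) set \<Rightarrow> 'a measure \<Rightarrow> 'a set \<Rightarrow> ennreal \<Rightarrow> ennreal \<Rightarrow> ennreal" where
  "remez P M \<Omega> q r =
     (SUP p\<in>{p \<in> P. 0 < Lnorm r (restrict_space M \<Omega>) p \<and> Lnorm r (restrict_space M \<Omega>) p \<le> 1}.
        Lnorm q M p)"

definition best_L2_approx :: "'a measure \<Rightarrow> ('a \<Rightarrow> complex) set \<Rightarrow> ('a \<Rightarrow> complex) \<Rightarrow> ('a \<Rightarrow> complex) \<Rightarrow> bool" where
  "best_L2_approx M P f g \<longleftrightarrow> is_arg_min (\<lambda>p. Lnorm 2 M (\<lambda>x. f x - p x)) (\<lambda>p. p \<in> P) g"

definition wls_loss ::
  "nat \<Rightarrow> ('a \<Rightarrow> ennreal) \<Rightarrow> (nat \<Rightarrow> 'a) \<Rightarrow> (nat \<Rightarrow> complex) \<Rightarrow> ('a \<Rightarrow> complex) \<Rightarrow> ennreal" where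
  "wls_loss m w x y p = ennreal (1 / real m) * (\<Sum>i<m. w (x i) * ennreal ((cmod (y i - p (x i)))\<^sup>2))"

definition wls_minimizer ::
  "('a \<Rightarrow> complex) set \<Rightarrow> nat \<Rightarrow> ('a \<Rightarrow> ennreal) \<Rightarrow> (nat \<Rightarrow> 'a) \<Rightarrow> (nat \<Rightarrow> complex) \<Rightarrow> ('a \<Rightarrow> complex) \<Rightarrow> bool" where
  "wls_minimizer P m w x y g \<longleftrightarrow> is_arg_min (wls_loss m w x y) (\<lambda>p. p \<in> P) g"

end

theory Submission
  imports Defs
begin

text \<open>Once \<open>P\<close> is injective on \<open>\<Omega>\<close> (which a finite Remez constant forces, because otherwise
  adding multiples of an element vanishing on \<open>\<Omega>\<close> to the constant \<open>1\<close> gives an infinite supremum),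
  choose an orthonormal basis \<open>g\<close> of \<open>P\<close> over \<open>\<Omega>\<close> and put
  \<open>u\<^sub>i(x) = sqrt (w x) * cnj (g\<^sub>i x)\<close> on \<open>\<Omega>\<close> and \<open>0\<close> elsewhere.
  These random vectors are isotropic under \<open>\<mu>\<close> and have norm at most \<open>sqrt \<kappa>\<close>. The probabilistic
  heart is the lower bound \<open>\<Sum> u u\<^sup>* \<ge> m / 16\<close>. Instead of a matrix Chernoff
  bound, the potential \<open>tr (L + \<Sum> u u\<^sup>*) ^ (- p)\<close> with \<open>L = 2 * m\<close> and \<open>p = \<lfloor>m / \<kappa>\<rfloor>\<close> is
  tracked: by the Sherman--Morrison formula and log-convexity of the moments
  \<open>u\<^sup>* T\<^sup>k u\<close>, a rank one update of \<open>T = (L + \<Sum> u u\<^sup>*) ^ (- 1)\<close> decreases \<open>tr T\<^sup>p\<close> in expectation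
  by a fixed multiple of \<open>p * tr T ^ (p + 1)\<close>.
  Markov's inequality, applied also to the empirical means of \<open>w * \<bar>f - f\<^sub>n\<bar>\<^sup>2\<close> and of \<open>w\<close>, then leaves
  an event on which the least-squares fit is stable; the constant is
  \<open>8 = sqrt (16 * 4)\<close>.\<close>

section \<open>Log-convex sequences\<close>

text \<open>Working with powers of the inverse avoids eigenvalues, matrix exponentials and trace
  inequalities: Cauchy-Schwarz for semidefinite forms is the one matrix inequality behind all
  estimates. The obstacle is that the expected drop of \<open>tr T ^ p\<close> is measured by
  \<open>tr T ^ (p + 1)\<close>, which is no function of \<open>tr T ^ p\<close>. Convexity of
  \<open>b ^ k * s k\<close> in k, for the moments \<open>s\<close> of a vector and a free level
  \<open>b\<close>, bounds it below by an affine function, and the resulting recursion has the fixed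
  point \<open>d / b ^ p\<close>. The shift \<open>L\<close> keeps \<open>T\<close> below
  \<open>1 / L\<close>, so that the second order error of an update has relative size at most
  \<open>(p + 1) * \<kappa> / (2 * L)\<close>, here at most 9/32. A failure of the lower bound
  forces the potential up to \<open>1 / c ^ p\<close> with \<open>c = L + m / 16\<close>, and the
  gap \<open>(b / c) ^ p = (5 / 4) ^ p\<close> beats \<open>n / \<epsilon>\<close> because p is at
  least 7 ln (3 n / \<epsilon>). The failure probability is split into \<open>\<epsilon> / 2\<close>
  for this event and \<open>\<epsilon> / 4\<close> for each use of Markov's inequality, whence the 4
  in the constant. The mean of \<open>w\<close> serves twice: it bounds the noise and excludes
  infinite weights at the samples.\<close>

definition logconvex_seq :: "(nat \<Rightarrow> real) \<Rightarrow> bool" where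
  "logconvex_seq s \<longleftrightarrow> (\<forall>k. 0 \<le> s k) \<and> (\<forall>k. (s (Suc k))\<^sup>2 \<le> s k * s (Suc (Suc k)))"

definition convex_seq :: "(nat \<Rightarrow> real) \<Rightarrow> bool" where
  "convex_seq r \<longleftrightarrow> (\<forall>k. 2 * r (Suc k) \<le> r k + r (Suc (Suc k)))"

text \<open>Log-convexity means that the ratios \<open>s (Suc k) / s k\<close> do not decrease. The
  cross-multiplied form admits zero terms, such as the moments of a zero vector.\<close>

lemma logconvex_seq_exchange:
  assumes "logconvex_seq s"
  shows "s (Suc a) * s (a + j) \<le> s a * s (Suc (a + j))"
proof (induction j)
  case (Suc j)
  have nn: "\<And>k. 0 \<le> s k" and lc: "\<And>k. (s (Suc k))\<^sup>2 \<le> s k * s (Suc (Suc k))"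
    using assms unfolding logconvex_seq_def by auto
  let ?b = "a + j"
  show ?case
  proof (cases "s (Suc ?b) = 0")
    case True then show ?thesis using nn by simp
  next
    case False
    \<comment> \<open>Log-convexity forbids a nonzero term right after a zero one, so this factor
      can be cancelled at the end.\<close>
    have pos: "0 < s ?b"
    proof -
      have "s ?b \<noteq> 0"
      proof
        assume "s ?b = 0"
        then have "(s (Suc ?b))\<^sup>2 \<le> 0" using lc[of ?b] by simp
        then show False using False by simp
      qed
      then show ?thesis using nn[of ?b] by linarith
    qed
    have "s ?b * (s (Suc a) * s (Suc ?b)) = (s (Suc a) * s ?b) * s (Suc ?b)" by simp
    also have "\<dots> \<le> (s a * s (Suc ?b)) * s (Suc ?b)"
      by (rule mult_right_mono[OF Suc.IH nn])
    also have "\<dots> = s a * (s (Suc ?b))\<^sup>2" by (simp add: power2_eq_square)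
    also have "\<dots> \<le> s a * (s ?b * s (Suc (Suc ?b)))" by (rule mult_left_mono[OF lc nn])
    also have "\<dots> = s ?b * (s a * s (Suc (Suc ?b)))" by simp
    finally have "s ?b * (s (Suc a) * s (Suc ?b)) \<le> s ?b * (s a * s (Suc (Suc ?b)))" .
    then have "s (Suc a) * s (Suc ?b) \<le> s a * s (Suc (Suc ?b))"
      using pos by (rule mult_left_le_imp_le)
    then show ?thesis by simp
  qed
qed simp

text \<open>Each exchange moves the two indices one step further apart without decreasing the
  product, until the smaller one reaches 0. This reduces a product of two moments to a multiple of a
  single moment.\<close>

lemma logconvex_seq_mult_le:
  assumes s: "logconvex_seq s"
  shows "s a * s b \<le> s 0 * s (a + b)"
proof -
  have *: "s a * s b \<le> s 0 * s (a + b)" if "a \<le> b" for a b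
    using that
  proof (induction a arbitrary: b)
    case (Suc a)
    have "s (Suc a) * s b \<le> s a * s (Suc b)"
      using logconvex_seq_exchange[OF s, of a "b - a"] Suc.prems by simp
    also have "\<dots> \<le> s 0 * s (a + Suc b)" by (rule Suc.IH) (use Suc.prems in simp)
    finally show ?case by simp
  qed simp
  show ?thesis
  proof (cases "a \<le> b")
    case False
    then have "s b * s a \<le> s 0 * s (b + a)" by (intro *) simp
    then show ?thesis by (simp only: mult.commute add.commute)
  qed (rule *)
qed

text \<open>The weights \<open>c ^ k\<close> preserve log-convexity, and the geometric mean is at
  most the arithmetic mean. The free scale \<open>c\<close> later becomes the level \<open>b\<close>
  with which the operator is compared.\<close>

lemma logconvex_seq_imp_convex_seq:
  assumes s: "logconvex_seq s" and c: "0 \<le> c"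
  shows "convex_seq (\<lambda>k. c ^ k * s k)"
  unfolding convex_seq_def
proof
  fix k
  have nn: "\<And>k. 0 \<le> s k" and lc: "\<And>k. (s (Suc k))\<^sup>2 \<le> s k * s (Suc (Suc k))"
    using s unfolding logconvex_seq_def by auto
  let ?r = "\<lambda>k. c ^ k * s k"
  have nr: "0 \<le> ?r k" for k using nn c by simp
  have "(?r (Suc k))\<^sup>2 = (c ^ Suc k)\<^sup>2 * (s (Suc k))\<^sup>2" by (rule power_mult_distrib)
  also have "\<dots> \<le> (c ^ Suc k)\<^sup>2 * (s k * s (Suc (Suc k)))" by (rule mult_left_mono[OF lc]) simp
  also have "\<dots> = ?r k * ?r (Suc (Suc k))" by (simp add: power2_eq_square)
  finally have A: "(?r (Suc k))\<^sup>2 \<le> ?r k * ?r (Suc (Suc k))" .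
  have "(2 * A)\<^sup>2 \<le> (B + C)\<^sup>2" if "A\<^sup>2 \<le> B * C" for A B C :: real
    using that sum_squares_bound[of B C] by (simp add: power2_sum)
  from this[OF A] show "2 * ?r (Suc k) \<le> ?r k + ?r (Suc (Suc k))"
    using nr[of k] nr[of "Suc (Suc k)"] by (meson add_nonneg_nonneg power2_le_imp_le)
qed

lemma convex_seq_diff_mono:
  assumes "convex_seq r" and "i \<le> j"
  shows "r (Suc i) - r i \<le> r (Suc j) - r j"
proof -
  have "mono (\<lambda>k. r (Suc k) - r k)"
    unfolding mono_iff_le_Suc
  proof
    fix k
    show "r (Suc k) - r k \<le> r (Suc (Suc k)) - r (Suc k)"
      using assms(1)[unfolded convex_seq_def, rule_format, of k] by linarith
  qed
  then show ?thesis using assms(2) by (auto dest: monoD)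
qed

text \<open>If the last increment is negative, convexity makes all earlier ones nonpositive, so
  \<open>r p\<close> is at most \<open>r 0\<close>. The model is z^p - 1 <= z^(p+1) for z >=
  0.\<close>

lemma convex_seq_lower:
  assumes cv: "convex_seq r" and nn: "0 \<le> r 0" "0 \<le> r (Suc p)"
  shows "r p - r 0 \<le> r (Suc p)"
proof (cases "r p \<le> r (Suc p)")
  case True then show ?thesis using nn by linarith
next
  case False
  have "r (Suc i) - r i \<le> 0" if "i < p" for i
    using convex_seq_diff_mono[OF cv, of i p] that False by simp
  then have "(\<Sum>i<p. r (Suc i) - r i) \<le> 0" by (intro sum_nonpos) auto
  then show ?thesis unfolding sum_lessThan_telescope using nn by linarith
qed

lemma convex_seq_ge_initial:
  assumes cv: "convex_seq r" and "r 0 \<le> r 1"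
  shows "r 0 \<le> r p"
proof -
  have "0 \<le> r (Suc i) - r i" for i
    using convex_seq_diff_mono[OF cv, of 0 i] assms(2) by simp
  then have "0 \<le> (\<Sum>i<p. r (Suc i) - r i)" by (intro sum_nonneg) auto
  then show ?thesis unfolding sum_lessThan_telescope by linarith
qed

section \<open>Positive semidefinite operators and rank one updates\<close>

definition cdot :: "nat \<Rightarrow> (nat \<Rightarrow> complex) \<Rightarrow> (nat \<Rightarrow> complex) \<Rightarrow> complex" where
  "cdot d x y = (\<Sum>i<d. cnj (x i) * y i)"

definition axis_vec :: "nat \<Rightarrow> nat \<Rightarrow> complex" where
  "axis_vec i = (\<lambda>j. if j = i then 1 else 0)"

lemma cdot_add_right: "cdot d x (\<lambda>i. y i + a * z i) = cdot d x y + a * cdot d x z"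
  by (simp add: cdot_def algebra_simps sum.distrib sum_distrib_left)

lemma cdot_diff_right: "cdot d x (\<lambda>i. y i - a * z i) = cdot d x y - a * cdot d x z"
  by (simp add: cdot_def algebra_simps sum_subtractf sum_distrib_left)

lemma cdot_add_left: "cdot d (\<lambda>i. y i + a * z i) x = cdot d y x + cnj a * cdot d z x"
  by (simp add: cdot_def algebra_simps sum.distrib sum_distrib_left)

lemma cdot_scale_left: "cdot d (\<lambda>i. a * z i) x = cnj a * cdot d z x"
  by (simp add: cdot_def algebra_simps sum_distrib_left)

lemma cdot_scale_right: "cdot d x (\<lambda>i. a * z i) = a * cdot d x z"
  by (simp add: cdot_def algebra_simps sum_distrib_left)

lemma cnj_cdot: "cnj (cdot d x y) = cdot d y x"
  by (simp add: cdot_def mult.commute)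

lemma cdot_axis_left: "i < d \<Longrightarrow> cdot d (axis_vec i) y = y i"
proof -
  have "cnj (axis_vec i j) * y j = (if i = j then y j else 0)" for j
    by (simp add: axis_vec_def)
  then show "i < d \<Longrightarrow> cdot d (axis_vec i) y = y i"
    by (simp add: cdot_def)
qed

lemma cdot_axis_right: "i < d \<Longrightarrow> cdot d y (axis_vec i) = cnj (y i)"
  using cdot_axis_left[of i d y] by (metis cnj_cdot)

lemma cdot_self: "cdot d x x = of_real (\<Sum>i<d. (cmod (x i))\<^sup>2)"
  unfolding cdot_def of_real_sum complex_norm_square by (simp add: mult.commute)

text \<open>A vector of length \<open>d\<close> is a function on \<open>nat\<close> of which only the values below \<open>d\<close> matter, since
  the conditions below see it through \<open>cdot d\<close> only.\<close>

definition psd_op :: "nat \<Rightarrow> ((nat \<Rightarrow> complex) \<Rightarrow> nat \<Rightarrow> complex) \<Rightarrow> bool" where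
  "psd_op d T \<longleftrightarrow>
     (\<forall>x y a. T (\<lambda>i. x i + a * y i) = (\<lambda>i. T x i + a * T y i)) \<and>
     (\<forall>x y. cdot d (T x) y = cdot d x (T y)) \<and> (\<forall>x. 0 \<le> Re (cdot d x (T x)))"

lemma psd_op_add: "psd_op d T \<Longrightarrow> T (\<lambda>i. x i + a * y i) = (\<lambda>i. T x i + a * T y i)"
  by (simp add: psd_op_def)

lemma psd_op_diff: "psd_op d T \<Longrightarrow> T (\<lambda>i. x i - a * y i) = (\<lambda>i. T x i - a * T y i)"
  using psd_op_add[of d T x "- a" y] by simp

lemma psd_op_herm: "psd_op d T \<Longrightarrow> cdot d (T x) y = cdot d x (T y)"
  by (simp add: psd_op_def)

lemma psd_op_nonneg: "psd_op d T \<Longrightarrow> 0 \<le> Re (cdot d x (T x))"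
  by (simp add: psd_op_def)

lemma psd_op_real: "psd_op d T \<Longrightarrow> cdot d x (T x) = of_real (Re (cdot d x (T x)))"
  by (metis psd_op_herm Reals_cnj_iff cnj_cdot complex_is_Real_iff of_real_Re)

lemma psd_op_id: "psd_op d (\<lambda>x. x)"
  by (simp add: psd_op_def cdot_self sum_nonneg)

lemma psd_op_pow_herm:
  "psd_op d T \<Longrightarrow> cdot d ((T ^^ k) x) y = cdot d x ((T ^^ k) y)"
  by (induction k arbitrary: x y) (simp_all add: psd_op_herm funpow_swap1)

lemma psd_op_pow_diff:
  "psd_op d T \<Longrightarrow> (T ^^ k) (\<lambda>i. x i - a * y i) = (\<lambda>i. (T ^^ k) x i - a * (T ^^ k) y i)"
  by (induction k) (simp_all add: psd_op_diff)

text \<open>The form is nonnegative at x - t (cnj h) y for every real t, where h is the cross term.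
  The discriminant argument needs two cases because a semidefinite form may vanish at
  \<open>y\<close>.\<close>

lemma psd_op_Cauchy_Schwarz:
  assumes T: "psd_op d T"
  shows "(cmod (cdot d x (T y)))\<^sup>2 \<le> Re (cdot d x (T x)) * Re (cdot d y (T y))"
proof -
  define h where "h = cdot d x (T y)"
  define p where "p = Re (cdot d x (T x))"
  define q where "q = Re (cdot d y (T y))"
  have yx: "cdot d y (T x) = cnj h"
    unfolding h_def by (metis T cnj_cdot psd_op_herm)
  have xx: "cdot d x (T x) = of_real p" and yy: "cdot d y (T y) = of_real q"
    unfolding p_def q_def using psd_op_real[OF T] by auto
  have p0: "0 \<le> p" and q0: "0 \<le> q" unfolding p_def q_def using psd_op_nonneg[OF T] by auto
  have ineq: "0 \<le> p - 2 * t * (cmod h)\<^sup>2 + t\<^sup>2 * (cmod h)\<^sup>2 * q" for t :: real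
  proof -
    \<comment> \<open>The factor \<open>cnj h\<close> makes both cross terms equal to the real
      number - t |h|^2.\<close>
    define a where "a = - of_real t * cnj h"
    let ?z = "\<lambda>i. x i + a * y i"
    have "cdot d ?z (T ?z) = of_real p + a * h + cnj a * cnj h + cnj a * a * of_real q"
      by (simp add: psd_op_add[OF T] cdot_add_left cdot_add_right xx yy yx h_def[symmetric]
          algebra_simps)
    also have "\<dots> = of_real p - 2 * of_real t * (h * cnj h) + (of_real t)\<^sup>2 * (h * cnj h) * of_real q"
      by (simp add: a_def algebra_simps power2_eq_square)
    also have "\<dots> = of_real (p - 2 * t * (cmod h)\<^sup>2 + t\<^sup>2 * (cmod h)\<^sup>2 * q)"
      by (simp flip: complex_norm_square)
    finally show ?thesis using psd_op_nonneg[OF T, of ?z] by simp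
  qed
  have "(cmod h)\<^sup>2 \<le> p * q"
  proof (cases "q = 0")
    case True
    show ?thesis
    proof (cases "h = 0")
      case False
      then have "0 < (cmod h)\<^sup>2" by simp
      \<comment> \<open>With q = 0 the expression is affine in t; this t gives it the negative value
        - p - 2.\<close>
      moreover have "0 \<le> p - 2 * ((p + 1) / (cmod h)\<^sup>2) * (cmod h)\<^sup>2"
        using ineq[of "(p + 1) / (cmod h)\<^sup>2"] True by simp
      ultimately show ?thesis using p0 by simp
    qed (use True in simp)
  next
    case False
    then have q: "0 < q" using q0 by simp
    \<comment> \<open>The choice t = 1 / q minimises the quadratic.\<close>
    have "0 \<le> p - 2 * (1 / q) * (cmod h)\<^sup>2 + (1 / q)\<^sup>2 * (cmod h)\<^sup>2 * q" by (rule ineq)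
    also have "\<dots> = p - (cmod h)\<^sup>2 / q"
      using q by (simp add: power2_eq_square field_simps)
    finally show ?thesis using q by (simp add: field_simps)
  qed
  then show ?thesis unfolding h_def p_def q_def .
qed

section \<open>Moments of the spectral measure of a positive operator at a vector\<close>

definition moment :: "nat \<Rightarrow> ((nat \<Rightarrow> complex) \<Rightarrow> nat \<Rightarrow> complex) \<Rightarrow> (nat \<Rightarrow> complex) \<Rightarrow> nat \<Rightarrow> real" where
  "moment d T u k = Re (cdot d u ((T ^^ k) u))"

lemma moment_0: "moment d T u 0 = (\<Sum>i<d. (cmod (u i))\<^sup>2)"
  by (simp add: moment_def cdot_self)

lemma cdot_pow_pow:
  "psd_op d T \<Longrightarrow> cdot d ((T ^^ a) u) ((T ^^ b) v) = cdot d u ((T ^^ (a + b)) v)"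
  by (simp add: psd_op_pow_herm funpow_add)

lemma cdot_pow_eq_moment:
  assumes T: "psd_op d T"
  shows "cdot d u ((T ^^ k) u) = of_real (moment d T u k)"
proof -
  have "cnj (cdot d u ((T ^^ k) u)) = cdot d u ((T ^^ k) u)"
    by (simp add: cnj_cdot psd_op_pow_herm[OF T])
  then show ?thesis by (metis Reals_cnj_iff moment_def of_real_Re)
qed

lemma moment_even: "psd_op d T \<Longrightarrow> moment d T u (j + j) = moment d T ((T ^^ j) u) 0"
  using cdot_pow_pow[of d T j u j u] by (simp add: moment_def)

lemma moment_odd: "psd_op d T \<Longrightarrow> moment d T u (Suc (j + j)) = Re (cdot d ((T ^^ j) u) (T ((T ^^ j) u)))"
  using cdot_pow_pow[of d T j u "Suc j" u] by (simp add: moment_def)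

text \<open>Cauchy-Schwarz with T^(k+1) shared between two vectors. For k = 2j the standard inner
  product is used on T^j u and T^(j+1) u, for k = 2j + 1 the form of \<open>T\<close> on the same
  vectors; treating the parities separately avoids a square root of \<open>T\<close>.\<close>

lemma logconvex_moment:
  assumes T: "psd_op d T"
  shows "logconvex_seq (moment d T u)"
proof -
  have cases: "\<exists>j. k = j + j \<or> k = Suc (j + j)" for k :: nat by presburger
  have "0 \<le> moment d T u k" for k
  proof -
    from cases[of k] obtain j where "k = j + j \<or> k = Suc (j + j)" by blast
    then show ?thesis
      using moment_even[OF T, of u j] moment_odd[OF T, of u j] psd_op_nonneg[OF T]
        psd_op_nonneg[OF psd_op_id] by (auto simp: moment_0 sum_nonneg)
  qed
  moreover have "(moment d T u (Suc k))\<^sup>2 \<le> moment d T u k * moment d T u (Suc (Suc k))" for k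
  proof -
    have sq: "(moment d T u (Suc k))\<^sup>2 = (cmod (cdot d u ((T ^^ Suc k) u)))\<^sup>2"
      by (simp only: cdot_pow_eq_moment[OF T] norm_of_real power2_abs)
    from cases[of k] obtain j where j: "k = j + j \<or> k = Suc (j + j)" by blast
    then show ?thesis
    proof
      assume k: "k = j + j"
      have "(moment d T u (Suc k))\<^sup>2 = (cmod (cdot d ((T ^^ j) u) ((T ^^ Suc j) u)))\<^sup>2"
        using sq cdot_pow_pow[OF T, of j u "Suc j" u] k by simp
      also have "\<dots> \<le> Re (cdot d ((T ^^ j) u) ((T ^^ j) u)) * Re (cdot d ((T ^^ Suc j) u) ((T ^^ Suc j) u))"
        by (rule psd_op_Cauchy_Schwarz[OF psd_op_id])
      also have "\<dots> = moment d T u k * moment d T u (Suc (Suc k))"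
        unfolding cdot_pow_pow[OF T] moment_def k by simp
      finally show ?thesis .
    next
      assume k: "k = Suc (j + j)"
      have "(moment d T u (Suc k))\<^sup>2 = (cmod (cdot d ((T ^^ j) u) (T ((T ^^ Suc j) u))))\<^sup>2"
        using sq cdot_pow_pow[OF T, of j u "Suc (Suc j)" u] k by simp
      also have "\<dots> \<le> Re (cdot d ((T ^^ j) u) (T ((T ^^ j) u))) * Re (cdot d ((T ^^ Suc j) u) (T ((T ^^ Suc j) u)))"
        by (rule psd_op_Cauchy_Schwarz[OF T])
      also have "\<dots> = moment d T u k * moment d T u (Suc (Suc k))"
        using moment_odd[OF T, of u j] moment_odd[OF T, of u "Suc j"] k by simp
      finally show ?thesis .
    qed
  qed
  ultimately show ?thesis unfolding logconvex_seq_def by blast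
qed

lemma moment_nonneg: "psd_op d T \<Longrightarrow> 0 \<le> moment d T u k"
  using logconvex_moment unfolding logconvex_seq_def by blast

definition op_le :: "nat \<Rightarrow> ((nat \<Rightarrow> complex) \<Rightarrow> nat \<Rightarrow> complex) \<Rightarrow> real \<Rightarrow> bool" where
  "op_le d T c \<longleftrightarrow> (\<forall>x. Re (cdot d x (T x)) \<le> c * Re (cdot d x x))"

text \<open>For even k = 2j this is the form bound at T^j u. For odd k the bound at the next even
  index is pulled back by log-convexity: s(k+1)^2 <= s(k) s(k+2) <= c s(k) s(k+1).\<close>

lemma moment_Suc_le:
  assumes T: "psd_op d T" and le: "op_le d T c" and c: "0 \<le> c"
  shows "moment d T u (Suc k) \<le> c * moment d T u k"
proof -
  have odd: "moment d T u (Suc (j + j)) \<le> c * moment d T u (j + j)" for j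
  proof -
    have "moment d T u (j + j) = Re (cdot d ((T ^^ j) u) ((T ^^ j) u))"
      using moment_even[OF T] by (simp add: moment_def)
    then show ?thesis using le unfolding moment_odd[OF T] op_le_def by simp
  qed
  have "\<exists>j. k = j + j \<or> k = Suc (j + j)" by presburger
  then obtain j where "k = j + j \<or> k = Suc (j + j)" by blast
  then show ?thesis
  proof
    assume k: "k = Suc (j + j)"
    let ?s = "moment d T u"
    show ?thesis
    proof (cases "?s (Suc k) = 0")
      case True
      then show ?thesis using moment_nonneg[OF T] c by simp
    next
      case False
      then have pos: "0 < ?s (Suc k)" using moment_nonneg[OF T, of u "Suc k"] by simp
      have "?s (Suc k) * ?s (Suc k) \<le> ?s k * ?s (Suc (Suc k))"
        using logconvex_moment[OF T, of u] unfolding logconvex_seq_def power2_eq_square by blast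
      also have "\<dots> \<le> ?s k * (c * ?s (Suc k))"
        using odd[of "Suc j"] k by (intro mult_left_mono moment_nonneg[OF T]) simp
      also have "\<dots> = (c * ?s k) * ?s (Suc k)" by simp
      finally have "?s (Suc k) * ?s (Suc k) \<le> (c * ?s k) * ?s (Suc k)" .
      then show ?thesis using pos by (rule mult_right_le_imp_le)
    qed
  qed (use odd in simp)
qed

text \<open>The Sherman--Morrison formula: if \<open>T\<close> is the inverse of \<open>H\<close>, then \<open>downdate d u T\<close> is the
  inverse of \<open>H + u u\<^sup>*\<close>.\<close>

definition downdate ::
  "nat \<Rightarrow> (nat \<Rightarrow> complex) \<Rightarrow> ((nat \<Rightarrow> complex) \<Rightarrow> nat \<Rightarrow> complex) \<Rightarrow> (nat \<Rightarrow> complex) \<Rightarrow> nat \<Rightarrow> complex" where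
  "downdate d u T x = (\<lambda>i. T x i - (cdot d (T u) x / (1 + cdot d u (T u))) * T u i)"

lemma cdot_downdate:
  assumes T: "psd_op d T"
  shows "cdot d x (downdate d u T y) =
    cdot d x (T y) - cdot d (T u) y * cdot d x (T u) / of_real (1 + moment d T u 1)"
proof -
  have "cdot d u (T u) = of_real (moment d T u 1)"
    using cdot_pow_eq_moment[OF T, of u 1] by simp
  then show ?thesis
    unfolding downdate_def cdot_diff_right by simp
qed

lemma moment_1_pos: "psd_op d T \<Longrightarrow> 0 < 1 + moment d T u 1"
  using moment_nonneg[of d T u 1] by linarith

lemma Re_cdot_downdate:
  assumes T: "psd_op d T"
  shows "Re (cdot d x (downdate d u T x)) =
    Re (cdot d x (T x)) - (cmod (cdot d x (T u)))\<^sup>2 / (1 + moment d T u 1)"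
proof -
  have "cdot d (T u) x * cdot d x (T u) = of_real ((cmod (cdot d x (T u)))\<^sup>2)"
    unfolding complex_norm_square cnj_cdot by simp
  then show ?thesis
    by (simp only: cdot_downdate[OF T] flip: of_real_divide) simp
qed

text \<open>Positivity survives because Cauchy-Schwarz for the form of \<open>T\<close> bounds the
  squared cross term by the form at \<open>x\<close> times \<open>moment d T u 1\<close>, while the
  subtracted term divides it by one more than that moment.\<close>

lemma psd_op_downdate:
  assumes T: "psd_op d T"
  shows "psd_op d (downdate d u T)"
  unfolding psd_op_def
proof (intro conjI allI)
  fix x y a
  show "downdate d u T (\<lambda>i. x i + a * y i) = (\<lambda>i. downdate d u T x i + a * downdate d u T y i)"
    by (simp add: downdate_def psd_op_add[OF T] cdot_add_right fun_eq_iff algebra_simps add_divide_distrib)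
next
  fix x y
  have "cdot d (downdate d u T x) y = cnj (cdot d y (downdate d u T x))"
    by (simp add: cnj_cdot)
  also have "\<dots> = cdot d x (downdate d u T y)"
    by (simp add: cdot_downdate[OF T] cnj_cdot psd_op_herm[OF T])
  finally show "cdot d (downdate d u T x) y = cdot d x (downdate d u T y)" .
next
  fix x
  let ?s = "moment d T u 1" and ?q = "Re (cdot d x (T x))"
  have s: "0 \<le> ?s" by (rule moment_nonneg[OF T])
  have q: "0 \<le> ?q" by (rule psd_op_nonneg[OF T])
  have "(cmod (cdot d x (T u)))\<^sup>2 \<le> ?q * ?s"
    using psd_op_Cauchy_Schwarz[OF T, of x u] by (simp add: moment_def)
  also have "\<dots> \<le> ?q * (1 + ?s)" using q by (intro mult_left_mono) auto
  finally have "(cmod (cdot d x (T u)))\<^sup>2 / (1 + ?s) \<le> ?q"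
    using s by (simp add: pos_divide_le_eq)
  then show "0 \<le> Re (cdot d x (downdate d u T x))"
    unfolding Re_cdot_downdate[OF T] by simp
qed

lemma op_le_downdate:
  assumes T: "psd_op d T" and le: "op_le d T c"
  shows "op_le d (downdate d u T) c"
  unfolding op_le_def
proof
  fix x
  have "Re (cdot d x (downdate d u T x)) \<le> Re (cdot d x (T x))"
    unfolding Re_cdot_downdate[OF T] using moment_1_pos[OF T, of u] by simp
  then show "Re (cdot d x (downdate d u T x)) \<le> c * Re (cdot d x x)"
    using le unfolding op_le_def by (meson order_trans)
qed

text \<open>On \<open>u\<close> itself the update is a mere rescaling. This turns T - D, with D the
  updated operator, into the rank one map sending z to \<open>cdot d (T u) z\<close> times D
  u.\<close>

lemma downdate_self:
  assumes T: "psd_op d T"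
  shows "downdate d u T u = (\<lambda>i. T u i / of_real (1 + moment d T u 1))"
proof -
  have "1 + complex_of_real (moment d T u 1) \<noteq> 0"
    using moment_1_pos[OF T, of u] by (metis less_irrefl of_real_1 of_real_add of_real_eq_0_iff)
  then show ?thesis
    using cdot_pow_eq_moment[OF T, of u 1]
    by (simp add: downdate_def fun_eq_iff psd_op_herm[OF T] field_simps)
qed

text \<open>Here \<open>h\<close> stands for H y with H the inverse of \<open>T\<close>, so the
  argument of \<open>downdate d u T\<close> is H y + u u^* y.\<close>

lemma downdate_inverse:
  assumes T: "psd_op d T" and inv: "T h = y"
  shows "downdate d u T (\<lambda>i. h i + cdot d u y * u i) = y"
proof -
  have n0: "1 + complex_of_real (moment d T u 1) \<noteq> 0"
    using moment_1_pos[OF T, of u] by (metis less_irrefl of_real_1 of_real_add of_real_eq_0_iff)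
  have "downdate d u T h = (\<lambda>i. y i - (cdot d u y / of_real (1 + moment d T u 1)) * T u i)"
    using cdot_pow_eq_moment[OF T, of u 1] by (simp add: downdate_def psd_op_herm[OF T] inv)
  then show ?thesis
    using n0 by (simp add: psd_op_add[OF psd_op_downdate[OF T]] downdate_self[OF T] fun_eq_iff)
qed

section \<open>The trace of a power under a rank one update\<close>

definition op_trace :: "nat \<Rightarrow> ((nat \<Rightarrow> complex) \<Rightarrow> nat \<Rightarrow> complex) \<Rightarrow> nat \<Rightarrow> real" where
  "op_trace d T p = (\<Sum>j<d. moment d T (axis_vec j) p)"

text \<open>Noncommutative telescoping: T^p - D^p is the sum of D^i (T - D) T^(p-1-i), and T - D has
  rank one. The trace of each rank one summand is an inner product of a power of \<open>T\<close>
  and a power of \<open>D\<close> applied to \<open>u\<close>.\<close>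

lemma op_trace_downdate:
  assumes T: "psd_op d T" and D_def: "D = downdate d u T"
  shows "op_trace d T p - op_trace d D p = (\<Sum>i<p. Re (cdot d ((T ^^ (p - i)) u) ((D ^^ Suc i) u)))"
proof -
  have D: "psd_op d D" unfolding D_def by (rule psd_op_downdate[OF T])
  let ?c = "complex_of_real (1 + moment d T u 1)"
  have diff: "(D ^^ i) (T z) j - (D ^^ i) (D z) j = cdot d (T u) z * (D ^^ Suc i) u j" for i z j
  proof -
    have "D z = (\<lambda>i. T z i - cdot d (T u) z * (T u i / ?c))"
      unfolding D_def downdate_def using cdot_pow_eq_moment[OF T, of u 1] by simp
    also have "\<dots> = (\<lambda>i. T z i - cdot d (T u) z * D u i)"
      using downdate_self[OF T, of u] unfolding D_def by simp
    finally have "(D ^^ i) (D z) = (\<lambda>k. (D ^^ i) (T z) k - cdot d (T u) z * (D ^^ i) (D u) k)"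
      by (simp add: psd_op_pow_diff[OF D])
    then show ?thesis by (simp add: funpow_swap1)
  qed
  have tele: "(T ^^ p) x j - (D ^^ p) x j = (\<Sum>i<p. cdot d (T u) ((T ^^ (p - Suc i)) x) * (D ^^ Suc i) u j)" for x j
  proof -
    let ?f = "\<lambda>i. (D ^^ i) ((T ^^ (p - i)) x) j"
    have "(\<Sum>i<p. cdot d (T u) ((T ^^ (p - Suc i)) x) * (D ^^ Suc i) u j) = (\<Sum>i<p. ?f i - ?f (Suc i))"
    proof (rule sum.cong[OF refl])
      fix i assume "i \<in> {..<p}"
      then have "p - i = Suc (p - Suc i)" by auto
      then have "(T ^^ (p - i)) x = T ((T ^^ (p - Suc i)) x)" by simp
      then show "cdot d (T u) ((T ^^ (p - Suc i)) x) * (D ^^ Suc i) u j = ?f i - ?f (Suc i)"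
        using diff[of i "(T ^^ (p - Suc i)) x" j] by (simp add: funpow_swap1)
    qed
    also have "\<dots> = ?f 0 - ?f p" by (rule sum_lessThan_telescope')
    finally show ?thesis by simp
  qed
  have pw: "(T ^^ (p - i)) u = (T ^^ (p - Suc i)) (T u)" if "i < p" for i
    using that by (metis Suc_diff_Suc comp_apply funpow_Suc_right)
  have "op_trace d T p - op_trace d D p
      = (\<Sum>j<d. Re ((T ^^ p) (axis_vec j) j - (D ^^ p) (axis_vec j) j))"
    by (simp add: op_trace_def moment_def cdot_axis_left sum_subtractf)
  also have "\<dots> = (\<Sum>j<d. Re (\<Sum>i<p. cnj ((T ^^ (p - i)) u j) * (D ^^ Suc i) u j))"
  proof (intro sum.cong refl arg_cong[where f = Re])
    fix j assume j: "j \<in> {..<d}"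
    show "(T ^^ p) (axis_vec j) j - (D ^^ p) (axis_vec j) j = (\<Sum>i<p. cnj ((T ^^ (p - i)) u j) * (D ^^ Suc i) u j)"
      unfolding tele
    proof (intro sum.cong refl)
      fix i assume i: "i \<in> {..<p}"
      have "cdot d (T u) ((T ^^ (p - Suc i)) (axis_vec j)) = cnj ((T ^^ (p - i)) u j)"
        using i j by (simp add: psd_op_pow_herm[OF T, symmetric] cdot_axis_right pw)
      then show "cdot d (T u) ((T ^^ (p - Suc i)) (axis_vec j)) * (D ^^ Suc i) u j
          = cnj ((T ^^ (p - i)) u j) * (D ^^ Suc i) u j" by simp
    qed
  qed
  also have "\<dots> = Re (\<Sum>i<p. \<Sum>j<d. cnj ((T ^^ (p - i)) u j) * (D ^^ Suc i) u j)"
    unfolding Re_sum[symmetric] by (subst sum.swap) simp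
  finally show ?thesis unfolding cdot_def Re_sum .
qed

text \<open>The decrease is a sum of mixed moments of T and D of total order p + 1. To first order
  each equals \<open>moment d T u (Suc p)\<close>; replacing the i + 1 factors D by T costs at most
  i + 1 times s(0) s(p+2). Summation gives the factor p (p + 1) / 2, and s(p+2) <= c s(p+1) absorbs
  the higher moment.\<close>

lemma op_trace_downdate_le:
  assumes T: "psd_op d T" and le: "op_le d T c" and c: "0 \<le> c"
  shows "op_trace d (downdate d u T) p
    \<le> op_trace d T p - real p * (1 - (real p + 1) * c * moment d T u 0 / 2) * moment d T u (Suc p)"
proof -
  define D where "D = downdate d u T"
  have D: "psd_op d D" unfolding D_def by (rule psd_op_downdate[OF T])
  let ?s = "moment d T u" and ?s' = "moment d D u"
  define t where "t = (\<lambda>a b. Re (cdot d ((T ^^ a) u) ((D ^^ b) u)))"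
  have s0: "0 \<le> ?s k" "0 \<le> ?s' k" for k
    using moment_nonneg[OF T] moment_nonneg[OF D] by auto
  have t0: "t a 0 = ?s a" for a
    by (simp add: t_def moment_def psd_op_pow_herm[OF T])
  have t1: "t 0 b = ?s' b" for b by (simp add: t_def moment_def)
  \<comment> \<open>One factor D is traded for T: with z = D^b u, the coefficient of T u in the
    update of z is (D u)^* z, a moment of D.\<close>
  have rec: "t a (Suc b) = t (Suc a) b - ?s (Suc a) * ?s' (Suc b)" for a b
  proof -
    let ?z = "(D ^^ b) u"
    have e: "cdot d (T u) ?z / of_real (1 + ?s 1) = of_real (?s' (Suc b))"
    proof -
      have "of_real (?s' (Suc b)) = cdot d u (D ?z)"
        using cdot_pow_eq_moment[OF D, of u "Suc b"] by simp
      also have "\<dots> = cdot d (D u) ?z" by (simp add: psd_op_herm[OF D])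
      also have "\<dots> = cdot d (\<lambda>i. (1 / of_real (1 + ?s 1)) * T u i) ?z"
        unfolding D_def downdate_self[OF T] by simp
      also have "\<dots> = cdot d (T u) ?z / of_real (1 + ?s 1)"
        unfolding cdot_scale_left by simp
      finally show ?thesis by simp
    qed
    have f: "cdot d ((T ^^ a) u) (T u) = of_real (?s (Suc a))"
      using cdot_pow_pow[OF T, of a u 1 u] cdot_pow_eq_moment[OF T, of u "Suc a"] by simp
    have "cdot d ((T ^^ a) u) ((D ^^ Suc b) u) = cdot d ((T ^^ a) u) (downdate d u T ?z)"
      by (simp add: D_def)
    also have "\<dots> = cdot d ((T ^^ a) u) (T ?z)
        - (cdot d (T u) ?z / of_real (1 + ?s 1)) * cdot d ((T ^^ a) u) (T u)"
      unfolding cdot_downdate[OF T] by simp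
    also have "\<dots> = cdot d ((T ^^ Suc a) u) ?z - of_real (?s (Suc a) * ?s' (Suc b))"
      unfolding e f by (simp add: psd_op_herm[OF T])
    finally show ?thesis unfolding t_def by simp
  qed
  have up: "t a b \<le> ?s (a + b)" for a b
  proof (induction b arbitrary: a)
    case (Suc b)
    have "t a (Suc b) \<le> t (Suc a) b" unfolding rec using s0 by simp
    also have "\<dots> \<le> ?s (a + Suc b)" using Suc[of "Suc a"] by simp
    finally show ?case .
  qed (simp add: t0)
  have s'_le: "?s' b \<le> ?s b" for b using up[of 0 b] by (simp add: t1)
  \<comment> \<open>Each trade loses a product of two moments; by \<open>s'_le\<close> and
    log-convexity it is at most s(0) times one moment of \<open>T\<close>.\<close>
  have low: "?s (a + b) - real b * ?s 0 * ?s (Suc (a + b)) \<le> t a b" for a b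
  proof (induction b arbitrary: a)
    case (Suc b)
    have "?s (Suc a) * ?s' (Suc b) \<le> ?s (Suc a) * ?s (Suc b)"
      by (intro mult_left_mono s'_le s0)
    also have "\<dots> \<le> ?s 0 * ?s (Suc a + Suc b)"
      by (rule logconvex_seq_mult_le[OF logconvex_moment[OF T]])
    finally show ?case using Suc[of "Suc a"] unfolding rec by (simp add: algebra_simps)
  qed (simp add: t0)
  have "(\<Sum>i<p. ?s (Suc p) - real (Suc i) * ?s 0 * ?s (Suc (Suc p))) \<le> (\<Sum>i<p. t (p - i) (Suc i))"
  proof (rule sum_mono)
    fix i assume "i \<in> {..<p}"
    then have "p - i + Suc i = Suc p" by simp
    then show "?s (Suc p) - real (Suc i) * ?s 0 * ?s (Suc (Suc p)) \<le> t (p - i) (Suc i)"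
      using low[of "p - i" "Suc i"] by metis
  qed
  also have "\<dots> = op_trace d T p - op_trace d D p"
    unfolding t_def D_def op_trace_downdate[OF T refl] ..
  finally have A: "(\<Sum>i<p. ?s (Suc p) - real (Suc i) * ?s 0 * ?s (Suc (Suc p))) \<le> op_trace d T p - op_trace d D p" .
  have "(\<Sum>i<p. A - real (Suc i) * B) = real p * A - real p * (real p + 1) / 2 * B" for A B
    by (induction p) (simp_all add: algebra_simps add_divide_distrib)
  then have "(\<Sum>i<p. ?s (Suc p) - real (Suc i) * (?s 0 * ?s (Suc (Suc p))))
      = real p * ?s (Suc p) - real p * (real p + 1) / 2 * (?s 0 * ?s (Suc (Suc p)))" .
  moreover have "real p * (real p + 1) / 2 * (?s 0 * ?s (Suc (Suc p)))
      \<le> real p * (real p + 1) / 2 * (?s 0 * (c * ?s (Suc p)))"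
    by (intro mult_left_mono moment_Suc_le[OF T le c] s0) auto
  moreover have "real p * (1 - (real p + 1) * c * ?s 0 / 2) * ?s (Suc p)
      = real p * ?s (Suc p) - real p * (real p + 1) / 2 * (?s 0 * (c * ?s (Suc p)))"
    by (simp add: field_simps)
  ultimately show ?thesis using A unfolding D_def mult.assoc by linarith
qed

section \<open>Inverses of L + sum of u u^* built by successive rank one updates\<close>

primrec resolvent ::
  "nat \<Rightarrow> real \<Rightarrow> (nat \<Rightarrow> nat \<Rightarrow> complex) \<Rightarrow> nat \<Rightarrow> (nat \<Rightarrow> complex) \<Rightarrow> nat \<Rightarrow> complex" where
  "resolvent d L U 0 = (\<lambda>x i. x i / of_real L)"
| "resolvent d L U (Suc k) = downdate d (U k) (resolvent d L U k)"

lemma resolvent_cong: "(\<And>j. j < k \<Longrightarrow> U j = V j) \<Longrightarrow> resolvent d L U k = resolvent d L V k"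
  by (induction k) auto

lemma psd_op_resolvent:
  assumes "0 < L"
  shows "psd_op d (resolvent d L U k)"
proof (induction k)
  case 0
  have e: "cdot d x (\<lambda>i. y i / of_real L) = cdot d x y / of_real L"
    "cdot d (\<lambda>i. x i / of_real L) y = cdot d x y / of_real L" for x y
    using cdot_scale_right[of d x "1 / of_real L" y] cdot_scale_left[of d "1 / of_real L" x y] by simp_all
  show ?case
    unfolding psd_op_def
  proof (intro conjI allI)
    show "0 \<le> Re (cdot d x (resolvent d L U 0 x))" for x
      using assms psd_op_nonneg[OF psd_op_id, of d x] by (simp add: e)
  qed (simp_all add: e add_divide_distrib)
next
  case (Suc k) then show ?case by (simp add: psd_op_downdate)
qed

lemma op_le_resolvent:
  assumes "0 < L"
  shows "op_le d (resolvent d L U k) (1 / L)"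
proof (induction k)
  case 0
  show ?case
    using cdot_scale_right[of d _ "1 / of_real L"] by (simp add: op_le_def)
next
  case (Suc k) then show ?case by (simp add: op_le_downdate psd_op_resolvent assms)
qed

text \<open>This identifies the recursion as the inverse of the shifted sum, obtained by iterating
  \<open>downdate_inverse\<close>. The lower bound on the potential rests on this relation.\<close>

lemma resolvent_inverse:
  assumes "0 < L"
  shows "resolvent d L U k (\<lambda>i. of_real L * y i + (\<Sum>j<k. cdot d (U j) y * U j i)) = y"
proof (induction k)
  case 0
  show ?case using assms by simp
next
  case (Suc k)
  from downdate_inverse[OF psd_op_resolvent[OF assms] this, of "U k"]
  show ?case by (simp add: add.assoc)
qed

section \<open>Comparison of the potential with the smallest eigenvalue\<close>

lemma psd_op_pow:
  assumes "psd_op d T"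
  shows "psd_op d (T ^^ p)"
  unfolding psd_op_def
proof (intro conjI allI)
  show "(T ^^ p) (\<lambda>i. x i + a * y i) = (\<lambda>i. (T ^^ p) x i + a * (T ^^ p) y i)" for x y a
    by (induction p) (simp_all add: psd_op_add[OF assms])
qed (use assms moment_nonneg[OF assms] in \<open>auto simp: psd_op_pow_herm moment_def\<close>)

text \<open>The largest eigenvalue of the positive matrix T^p is at most its trace. Cauchy-Schwarz
  for the form of T^p bounds the i-th entry of T^p y by the square roots of the i-th diagonal entry
  and of the left-hand side; inserting this gives a bound on the square of the left-hand side, from
  which one factor is cancelled.\<close>

lemma moment_le_op_trace:
  assumes T: "psd_op d T"
  shows "moment d T y p \<le> moment d T y 0 * op_trace d T p"
proof -
  let ?q = "moment d T y p"
  let ?t = "\<lambda>i. moment d T (axis_vec i) p"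
  have q0: "0 \<le> ?q" and t0: "0 \<le> ?t i" for i using moment_nonneg[OF T] by auto
  have entry: "cmod ((T ^^ p) y i) \<le> sqrt (?t i) * sqrt ?q" if "i < d" for i
  proof -
    have "(cmod ((T ^^ p) y i))\<^sup>2 \<le> ?t i * ?q"
      using psd_op_Cauchy_Schwarz[OF psd_op_pow[OF T, of p], of "axis_vec i" y] that
      by (simp add: cdot_axis_left moment_def)
    then have "cmod ((T ^^ p) y i) \<le> sqrt (?t i * ?q)" by (rule real_le_rsqrt)
    then show ?thesis by (simp add: real_sqrt_mult)
  qed
  have "?q \<le> cmod (cdot d y ((T ^^ p) y))" unfolding moment_def by (rule complex_Re_le_cmod)
  also have "\<dots> \<le> (\<Sum>i<d. cmod (y i) * cmod ((T ^^ p) y i))"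
    unfolding cdot_def by (rule sum_norm_le) (simp add: norm_mult)
  also have "\<dots> \<le> (\<Sum>i<d. cmod (y i) * (sqrt (?t i) * sqrt ?q))"
    by (intro sum_mono mult_left_mono entry) auto
  also have "\<dots> = (\<Sum>i<d. cmod (y i) * sqrt (?t i)) * sqrt ?q"
    by (simp add: sum_distrib_right mult.assoc)
  finally have "?q\<^sup>2 \<le> ((\<Sum>i<d. cmod (y i) * sqrt (?t i)) * sqrt ?q)\<^sup>2"
    using q0 by (intro power_mono)
  also have "\<dots> = (\<Sum>i<d. cmod (y i) * sqrt (?t i))\<^sup>2 * ?q"
    using q0 by (simp add: power_mult_distrib)
  also have "\<dots> \<le> ((\<Sum>i<d. (cmod (y i))\<^sup>2) * (\<Sum>i<d. (sqrt (?t i))\<^sup>2)) * ?q"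
    by (intro mult_right_mono Cauchy_Schwarz_ineq_sum q0)
  also have "\<dots> = (moment d T y 0 * op_trace d T p) * ?q"
    using t0 by (simp add: moment_0 op_trace_def)
  finally have main: "?q * ?q \<le> (moment d T y 0 * op_trace d T p) * ?q" by (simp add: power2_eq_square)
  show ?thesis
  proof (cases "?q = 0")
    case True
    have "0 \<le> op_trace d T p" unfolding op_trace_def by (intro sum_nonneg t0)
    then show ?thesis using True moment_nonneg[OF T, of y 0] by simp
  next
    case False
    then show ?thesis using main q0 by (intro mult_right_le_imp_le[OF main]) simp
  qed
qed

text \<open>The vector \<open>y\<close> certifies that the smallest eigenvalue of H = L + sum of u
  u^* is at most \<open>b\<close>, so its inverse has an eigenvalue of at least 1 / b and the trace
  of the p-th power is at least that of this eigenvalue alone. The proof follows this with forms in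
  place of eigenvalues.\<close>

lemma op_trace_resolvent_ge:
  assumes L: "0 < L" and b: "0 < b" and y: "0 < (\<Sum>i<d. (cmod (y i))\<^sup>2)"
    and small: "(\<Sum>j<k. (cmod (cdot d (U j) y))\<^sup>2) \<le> (b - L) * (\<Sum>i<d. (cmod (y i))\<^sup>2)"
  shows "1 / b ^ p \<le> op_trace d (resolvent d L U k) p"
proof -
  define T where "T = resolvent d L U k"
  define Y where "Y = (\<Sum>i<d. (cmod (y i))\<^sup>2)"
  have T: "psd_op d T" unfolding T_def by (rule psd_op_resolvent[OF L])
  let ?s = "moment d T y"
  let ?h = "\<lambda>i. of_real L * y i + (\<Sum>j<k. cdot d (U j) y * U j i)"
  have Th: "T ?h = y" unfolding T_def by (rule resolvent_inverse[OF L])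
  have yy: "cdot d y y = of_real Y" by (simp add: cdot_self Y_def)
  have s0: "?s 0 = Y" by (simp add: moment_0 Y_def)
  have "cdot d y ?h = of_real L * of_real Y + (\<Sum>j<k. cdot d (U j) y * cdot d y (U j))"
  proof -
    have "cdot d y ?h = cdot d y (\<lambda>i. of_real L * y i) + cdot d y (\<lambda>i. \<Sum>j<k. cdot d (U j) y * U j i)"
      by (simp add: cdot_def sum.distrib algebra_simps)
    also have "cdot d y (\<lambda>i. \<Sum>j<k. cdot d (U j) y * U j i) = (\<Sum>j<k. cdot d y (\<lambda>i. cdot d (U j) y * U j i))"
      unfolding cdot_def sum_distrib_left by (rule sum.swap)
    finally show ?thesis by (simp add: cdot_scale_right yy)
  qed
  also have "(\<Sum>j<k. cdot d (U j) y * cdot d y (U j)) = of_real (\<Sum>j<k. (cmod (cdot d (U j) y))\<^sup>2)"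
    unfolding of_real_sum complex_norm_square cnj_cdot ..
  finally have yh: "Re (cdot d y ?h) = L * Y + (\<Sum>j<k. (cmod (cdot d (U j) y))\<^sup>2)"
    by simp
  then have h: "Re (cdot d y ?h) \<le> b * Y"
    using small unfolding Y_def[symmetric] by (simp add: algebra_simps)
  \<comment> \<open>Since y = T H y, Cauchy-Schwarz for the form of \<open>T\<close> gives |y|^4 <=
    (y^* T y) (y^* H y), which bounds the first moment below.\<close>
  have "Y\<^sup>2 = (cmod (cdot d y (T ?h)))\<^sup>2" by (simp add: Th yy)
  also have "\<dots> \<le> Re (cdot d y (T y)) * Re (cdot d ?h (T ?h))"
    by (rule psd_op_Cauchy_Schwarz[OF T])
  also have "Re (cdot d ?h (T ?h)) = Re (cdot d y ?h)"
    unfolding Th by (subst cnj_cdot[symmetric]) simp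
  also have "Re (cdot d y (T y)) * Re (cdot d y ?h) \<le> ?s 1 * (b * Y)"
    using h moment_nonneg[OF T, of y 1] by (simp add: moment_def mult_left_mono)
  finally have "Y * Y \<le> (b * ?s 1) * Y" by (simp add: power2_eq_square algebra_simps)
  then have "Y \<le> b * ?s 1" using y unfolding Y_def[symmetric] by (rule mult_right_le_imp_le)
  \<comment> \<open>The convex sequence \<open>b ^ k * s k\<close> starts with a nonnegative
    increment, so it never falls below its first term.\<close>
  then have "Y \<le> b ^ p * ?s p"
    using convex_seq_ge_initial[OF logconvex_seq_imp_convex_seq[OF logconvex_moment[OF T, of y], of b], of p] b s0
    by simp
  also have "\<dots> \<le> b ^ p * (Y * op_trace d T p)"
    using moment_le_op_trace[OF T, of y p] b s0 by (intro mult_left_mono) auto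
  finally have "1 * Y \<le> (b ^ p * op_trace d T p) * Y" by (simp add: algebra_simps)
  then have "1 \<le> b ^ p * op_trace d T p" using y unfolding Y_def[symmetric] by (rule mult_right_le_imp_le)
  then show ?thesis using b unfolding T_def by (simp add: field_simps)
qed

text \<open>Closes the recursion for the potential: for an eigenvalue x it reads x^(p+1) >= x^p / b
  - 1 / b^(p+1), which is \<open>convex_seq_lower\<close> for the powers of b x. It is applied to
  the moments of each coordinate vector.\<close>

lemma op_trace_Suc_ge:
  assumes T: "psd_op d T" and b: "0 < b"
  shows "op_trace d T p / b - real d / b ^ Suc p \<le> op_trace d T (Suc p)"
proof -
  have le: "moment d T (axis_vec i) p / b - 1 / b ^ Suc p \<le> moment d T (axis_vec i) (Suc p)" if "i < d" for i
  proof -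
    let ?s = "moment d T (axis_vec i)"
    have s0: "?s 0 = 1" using that by (simp add: moment_def cdot_axis_left) (simp add: axis_vec_def)
    have "b ^ p * ?s p - b ^ 0 * ?s 0 \<le> b ^ Suc p * ?s (Suc p)"
      using b moment_nonneg[OF T]
      by (intro convex_seq_lower[OF logconvex_seq_imp_convex_seq[OF logconvex_moment[OF T]]]) auto
    then show ?thesis using b s0 by (simp add: field_simps)
  qed
  have "(\<Sum>i<d. moment d T (axis_vec i) p / b - 1 / b ^ Suc p) \<le> (\<Sum>i<d. moment d T (axis_vec i) (Suc p))"
    by (intro sum_mono le) auto
  then show ?thesis by (simp add: op_trace_def sum_subtractf sum_divide_distrib)
qed

section \<open>Measurability of random operators\<close>

definition measurable_op :: "'b measure \<Rightarrow> nat \<Rightarrow> ('b \<Rightarrow> (nat \<Rightarrow> complex) \<Rightarrow> nat \<Rightarrow> complex) \<Rightarrow> bool" where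
  "measurable_op N d T \<longleftrightarrow>
     (\<forall>x. (\<forall>i<d. (\<lambda>\<omega>. x \<omega> i) \<in> borel_measurable N) \<longrightarrow>
          (\<forall>i<d. (\<lambda>\<omega>. T \<omega> (x \<omega>) i) \<in> borel_measurable N))"

lemma measurable_opD:
  "measurable_op N d T \<Longrightarrow> (\<And>i. i < d \<Longrightarrow> (\<lambda>\<omega>. x \<omega> i) \<in> borel_measurable N) \<Longrightarrow> i < d \<Longrightarrow>
    (\<lambda>\<omega>. T \<omega> (x \<omega>) i) \<in> borel_measurable N"
  unfolding measurable_op_def by blast

lemma measurable_cnj:
  assumes "f \<in> borel_measurable M"
  shows "(\<lambda>x. cnj (f x)) \<in> borel_measurable M"
  by (rule borel_measurable_continuous_on[OF _ assms]) (intro continuous_intros)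

lemma measurable_cdot:
  fixes x y :: "'b \<Rightarrow> nat \<Rightarrow> complex"
  assumes "\<And>i. i < d \<Longrightarrow> (\<lambda>\<omega>. x \<omega> i) \<in> borel_measurable N"
    and "\<And>i. i < d \<Longrightarrow> (\<lambda>\<omega>. y \<omega> i) \<in> borel_measurable N"
  shows "(\<lambda>\<omega>. cdot d (x \<omega>) (y \<omega>)) \<in> borel_measurable N"
  unfolding cdot_def
proof (rule borel_measurable_sum)
  fix i assume "i \<in> {..<d}"
  then have [measurable]: "(\<lambda>\<omega>. x \<omega> i) \<in> borel_measurable N" "(\<lambda>\<omega>. y \<omega> i) \<in> borel_measurable N"
    using assms by auto
  show "(\<lambda>\<omega>. cnj (x \<omega> i) * y \<omega> i) \<in> borel_measurable N"
    by (intro borel_measurable_times measurable_cnj[of "\<lambda>\<omega>. x \<omega> i"]) measurable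
qed

lemma measurable_op_downdate:
  assumes T: "measurable_op N d T" and u: "\<And>i. i < d \<Longrightarrow> (\<lambda>\<omega>. u \<omega> i) \<in> borel_measurable N"
  shows "measurable_op N d (\<lambda>\<omega>. downdate d (u \<omega>) (T \<omega>))"
  unfolding measurable_op_def downdate_def
proof (intro allI impI)
  fix x :: "'a \<Rightarrow> nat \<Rightarrow> complex" and i
  assume "\<forall>i<d. (\<lambda>\<omega>. x \<omega> i) \<in> borel_measurable N" and i: "i < d"
  then have x: "\<And>i. i < d \<Longrightarrow> (\<lambda>\<omega>. x \<omega> i) \<in> borel_measurable N" by auto
  note Tx = measurable_opD[OF T x] and Tu = measurable_opD[OF T u]
  show "(\<lambda>\<omega>. T \<omega> (x \<omega>) i - cdot d (T \<omega> (u \<omega>)) (x \<omega>) / (1 + cdot d (u \<omega>) (T \<omega> (u \<omega>))) * T \<omega> (u \<omega>) i)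
    \<in> borel_measurable N"
    using Tx[OF _ i] Tu[OF _ i] measurable_cdot[OF Tu x] measurable_cdot[OF u Tu]
    by (auto intro!: borel_measurable_diff borel_measurable_times borel_measurable_divide borel_measurable_add)
qed

text \<open>Iteration is the reason why \<open>measurable_op\<close> quantifies over random vectors:
  the inner power is a vector that depends on \<omega>.\<close>

lemma measurable_op_pow:
  assumes T: "measurable_op N d T"
  shows "measurable_op N d (\<lambda>\<omega>. T \<omega> ^^ p)"
proof (induction p)
  case (Suc p)
  show ?case
    unfolding measurable_op_def
  proof (intro allI impI)
    fix x :: "'a \<Rightarrow> nat \<Rightarrow> complex" and i
    assume "\<forall>i<d. (\<lambda>\<omega>. x \<omega> i) \<in> borel_measurable N" and i: "i < d"
    then have "\<And>i. i < d \<Longrightarrow> (\<lambda>\<omega>. (T \<omega> ^^ p) (x \<omega>) i) \<in> borel_measurable N"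
      using measurable_opD[OF Suc.IH] by blast
    from measurable_opD[OF T this i] show "(\<lambda>\<omega>. (T \<omega> ^^ Suc p) (x \<omega>) i) \<in> borel_measurable N"
      by simp
  qed
qed (simp add: measurable_op_def)

lemma measurable_op_resolvent:
  assumes "\<And>j i. j < k \<Longrightarrow> i < d \<Longrightarrow> (\<lambda>\<omega>. U \<omega> j i) \<in> borel_measurable N"
  shows "measurable_op N d (\<lambda>\<omega>. resolvent d L (U \<omega>) k)"
  using assms
proof (induction k)
  case 0
  show ?case unfolding measurable_op_def by auto
next
  case (Suc k)
  then show ?case by (auto intro!: measurable_op_downdate)
qed

lemma measurable_op_trace:
  assumes T: "measurable_op N d T"
  shows "(\<lambda>\<omega>. op_trace d (T \<omega>) p) \<in> borel_measurable N"
proof -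
  have "(\<lambda>\<omega>. cdot d (axis_vec j) ((T \<omega> ^^ p) (axis_vec j))) \<in> borel_measurable N" for j
    by (rule measurable_cdot[OF _ measurable_opD[OF measurable_op_pow[OF T]]]) simp_all
  then show ?thesis
    unfolding op_trace_def moment_def
    by (intro borel_measurable_sum measurable_compose[OF _ borel_measurable_Re]) 
qed

section \<open>The smallest eigenvalue of a sum of independent rank one matrices\<close>

text \<open>The mean of u u^* is the identity. The norm bound is imposed at every point because the
  drift estimate below is pointwise in the sample.\<close>

locale isotropic_vectors = prob_space M for M :: "'a measure" +
  fixes u :: "'a \<Rightarrow> nat \<Rightarrow> complex" and d :: nat and \<kappa> :: real
  assumes measurable_u: "\<And>i. i < d \<Longrightarrow> (\<lambda>x. u x i) \<in> borel_measurable M"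
    and norm_u: "\<And>x. (\<Sum>i<d. (cmod (u x i))\<^sup>2) \<le> \<kappa>"
    and isotropic: "\<And>i j. i < d \<Longrightarrow> j < d \<Longrightarrow> (\<integral>x. cnj (u x i) * u x j \<partial>M) = (if i = j then 1 else 0)"
begin

lemma integrable_u:
  assumes "i < d" "j < d"
  shows "integrable M (\<lambda>x. cnj (u x i) * u x j)"
proof (rule integrable_const_bound)
  have "cmod (u x i) * cmod (u x j) \<le> \<kappa>" for x
  proof -
    have "(cmod (u x k))\<^sup>2 \<le> \<kappa>" if "k < d" for k
      using norm_u[of x] member_le_sum[of k "{..<d}" "\<lambda>k. (cmod (u x k))\<^sup>2"] that by force
    from this[OF assms(1)] this[OF assms(2)]
    show ?thesis using sum_squares_bound[of "cmod (u x i)" "cmod (u x j)"] by linarith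
  qed
  then show "AE x in M. norm (cnj (u x i) * u x j) \<le> \<kappa>"
    by (simp add: norm_mult)
  show "(\<lambda>x. cnj (u x i) * u x j) \<in> borel_measurable M"
    using measurable_u assms
    by (intro borel_measurable_times measurable_cnj[of "\<lambda>x. u x i"]) auto
qed

text \<open>A moment is linear in the entries of u u^*, whose mean is the identity, so its mean is
  the trace of T^q.\<close>

lemma
  assumes T: "psd_op d T"
  shows integrable_moment: "integrable M (\<lambda>x. moment d T (u x) q)"
    and integral_moment: "(\<integral>x. moment d T (u x) q \<partial>M) = op_trace d T q"
proof -
  let ?c = "\<lambda>i j. cnj ((T ^^ q) (axis_vec i) j)"
  let ?f = "\<lambda>x. \<Sum>i<d. \<Sum>j<d. ?c i j * (cnj (u x i) * u x j)"
  have eq: "moment d T z q = Re (\<Sum>i<d. \<Sum>j<d. ?c i j * (cnj (z i) * z j))" for z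
  proof -
    have "(T ^^ q) z i = (\<Sum>j<d. ?c i j * z j)" if "i < d" for i
    proof -
      have "(T ^^ q) z i = cdot d ((T ^^ q) (axis_vec i)) z"
        using that by (simp add: psd_op_pow_herm[OF T] cdot_axis_left)
      then show ?thesis by (simp add: cdot_def)
    qed
    then show ?thesis
      unfolding moment_def cdot_def by (simp add: sum_distrib_left mult.left_commute)
  qed
  have int: "integrable M ?f"
    by (intro Bochner_Integration.integrable_sum integrable_mult_right integrable_u) auto
  show "integrable M (\<lambda>x. moment d T (u x) q)"
    unfolding eq by (rule integrable_Re[OF int])
  have "(\<integral>x. moment d T (u x) q \<partial>M) = Re (\<integral>x. ?f x \<partial>M)"
    unfolding eq by (rule integral_Re[OF int])
  also have "(\<integral>x. ?f x \<partial>M) = (\<Sum>i<d. \<integral>x. (\<Sum>j<d. ?c i j * (cnj (u x i) * u x j)) \<partial>M)"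
    by (intro Bochner_Integration.integral_sum Bochner_Integration.integrable_sum integrable_mult_right integrable_u) auto
  also have "\<dots> = (\<Sum>i<d. \<Sum>j<d. ?c i j * (if i = j then 1 else 0))"
  proof (intro sum.cong refl)
    fix i assume i: "i \<in> {..<d}"
    have "(\<integral>x. (\<Sum>j<d. ?c i j * (cnj (u x i) * u x j)) \<partial>M) = (\<Sum>j<d. \<integral>x. ?c i j * (cnj (u x i) * u x j) \<partial>M)"
      using i by (intro Bochner_Integration.integral_sum integrable_mult_right integrable_u) auto
    also have "\<dots> = (\<Sum>j<d. ?c i j * (if i = j then 1 else 0))"
      using i by (intro sum.cong refl) (simp add: isotropic)
    finally show "(\<integral>x. (\<Sum>j<d. ?c i j * (cnj (u x i) * u x j)) \<partial>M) = (\<Sum>j<d. ?c i j * (if i = j then 1 else 0))" .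
  qed
  also have "\<dots> = (\<Sum>i<d. ?c i i)"
  proof (rule sum.cong[OF refl])
    fix i assume i: "i \<in> {..<d}"
    have "(\<Sum>j<d. ?c i j * (if i = j then 1 else 0)) = (\<Sum>j<d. if i = j then ?c i j else 0)"
      by (intro sum.cong refl) auto
    then show "(\<Sum>j<d. ?c i j * (if i = j then 1 else 0)) = ?c i i" using i by simp
  qed
  finally show "(\<integral>x. moment d T (u x) q \<partial>M) = op_trace d T q"
    by (simp add: op_trace_def moment_def cdot_axis_left)
qed

lemma op_trace_nonneg: "psd_op d T \<Longrightarrow> 0 \<le> op_trace d T p"
  unfolding op_trace_def by (intro sum_nonneg moment_nonneg)

text \<open>The mean of |u|^2 is the trace of the identity, that is \<open>d\<close>, and |u|^2
  never exceeds \<kappa>.\<close>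

lemma one_le_\<kappa>:
  assumes "0 < d"
  shows "1 \<le> \<kappa>"
proof -
  note id = psd_op_id[of d]
  have "real d = op_trace d (\<lambda>x. x) 0"
    by (simp add: op_trace_def moment_def cdot_axis_left) (simp add: axis_vec_def)
  also have "\<dots> = (\<integral>x. moment d (\<lambda>x. x) (u x) 0 \<partial>M)" by (rule integral_moment[OF id, symmetric])
  also have "\<dots> \<le> \<kappa>"
    using norm_u by (intro integral_le_const integrable_moment[OF id]) (auto simp: moment_0)
  finally show ?thesis using assms by simp
qed

text \<open>The hypothesis on \<open>g\<close> bounds the factor in
  \<open>op_trace_downdate_le\<close> below by \<open>g\<close>, uniformly in the sample. Averaging
  turns the subtracted moment into \<open>op_trace d T (Suc p)\<close>, and
  \<open>op_trace_Suc_ge\<close> replaces this by an affine function of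
  \<open>op_trace d T p\<close>.\<close>

lemma nn_integral_op_trace_downdate:
  assumes T: "psd_op d T" and le: "op_le d T (1 / L)" and L: "0 < L" and b: "0 < b"
    and g: "(real p + 1) * \<kappa> / (2 * L) \<le> 1 - g" "0 \<le> g"
  shows "(\<integral>\<^sup>+x. ennreal (op_trace d (downdate d (u x) T) p) \<partial>M)
    \<le> ennreal ((1 - real p * g / b) * op_trace d T p + real p * g * real d / b ^ Suc p)"
proof -
  let ?F = "\<lambda>x. op_trace d T p - real p * g * moment d T (u x) (Suc p)"
  have F: "op_trace d (downdate d (u x) T) p \<le> ?F x" for x
  proof -
    have "op_trace d (downdate d (u x) T) p
      \<le> op_trace d T p - real p * (1 - (real p + 1) * (1 / L) * moment d T (u x) 0 / 2) * moment d T (u x) (Suc p)"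
      using op_trace_downdate_le[OF T le] L by simp
    also have "\<dots> \<le> ?F x"
    proof -
      have "(real p + 1) * (1 / L) * moment d T (u x) 0 / 2 = ((real p + 1) / (2 * L)) * moment d T (u x) 0"
        by simp
      also have "\<dots> \<le> ((real p + 1) / (2 * L)) * \<kappa>"
        using norm_u[of x] L by (intro mult_left_mono) (auto simp: moment_0)
      also have "\<dots> \<le> 1 - g" using g by simp
      finally have "g \<le> 1 - (real p + 1) * (1 / L) * moment d T (u x) 0 / 2" by simp
      then show ?thesis
        using moment_nonneg[OF T, of "u x" "Suc p"] by (intro diff_left_mono mult_right_mono mult_left_mono) auto
    qed
    finally show ?thesis .
  qed
  have int: "integrable M ?F"
    by (intro Bochner_Integration.integrable_diff integrable_mult_right integrable_moment[OF T]) auto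
  \<comment> \<open>\<open>?F\<close> dominates the trace of a power of a positive operator; its
    nonnegativity allows the passage to the Bochner integral.\<close>
  have nn: "0 \<le> ?F x" for x
    using F[of x] op_trace_nonneg[OF psd_op_downdate[OF T]] by (meson order_trans)
  have "(\<integral>\<^sup>+x. ennreal (op_trace d (downdate d (u x) T) p) \<partial>M) \<le> (\<integral>\<^sup>+x. ennreal (?F x) \<partial>M)"
    by (intro nn_integral_mono ennreal_leI F)
  also have "\<dots> = ennreal (\<integral>x. ?F x \<partial>M)"
    using nn by (intro nn_integral_eq_integral[OF int]) auto
  also have "(\<integral>x. ?F x \<partial>M) = op_trace d T p - real p * g * op_trace d T (Suc p)"
    using integrable_moment[OF T, of "Suc p"] integral_moment[OF T, of "Suc p"] by (simp add: prob_space)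
  also have "ennreal \<dots> \<le> ennreal ((1 - real p * g / b) * op_trace d T p + real p * g * real d / b ^ Suc p)"
  proof (rule ennreal_leI)
    have "real p * g * (op_trace d T p / b - real d / b ^ Suc p) \<le> real p * g * op_trace d T (Suc p)"
      using op_trace_Suc_ge[OF T b, of p] g by (intro mult_left_mono) auto
    then show "op_trace d T p - real p * g * op_trace d T (Suc p)
      \<le> (1 - real p * g / b) * op_trace d T p + real p * g * real d / b ^ Suc p"
      by (simp add: algebra_simps)
  qed
  finally show ?thesis .
qed

lemma measurable_op_trace_resolvent:
  assumes "k \<le> m"
  shows "(\<lambda>\<omega>. op_trace d (resolvent d L (\<lambda>j. u (\<omega> j)) k) p) \<in> borel_measurable (Pi\<^sub>M {..<m} (\<lambda>_. M))"
proof (rule measurable_op_trace[OF measurable_op_resolvent])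
  fix j i assume ji: "j < k" "i < d"
  have "(\<lambda>\<omega>. \<omega> j) \<in> Pi\<^sub>M {..<m} (\<lambda>_. M) \<rightarrow>\<^sub>M M"
    using ji assms by (intro measurable_component_singleton) simp
  then show "(\<lambda>\<omega>. u (\<omega> j) i) \<in> borel_measurable (Pi\<^sub>M {..<m} (\<lambda>_. M))"
    by (rule measurable_compose[OF _ measurable_u[OF ji(2)]])
qed

text \<open>Iterates the affine recursion of a single update, starting from
  \<open>d / L ^ p\<close>. The condition \<open>p * g \<le> b\<close> keeps its slope nonnegative,
  so that the induction hypothesis can be inserted.\<close>

lemma nn_integral_op_trace_resolvent:
  assumes L: "0 < L" and b: "0 < b"
    and g: "(real p + 1) * \<kappa> / (2 * L) \<le> 1 - g" "0 \<le> g" "real p * g \<le> b"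
  shows "(\<integral>\<^sup>+\<omega>. ennreal (op_trace d (resolvent d L (\<lambda>j. u (\<omega> j)) k) p) \<partial>(Pi\<^sub>M {..<k} (\<lambda>_. M)))
    \<le> ennreal (real d * ((1 - real p * g / b) ^ k / L ^ p + 1 / b ^ p))"
proof (induction k)
  case 0
  have "(T ^^ p) x = (\<lambda>i. x i / of_real L ^ p)" if "T = (\<lambda>x i. x i / of_real L)" for x and T :: "(nat \<Rightarrow> complex) \<Rightarrow> nat \<Rightarrow> complex"
    using that by (induction p) (simp_all add: field_simps)
  then have "moment d (resolvent d L (\<lambda>j. u (\<omega> j)) 0) (axis_vec i) p = 1 / L ^ p" if "i < d" for i \<omega>
    using that by (simp add: moment_def cdot_axis_left) (simp add: axis_vec_def flip: of_real_power of_real_divide)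
  then have "op_trace d (resolvent d L (\<lambda>j. u (\<omega> j)) 0) p = real d / L ^ p" for \<omega>
    unfolding op_trace_def by simp
  moreover have "emeasure (Pi\<^sub>M {..<0::nat} (\<lambda>_. M)) (space (Pi\<^sub>M {..<0} (\<lambda>_. M))) = 1"
    by (intro prob_space.emeasure_space_1 prob_space_PiM prob_space_axioms)
  ultimately have "(\<integral>\<^sup>+\<omega>. ennreal (op_trace d (resolvent d L (\<lambda>j. u (\<omega> j)) 0) p) \<partial>(Pi\<^sub>M {..<0} (\<lambda>_. M))) = ennreal (real d / L ^ p)"
    by (simp only: nn_integral_const mult_1_right)
  also have "\<dots> \<le> ennreal (real d * ((1 - real p * g / b) ^ 0 / L ^ p + 1 / b ^ p))"
    using b by (intro ennreal_leI) (simp add: field_simps)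
  finally show ?case .
next
  case (Suc k)
  interpret P: product_sigma_finite "\<lambda>_::nat. M"
    by (simp add: product_sigma_finite.intro prob_space_imp_sigma_finite prob_space_axioms)
  define \<alpha> where "\<alpha> = 1 - real p * g / b"
  define \<beta> where "\<beta> = real p * g * real d / b ^ Suc p"
  have \<alpha>0: "0 \<le> \<alpha>" using g b by (simp add: \<alpha>_def)
  have \<beta>0: "0 \<le> \<beta>" using g b by (simp add: \<beta>_def)
  let ?R = "\<lambda>\<omega> k. resolvent d L (\<lambda>j. u (\<omega> j)) k"
  \<comment> \<open>The first k updates do not see coordinate k, so after Fubini the last sample
    acts on an operator that is fixed in the inner integral.\<close>
  have upd: "?R (fun_upd \<omega> k y) (Suc k) = downdate d (u y) (?R \<omega> k)" for \<omega> y
  proof -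
    have "resolvent d L (\<lambda>j. u ((fun_upd \<omega> k y) j)) k = ?R \<omega> k" by (rule resolvent_cong) simp
    then show ?thesis by simp
  qed
  have meas: "(\<lambda>\<omega>. ennreal (op_trace d (?R \<omega> (Suc k)) p)) \<in> borel_measurable (Pi\<^sub>M (insert k {..<k}) (\<lambda>_. M))"
    using measurable_op_trace_resolvent[of "Suc k" "Suc k"] by (simp add: lessThan_Suc del: resolvent.simps)
  have "(\<integral>\<^sup>+\<omega>. ennreal (op_trace d (?R \<omega> (Suc k)) p) \<partial>(Pi\<^sub>M {..<Suc k} (\<lambda>_. M)))
    = (\<integral>\<^sup>+\<omega>. \<integral>\<^sup>+y. ennreal (op_trace d (?R (fun_upd \<omega> k y) (Suc k)) p) \<partial>M \<partial>(Pi\<^sub>M {..<k} (\<lambda>_. M)))"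
    unfolding lessThan_Suc by (rule P.product_nn_integral_insert[OF _ _ meas]) auto
  also have "\<dots> \<le> (\<integral>\<^sup>+\<omega>. ennreal (\<alpha> * op_trace d (?R \<omega> k) p + \<beta>) \<partial>(Pi\<^sub>M {..<k} (\<lambda>_. M)))"
    unfolding upd \<alpha>_def \<beta>_def
    by (intro nn_integral_mono
        nn_integral_op_trace_downdate[OF psd_op_resolvent[OF L] op_le_resolvent[OF L] L b g(1,2)])
  also have "\<dots> = (\<integral>\<^sup>+\<omega>. ennreal \<alpha> * ennreal (op_trace d (?R \<omega> k) p) + ennreal \<beta> \<partial>(Pi\<^sub>M {..<k} (\<lambda>_. M)))"
    using \<alpha>0 \<beta>0 op_trace_nonneg[OF psd_op_resolvent[OF L]]
    by (intro nn_integral_cong) (simp add: ennreal_plus ennreal_mult)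
  also have "\<dots> = ennreal \<alpha> * (\<integral>\<^sup>+\<omega>. ennreal (op_trace d (?R \<omega> k) p) \<partial>(Pi\<^sub>M {..<k} (\<lambda>_. M))) + ennreal \<beta>"
  proof -
    have "emeasure (Pi\<^sub>M {..<k} (\<lambda>_. M)) (space (Pi\<^sub>M {..<k} (\<lambda>_. M))) = 1"
      by (intro prob_space.emeasure_space_1 prob_space_PiM prob_space_axioms)
    moreover have "(\<lambda>\<omega>. ennreal (op_trace d (?R \<omega> k) p)) \<in> borel_measurable (Pi\<^sub>M {..<k} (\<lambda>_. M))"
      using measurable_op_trace_resolvent[of k k] by simp
    ultimately show ?thesis by (simp add: nn_integral_add nn_integral_cmult)
  qed
  also have "\<dots> \<le> ennreal \<alpha> * ennreal (real d * (\<alpha> ^ k / L ^ p + 1 / b ^ p)) + ennreal \<beta>"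
    using Suc.IH unfolding \<alpha>_def by (intro add_mono mult_left_mono) auto
  also have "\<dots> = ennreal (\<alpha> * (real d * (\<alpha> ^ k / L ^ p + 1 / b ^ p)) + \<beta>)"
    using \<alpha>0 \<beta>0 L b by (simp add: ennreal_plus ennreal_mult)
  also have "\<alpha> * (real d * (\<alpha> ^ k / L ^ p + 1 / b ^ p)) + \<beta> = real d * (\<alpha> ^ Suc k / L ^ p + 1 / b ^ p)"
  proof -
    \<comment> \<open>This says that \<open>d / b ^ p\<close> is the fixed point of the map a ->
      \<alpha> a + \<beta>.\<close>
    have "\<beta> = real d * ((1 - \<alpha>) / b ^ p)"
      using b by (simp add: \<alpha>_def \<beta>_def field_simps)
    then show ?thesis by (simp add: algebra_simps diff_divide_distrib)
  qed
  finally show ?case unfolding \<alpha>_def .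
qed


text \<open>Independence and equal marginals make the joint law of the samples the product measure,
  where the expected potential is known; Markov's inequality at the level \<open>1 / c ^ p\<close>
  gives the tail.\<close>

lemma emeasure_op_trace_resolvent:
  assumes S: "prob_space S" and ind: "prob_space.indep_vars S (\<lambda>_. M) X {..<m}"
    and dist: "\<And>i. i < m \<Longrightarrow> distr S M (X i) = M" and m: "0 < m"
    and L: "0 < L" and b: "0 < b" and c: "0 < c"
    and g: "(real p + 1) * \<kappa> / (2 * L) \<le> 1 - g" "0 \<le> g" "real p * g \<le> b"
  defines "B \<equiv> {s \<in> space S. 1 / c ^ p \<le> op_trace d (resolvent d L (\<lambda>j. u (X j s)) m) p}"
  shows "B \<in> sets S"
    and "emeasure S B \<le> ennreal (real d * ((1 - real p * g / b) ^ m * (c / L) ^ p + (c / b) ^ p))"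
proof -
  interpret S: prob_space S by (rule S)
  let ?P = "Pi\<^sub>M {..<m} (\<lambda>_. M)"
  let ?F = "\<lambda>\<omega>. op_trace d (resolvent d L (\<lambda>j. u (\<omega> j)) m) p"
  let ?Y = "\<lambda>s. \<lambda>j\<in>{..<m}. X j s"
  have rv: "S.random_variable M (X i)" if "i \<in> {..<m}" for i
    using ind that unfolding S.indep_vars_def by auto
  have Y: "?Y \<in> S \<rightarrow>\<^sub>M ?P" using rv by (intro measurable_restrict) auto
  have "distr S ?P ?Y = Pi\<^sub>M {..<m} (\<lambda>i. distr S M (X i))"
    using S.indep_vars_iff_distr_eq_PiM'[where I = "{..<m}" and M' = "\<lambda>_. M" and X = X] ind rv m by auto
  also have "\<dots> = ?P" by (intro PiM_cong) (auto simp: dist)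
  finally have distr: "distr S ?P ?Y = ?P" .
  have F: "?F \<in> borel_measurable ?P" by (rule measurable_op_trace_resolvent) simp
  have eqF: "?F (?Y s) = op_trace d (resolvent d L (\<lambda>j. u (X j s)) m) p" for s
    by (rule arg_cong[where f = "\<lambda>T. op_trace d T p"], rule resolvent_cong) simp
  have FY: "(\<lambda>s. op_trace d (resolvent d L (\<lambda>j. u (X j s)) m) p) \<in> borel_measurable S"
    using measurable_compose[OF Y F] unfolding eqF .
  then show "B \<in> sets S" unfolding B_def by measurable
  have B: "B = {s \<in> space S. 1 \<le> ennreal (c ^ p) * ennreal (op_trace d (resolvent d L (\<lambda>j. u (X j s)) m) p)}"
  proof -
    have "(1 / c ^ p \<le> x) = (1 \<le> ennreal (c ^ p) * ennreal x)" if "0 \<le> x" for x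
    proof -
      have "(1 \<le> ennreal (c ^ p) * ennreal x) = (ennreal 1 \<le> ennreal (c ^ p * x))"
        using c that by (simp add: ennreal_mult)
      also have "\<dots> = (1 \<le> c ^ p * x)" using c that by (subst ennreal_le_iff) auto
      also have "\<dots> = (1 / c ^ p \<le> x)" using c by (simp add: field_simps)
      finally show ?thesis by simp
    qed
    then show ?thesis unfolding B_def using op_trace_nonneg[OF psd_op_resolvent[OF L]] by auto
  qed
  have "emeasure S B \<le> ennreal (c ^ p) * (\<integral>\<^sup>+s. ennreal (op_trace d (resolvent d L (\<lambda>j. u (X j s)) m) p) * indicator (space S) s \<partial>S)"
    using nn_integral_Markov_inequality[of "\<lambda>s. ennreal (op_trace d (resolvent d L (\<lambda>j. u (X j s)) m) p)" "space S" S "ennreal (c ^ p)"] FY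
    unfolding B by auto
  also have "(\<integral>\<^sup>+s. ennreal (op_trace d (resolvent d L (\<lambda>j. u (X j s)) m) p) * indicator (space S) s \<partial>S)
      = (\<integral>\<^sup>+s. ennreal (?F (?Y s)) \<partial>S)"
    unfolding eqF by (intro nn_integral_cong) simp
  also have "\<dots> = (\<integral>\<^sup>+\<omega>. ennreal (?F \<omega>) \<partial>distr S ?P ?Y)"
    using F by (intro nn_integral_distr[symmetric] Y) simp
  also have "\<dots> \<le> ennreal (real d * ((1 - real p * g / b) ^ m / L ^ p + 1 / b ^ p))"
    unfolding distr by (rule nn_integral_op_trace_resolvent[OF L b g])
  also have "ennreal (c ^ p) * \<dots> = ennreal (c ^ p * (real d * ((1 - real p * g / b) ^ m / L ^ p + 1 / b ^ p)))"
    using c by (subst ennreal_mult') auto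
  also have "c ^ p * (real d * ((1 - real p * g / b) ^ m / L ^ p + 1 / b ^ p))
      = real d * ((1 - real p * g / b) ^ m * (c / L) ^ p + (c / b) ^ p)"
    by (simp add: power_divide algebra_simps)
  finally show "emeasure S B \<le> ennreal (real d * ((1 - real p * g / b) ^ m * (c / L) ^ p + (c / b) ^ p))"
    by (simp add: mult_left_mono)
qed

text \<open>A vector violating the frame bound pushes the potential up to \<open>1 / ?c ^ p\<close>
  by \<open>op_trace_resolvent_ge\<close>. The bad event therefore does not depend on the vector,
  and the bound holds for all \<open>y\<close> at once.\<close>

lemma sample_lower_frame_bound:
  assumes S: "prob_space S" and ind: "prob_space.indep_vars S (\<lambda>_. M) X {..<m}"
    and dist: "\<And>i. i < m \<Longrightarrow> distr S M (X i) = M"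
    and n: "1 \<le> n" "d \<le> n" and \<kappa>: "1 \<le> \<kappa>" and \<epsilon>: "0 < \<epsilon>" "\<epsilon> < 1"
    and m: "8 * \<kappa> * ln (3 * real n / \<epsilon>) \<le> real m"
  shows "\<exists>B\<in>sets S. emeasure S B \<le> ennreal (\<epsilon> / 2) \<and>
    (\<forall>s\<in>space S - B. \<forall>y. real m / 16 * (\<Sum>i<d. (cmod (y i))\<^sup>2) \<le> (\<Sum>j<m. (cmod (cdot d (u (X j s)) y))\<^sup>2))"
proof -
  define l where "l = ln (3 * real n / \<epsilon>)"
  have l1: "1 \<le> l"
  proof -
    have "1 \<le> ln (3::real)" using exp_le by (subst ln_ge_iff) auto
    also have "\<dots> \<le> l" unfolding l_def
    proof (rule ln_mono)
      show "3 \<le> 3 * real n / \<epsilon>" using n \<epsilon> by (simp add: field_simps)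
    qed (use n \<epsilon> in auto)
    finally show ?thesis .
  qed
  define r where "r = real m / \<kappa>"
  have r: "8 * l \<le> r" using m \<kappa> unfolding r_def l_def by (simp add: field_simps)
  have m0: "0 < m" using r l1 \<kappa> unfolding r_def by (cases m) auto
  define p where "p = nat \<lfloor>r\<rfloor>"
  have pr: "real p \<le> r" and rp: "r < real p + 1" using r l1 unfolding p_def by linarith+
  have p8: "8 \<le> real p"
  proof -
    have "8 \<le> \<lfloor>r\<rfloor>" using r l1 by linarith
    then show ?thesis unfolding p_def by simp
  qed
  \<comment> \<open>p exceeds r - 1 >= 8 l - 1, and l >= 1 since e <= 3 <= 3 n / \<epsilon>.\<close>
  have p7: "7 * l \<le> real p" using rp r l1 by linarith
  have pm: "real p \<le> real m"
  proof -
    have "r \<le> real m" using \<kappa> mult_left_mono[of 1 \<kappa> "real m"] unfolding r_def by (simp add: divide_le_eq)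
    then show ?thesis using pr by simp
  qed
  \<comment> \<open>\<open>?c = ?L + m / 16\<close> is the level to be exceeded, \<open>?g\<close> bounds the drift factor
    \<open>1 - (p + 1) * \<kappa> / (2 * ?L)\<close> from below, and \<open>?b = 5 / 4 * ?c\<close> balances the two terms of the
    tail bound: both are at most \<open>exp (- p / 5)\<close>.\<close>
  let ?L = "2 * real m" and ?c = "33 / 16 * real m" and ?b = "165 / 64 * real m" and ?g = "23 / 32 :: real"
  \<comment> \<open>As r >= 8, p + 1 is at most 9/8 r; dividing 9/8 m by 4 m leaves 9/32 = 1 -
    23/32.\<close>
  have g1: "(real p + 1) * \<kappa> / (2 * ?L) \<le> 1 - ?g"
  proof -
    have "(real p + 1) \<le> 9 / 8 * r" using pr p8 by linarith
    then have "(real p + 1) * \<kappa> \<le> 9 / 8 * r * \<kappa>" using \<kappa> by (intro mult_right_mono) auto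
    also have "9 / 8 * r * \<kappa> = 9 / 8 * real m" using \<kappa> unfolding r_def by simp
    finally have "(real p + 1) * \<kappa> \<le> 9 / 8 * real m" .
    then show ?thesis using m0 by (simp add: pos_divide_le_eq mult.commute)
  qed
  have g3: "real p * ?g \<le> ?b" using pm by linarith
  define B where "B = {s \<in> space S. 1 / ?c ^ p \<le> op_trace d (resolvent d ?L (\<lambda>j. u (X j s)) m) p}"
  note tail = emeasure_op_trace_resolvent[OF S ind dist m0, of ?L ?b ?c p ?g, folded B_def]
  have B: "B \<in> sets S" and EB: "emeasure S B \<le> ennreal (real d * ((1 - real p * ?g / ?b) ^ m * (?c / ?L) ^ p + (?c / ?b) ^ p))"
    by (rule tail; use m0 g1 g3 in simp)+
  have "real d * ((1 - real p * ?g / ?b) ^ m * (?c / ?L) ^ p + (?c / ?b) ^ p) \<le> \<epsilon> / 2"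
  proof -
    have "(?c / ?b) ^ p = (1 - 1 / 5) ^ p" using m0 by simp
    also have "\<dots> \<le> exp (- (1 / 5)) ^ p"
      using exp_ge_add_one_self[of "- (1 / 5) :: real"] by (intro power_mono) auto
    also have "\<dots> = exp (- real p / 5)" by (simp flip: exp_of_nat_mult)
    finally have first: "(?c / ?b) ^ p \<le> exp (- real p / 5)" .
    have pg: "real p * ?g / ?b \<le> 1" using g3 m0 by (simp add: divide_le_eq)
    have "(1 - real p * ?g / ?b) ^ m \<le> exp (- (real p * ?g / ?b)) ^ m"
      using exp_ge_add_one_self[of "- (real p * ?g / ?b)"] pg by (intro power_mono) auto
    also have "\<dots> = exp (- (46 / 165) * real p)"
      using m0 by (simp flip: exp_of_nat_mult)
    finally have s1: "(1 - real p * ?g / ?b) ^ m \<le> exp (- (46 / 165) * real p)" .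
    have "(?c / ?L) ^ p = (1 + 1 / 32) ^ p" using m0 by simp
    also have "\<dots> \<le> exp (1 / 32) ^ p"
      using exp_ge_add_one_self[of "1 / 32 :: real"] by (intro power_mono) auto
    also have "\<dots> = exp (real p / 32)" by (simp flip: exp_of_nat_mult)
    finally have s2: "(?c / ?L) ^ p \<le> exp (real p / 32)" .
    have "(1 - real p * ?g / ?b) ^ m * (?c / ?L) ^ p \<le> exp (- (46 / 165) * real p) * exp (real p / 32)"
      by (intro mult_mono s1 s2) auto
    also have "\<dots> = exp (- (46 / 165) * real p + real p / 32)" by (simp only: exp_add)
    also have "\<dots> \<le> exp (- real p / 5)" using p8 by simp
    finally have second: "(1 - real p * ?g / ?b) ^ m * (?c / ?L) ^ p \<le> exp (- real p / 5)" .
    \<comment> \<open>Here 7 l / 5 >= l + 2 / 5, and exp (-2/5) <= 3/4 improves \<epsilon> / (3 n)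
      to \<epsilon> / (4 n). Two such terms times d <= n give \<epsilon> / 2.\<close>
    have "exp (- real p / 5) \<le> exp (- l + - (2 / 5))" using p7 l1 by simp
    also have "\<dots> = \<epsilon> / (3 * real n) * exp (- (2 / 5))"
      using n \<epsilon> unfolding exp_add l_def by (simp add: exp_minus)
    also have "\<dots> \<le> \<epsilon> / (3 * real n) * (3 / 4)"
    proof -
      have "4 / 3 \<le> exp (2 / 5 :: real)" using exp_ge_add_one_self[of "2 / 5 :: real"] by simp
      then have "exp (- (2 / 5) :: real) \<le> 3 / 4" by (simp add: exp_minus field_simps)
      then show ?thesis using n \<epsilon> by (intro mult_left_mono) auto
    qed
    also have "\<dots> = \<epsilon> / (4 * real n)" by simp
    finally have e: "exp (- real p / 5) \<le> \<epsilon> / (4 * real n)" .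
    have "real d * ((1 - real p * ?g / ?b) ^ m * (?c / ?L) ^ p + (?c / ?b) ^ p) \<le> real d * (\<epsilon> / (4 * real n) + \<epsilon> / (4 * real n))"
      using first second e by (intro mult_left_mono add_mono) auto
    also have "\<dots> \<le> real n * (\<epsilon> / (4 * real n) + \<epsilon> / (4 * real n))"
      using n \<epsilon> by (intro mult_right_mono) auto
    also have "\<dots> = \<epsilon> / 2" using n by (simp add: field_simps)
    finally show ?thesis .
  qed
  then have EB': "emeasure S B \<le> ennreal (\<epsilon> / 2)"
    using EB by (meson ennreal_leI order_trans)
  have "real m / 16 * (\<Sum>i<d. (cmod (y i))\<^sup>2) \<le> (\<Sum>j<m. (cmod (cdot d (u (X j s)) y))\<^sup>2)"
    if s: "s \<in> space S - B" for s y
  proof (rule ccontr)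
    assume neg: "\<not> ?thesis"
    let ?Y = "\<Sum>i<d. (cmod (y i))\<^sup>2"
    have "0 \<le> (\<Sum>j<m. (cmod (cdot d (u (X j s)) y))\<^sup>2)" by (intro sum_nonneg) auto
    then have "0 < real m / 16 * ?Y" using neg by linarith
    then have Y: "0 < ?Y" using m0 by (simp add: zero_less_mult_iff)
    have "(\<Sum>j<m. (cmod (cdot d (u (X j s)) y))\<^sup>2) \<le> (?c - ?L) * ?Y"
      using neg by (simp add: algebra_simps)
    then have "1 / ?c ^ p \<le> op_trace d (resolvent d ?L (\<lambda>j. u (X j s)) m) p"
      using m0 Y by (intro op_trace_resolvent_ge) auto
    then show False using s unfolding B_def by auto
  qed
  then show ?thesis using B EB' by blast
qed

end

section \<open>Lebesgue norms, orthonormal bases and Remez constants\<close>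

lemma ennreal_power2_le_imp_le:
  fixes a b :: ennreal
  assumes le: "a\<^sup>2 \<le> b\<^sup>2"
  shows "a \<le> b"
proof (rule ccontr)
  assume "\<not> a \<le> b"
  then have ba: "b < a" by simp
  then obtain r where r: "b = ennreal r" "0 \<le> r" by (cases b) auto
  have "b * b < a * a"
  proof (cases a)
    case (real s)
    then have "r < s" using ba r by (simp add: ennreal_less_iff)
    then have "r * r < s * s" using r by (intro mult_strict_mono') auto
    then have "ennreal (r * r) < ennreal (s * s)" using r by (subst ennreal_less_iff) auto
    then show ?thesis unfolding real(2) r(1) using r real(1) by (simp only: ennreal_mult)
  next
    case top
    then show ?thesis using r by (simp flip: ennreal_mult)
  qed
  then show False using le unfolding power2_eq_square by simp
qed

text \<open>Squaring removes the real powers and the case distinction from \<open>Lnorm\<close>. The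
  norm inequalities below are proved for squares and transferred by
  \<open>ennreal_power2_le_imp_le\<close>.\<close>

lemma Lnorm_2_power2: "(Lnorm 2 M f)\<^sup>2 = (\<integral>\<^sup>+x. ennreal ((cmod (f x))\<^sup>2) \<partial>M)"
proof -
  let ?I = "\<integral>\<^sup>+x. ennreal ((cmod (f x))\<^sup>2) \<partial>M"
  have two: "(2::ennreal) = ennreal 2" by simp
  have e: "enn2real (2::ennreal) = 2" unfolding two by (rule enn2real_ennreal) simp
  have t: "(2::ennreal) \<noteq> \<infinity>" by simp
  have L: "Lnorm 2 M f = (if ?I = \<infinity> then \<infinity> else ennreal (enn2real ?I powr (1 / 2)))"
    using t unfolding Lnorm_def e by (simp add: Let_def)
  show ?thesis
  proof (cases "?I = \<infinity>")
    case True then show ?thesis unfolding L by simp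
  next
    case False
    then have "(Lnorm 2 M f)\<^sup>2 = (ennreal (enn2real ?I powr (1 / 2)))\<^sup>2"
      unfolding L by (simp only: if_False)
    also have "\<dots> = ennreal (enn2real ?I)"
      by (simp add: ennreal_power powr_half_sqrt)
    also have "\<dots> = ?I" using False by (intro ennreal_enn2real) (simp add: less_top)
    finally show ?thesis .
  qed
qed

lemma Lnorm_infinity: "Lnorm \<infinity> M f = esssup M (\<lambda>x. ennreal (cmod (f x)))"
  by (simp add: Lnorm_def)

lemma Lnorm_infinity_AE: "AE x in M. ennreal (cmod (f x)) \<le> Lnorm \<infinity> M f"
  unfolding Lnorm_infinity by (rule esssup_AE)

lemma Lnorm_2_mono_AE:
  assumes "AE x in M. cmod (f x) \<le> cmod (g x)"
  shows "Lnorm 2 M f \<le> Lnorm 2 M g"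
  by (rule ennreal_power2_le_imp_le, unfold Lnorm_2_power2, rule nn_integral_mono_AE)
    (use assms in \<open>auto intro!: ennreal_leI power_mono\<close>)

lemma Lnorm_2_cong_AE: "AE x in M. f x = g x \<Longrightarrow> Lnorm 2 M f = Lnorm 2 M g"
  by (intro antisym Lnorm_2_mono_AE) auto

lemma Lnorm_2_eq_0_iff:
  assumes [measurable]: "f \<in> borel_measurable M"
  shows "Lnorm 2 M f = 0 \<longleftrightarrow> (AE x in M. f x = 0)"
proof -
  have "Lnorm 2 M f = 0 \<longleftrightarrow> (\<integral>\<^sup>+x. ennreal ((cmod (f x))\<^sup>2) \<partial>M) = 0"
    unfolding Lnorm_2_power2[symmetric] by simp
  also have "\<dots> \<longleftrightarrow> (AE x in M. f x = 0)"
    by (subst nn_integral_0_iff_AE) (auto simp: ennreal_eq_0_iff)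
  finally show ?thesis .
qed

text \<open>With a and b the two norms, the arithmetic-geometric mean inequality gives |f + g|^2 <=
  (1 + b/a) |f|^2 + (1 + a/b) |g|^2 pointwise, and the integral of the right side is exactly (a +
  b)^2. Zero and infinite norms are treated first.\<close>

lemma Lnorm_2_triangle:
  assumes [measurable]: "f \<in> borel_measurable M" "g \<in> borel_measurable M"
  shows "Lnorm 2 M (\<lambda>x. f x + g x) \<le> Lnorm 2 M f + Lnorm 2 M g"
proof (cases "Lnorm 2 M f = 0 \<or> Lnorm 2 M g = 0 \<or> Lnorm 2 M f = \<infinity> \<or> Lnorm 2 M g = \<infinity>")
  case True
  then consider "Lnorm 2 M f = 0" | "Lnorm 2 M g = 0" | "Lnorm 2 M f + Lnorm 2 M g = \<infinity>" by force
  then show ?thesis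
  proof cases
    case 1
    then have "AE x in M. f x + g x = g x" using Lnorm_2_eq_0_iff[of f M] by auto
    from Lnorm_2_cong_AE[OF this] show ?thesis by simp
  next
    case 2
    then have "AE x in M. f x + g x = f x" using Lnorm_2_eq_0_iff[of g M] by auto
    from Lnorm_2_cong_AE[OF this] show ?thesis by simp
  next
    case 3
    then show ?thesis unfolding 3 by simp
  qed
next
  case False
  then obtain a b where a: "Lnorm 2 M f = ennreal a" "0 < a" and b: "Lnorm 2 M g = ennreal b" "0 < b"
    by (cases "Lnorm 2 M f"; cases "Lnorm 2 M g") (auto simp: less_le)
  have F: "(\<integral>\<^sup>+x. ennreal ((cmod (f x))\<^sup>2) \<partial>M) = ennreal (a\<^sup>2)"
    using a by (simp flip: Lnorm_2_power2 add: ennreal_power)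
  have G: "(\<integral>\<^sup>+x. ennreal ((cmod (g x))\<^sup>2) \<partial>M) = ennreal (b\<^sup>2)"
    using b by (simp flip: Lnorm_2_power2 add: ennreal_power)
  have pt: "(cmod (f x + g x))\<^sup>2 \<le> (1 + b / a) * (cmod (f x))\<^sup>2 + (1 + a / b) * (cmod (g x))\<^sup>2" for x
  proof -
    let ?r = "cmod (f x)" and ?s = "cmod (g x)"
    have "(cmod (f x + g x))\<^sup>2 \<le> (?r + ?s)\<^sup>2" by (intro power_mono norm_triangle_ineq) auto
    also have "\<dots> = ?r\<^sup>2 + 2 * ?r * ?s + ?s\<^sup>2" by (simp add: power2_sum)
    also have "2 * ?r * ?s \<le> b / a * ?r\<^sup>2 + a / b * ?s\<^sup>2"
    proof -
      have "(b * R - a * S)\<^sup>2 / (a * b) = b / a * R\<^sup>2 + a / b * S\<^sup>2 - 2 * R * S" for R S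
        using a(2) b(2) by (simp add: power2_diff power_mult_distrib diff_divide_distrib add_divide_distrib)
          (simp add: power2_eq_square)
      moreover have "0 \<le> (b * ?r - a * ?s)\<^sup>2 / (a * b)" using a b by simp
      ultimately show ?thesis by simp
    qed
    finally show ?thesis by (simp add: algebra_simps)
  qed
  have "(Lnorm 2 M (\<lambda>x. f x + g x))\<^sup>2
      \<le> (\<integral>\<^sup>+x. ennreal (1 + b / a) * ennreal ((cmod (f x))\<^sup>2) + ennreal (1 + a / b) * ennreal ((cmod (g x))\<^sup>2) \<partial>M)"
    unfolding Lnorm_2_power2
  proof (rule nn_integral_mono)
    fix x
    have "ennreal ((cmod (f x + g x))\<^sup>2) \<le> ennreal ((1 + b / a) * (cmod (f x))\<^sup>2 + (1 + a / b) * (cmod (g x))\<^sup>2)"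
      by (rule ennreal_leI[OF pt])
    also have "\<dots> = ennreal (1 + b / a) * ennreal ((cmod (f x))\<^sup>2) + ennreal (1 + a / b) * ennreal ((cmod (g x))\<^sup>2)"
    proof -
      have "0 \<le> 1 + b / a" "0 \<le> 1 + a / b" using a b by auto
      then show ?thesis by (subst ennreal_plus) (auto simp: ennreal_mult)
    qed
    finally show "ennreal ((cmod (f x + g x))\<^sup>2)
      \<le> ennreal (1 + b / a) * ennreal ((cmod (f x))\<^sup>2) + ennreal (1 + a / b) * ennreal ((cmod (g x))\<^sup>2)" .
  qed
  also have "\<dots> = ennreal (1 + b / a) * ennreal (a\<^sup>2) + ennreal (1 + a / b) * ennreal (b\<^sup>2)"
  proof -
    have m: "(\<lambda>x. ennreal ((cmod (f x))\<^sup>2)) \<in> borel_measurable M"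
      "(\<lambda>x. ennreal ((cmod (g x))\<^sup>2)) \<in> borel_measurable M" by measurable
    show ?thesis
      unfolding F[symmetric] G[symmetric] nn_integral_cmult[OF m(1), symmetric] nn_integral_cmult[OF m(2), symmetric]
      by (rule nn_integral_add; measurable)
  qed
  also have "\<dots> = ennreal ((1 + b / a) * a\<^sup>2 + (1 + a / b) * b\<^sup>2)"
  proof -
    have "0 \<le> 1 + b / a" "0 \<le> 1 + a / b" using a b by auto
    then show ?thesis by (subst ennreal_plus) (auto simp: ennreal_mult)
  qed
  also have "(1 + b / a) * a\<^sup>2 + (1 + a / b) * b\<^sup>2 = (a + b)\<^sup>2"
    using a b by (simp add: power2_eq_square field_simps)
  also have "ennreal ((a + b)\<^sup>2) = (Lnorm 2 M f + Lnorm 2 M g)\<^sup>2"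
    using a b by (simp flip: ennreal_plus add: ennreal_power)
  finally show ?thesis by (rule ennreal_power2_le_imp_le)
qed

lemma Lnorm_infinity_triangle:
  assumes [measurable]: "f \<in> borel_measurable M" "g \<in> borel_measurable M"
  shows "Lnorm \<infinity> M (\<lambda>x. f x + g x) \<le> Lnorm \<infinity> M f + Lnorm \<infinity> M g"
  unfolding Lnorm_infinity[where M = M and f = "\<lambda>x. f x + g x"]
proof (rule esssup_I)
  show "AE x in M. ennreal (cmod (f x + g x)) \<le> Lnorm \<infinity> M f + Lnorm \<infinity> M g"
    using Lnorm_infinity_AE[where M = M and f = f] Lnorm_infinity_AE[where M = M and f = g]
  proof eventually_elim
    case (elim x)
    have "ennreal (cmod (f x + g x)) \<le> ennreal (cmod (f x)) + ennreal (cmod (g x))"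
      by (simp flip: ennreal_plus add: ennreal_leI norm_triangle_ineq)
    also have "\<dots> \<le> Lnorm \<infinity> M f + Lnorm \<infinity> M g" by (intro add_mono elim)
    finally show ?case .
  qed
qed measurable

lemma Lnorm_cmult_le:
  assumes [measurable]: "f \<in> borel_measurable M" and q: "q = 2 \<or> q = \<infinity>"
  shows "Lnorm q M (\<lambda>x. c * f x) \<le> ennreal (cmod c) * Lnorm q M f"
  using q
proof
  assume q: "q = 2"
  have "(Lnorm 2 M (\<lambda>x. c * f x))\<^sup>2 = (\<integral>\<^sup>+x. (ennreal (cmod c))\<^sup>2 * ennreal ((cmod (f x))\<^sup>2) \<partial>M)"
    unfolding Lnorm_2_power2
    by (intro nn_integral_cong) (simp only: norm_mult power_mult_distrib ennreal_mult ennreal_power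
        zero_le_power norm_ge_zero)
  also have "\<dots> = (ennreal (cmod c))\<^sup>2 * (\<integral>\<^sup>+x. ennreal ((cmod (f x))\<^sup>2) \<partial>M)"
    by (rule nn_integral_cmult) measurable
  also have "\<dots> = (ennreal (cmod c) * Lnorm 2 M f)\<^sup>2"
    by (simp only: power_mult_distrib Lnorm_2_power2)
  finally have "(Lnorm 2 M (\<lambda>x. c * f x))\<^sup>2 \<le> (ennreal (cmod c) * Lnorm 2 M f)\<^sup>2"
    by (rule eq_refl)
  then show ?thesis unfolding q by (rule ennreal_power2_le_imp_le)
next
  assume q: "q = \<infinity>"
  show ?thesis
    unfolding q Lnorm_infinity[where M = M and f = "\<lambda>x. c * f x"]
  proof (rule esssup_I)
    show "AE x in M. ennreal (cmod (c * f x)) \<le> ennreal (cmod c) * Lnorm \<infinity> M f"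
      using Lnorm_infinity_AE[where M = M and f = f]
      by eventually_elim (simp add: norm_mult ennreal_mult mult_left_mono)
  qed measurable
qed

lemma (in prob_space) Lnorm_2_le_infinity: "Lnorm 2 M f \<le> Lnorm \<infinity> M f"
proof (rule ennreal_power2_le_imp_le)
  have "(Lnorm 2 M f)\<^sup>2 \<le> (\<integral>\<^sup>+x. (Lnorm \<infinity> M f)\<^sup>2 \<partial>M)"
    unfolding Lnorm_2_power2
    by (rule nn_integral_mono_AE, use Lnorm_infinity_AE[where M = M and f = f] in eventually_elim)
      (simp only: power_mono zero_le ennreal_power[OF norm_ge_zero, symmetric])
  also have "\<dots> = (Lnorm \<infinity> M f)\<^sup>2" by (simp add: emeasure_space_1)
  finally show "(Lnorm 2 M f)\<^sup>2 \<le> (Lnorm \<infinity> M f)\<^sup>2" .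
qed

lemma Lnorm_2_restrict_le:
  assumes "\<Omega> \<in> sets M"
  shows "Lnorm 2 (restrict_space M \<Omega>) f \<le> Lnorm 2 M f"
proof (rule ennreal_power2_le_imp_le)
  have "\<Omega> \<inter> space M \<in> sets M" using assms by auto
  then show "(Lnorm 2 (restrict_space M \<Omega>) f)\<^sup>2 \<le> (Lnorm 2 M f)\<^sup>2"
    unfolding Lnorm_2_power2
    by (subst nn_integral_restrict_space) (auto intro!: nn_integral_mono simp: indicator_def)
qed

lemma L2_restrict: "\<Omega> \<in> sets M \<Longrightarrow> f \<in> L2 M \<Longrightarrow> f \<in> L2 (restrict_space M \<Omega>)"
  using Lnorm_2_restrict_le[of \<Omega> M f] by (auto simp: L2_def measurable_restrict_space1)

lemma L2_integrable_square:
  assumes "f \<in> L2 M"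
  shows "integrable M (\<lambda>x. (cmod (f x))\<^sup>2)"
proof (rule integrableI_nonneg)
  have "(Lnorm 2 M f)\<^sup>2 < \<infinity>"
    using assms unfolding L2_def by (simp add: power2_eq_square ennreal_mult_less_top)
  then show "(\<integral>\<^sup>+x. ennreal ((cmod (f x))\<^sup>2) \<partial>M) < \<infinity>" by (simp add: Lnorm_2_power2)
qed (use assms in \<open>auto simp: L2_def\<close>)

lemma L2_integrable_mult:
  assumes "f \<in> L2 M" "g \<in> L2 M"
  shows "integrable M (\<lambda>x. cnj (f x) * g x)"
proof (rule Bochner_Integration.integrable_bound)
  show "integrable M (\<lambda>x. (cmod (f x))\<^sup>2 + (cmod (g x))\<^sup>2)"
    by (intro Bochner_Integration.integrable_add L2_integrable_square assms)
  show "(\<lambda>x. cnj (f x) * g x) \<in> borel_measurable M"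
    using assms by (intro borel_measurable_times measurable_cnj[of f]) (auto simp: L2_def)
  have "cmod (f x) * cmod (g x) \<le> (cmod (f x))\<^sup>2 + (cmod (g x))\<^sup>2" for x
  proof -
    have "0 \<le> cmod (f x) * cmod (g x)" by simp
    then show ?thesis using sum_squares_bound[of "cmod (f x)" "cmod (g x)"] by linarith
  qed
  then show "AE x in M. norm (cnj (f x) * g x) \<le> norm ((cmod (f x))\<^sup>2 + (cmod (g x))\<^sup>2)"
    by (auto simp: norm_mult)
qed

lemma L2_integral_cnj_self:
  assumes "f \<in> L2 M"
  shows "ennreal (Re (\<integral>x. cnj (f x) * f x \<partial>M)) = (Lnorm 2 M f)\<^sup>2"
    and "(\<integral>x. cnj (f x) * f x \<partial>M) = of_real (Re (\<integral>x. cnj (f x) * f x \<partial>M))"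
proof -
  have "(\<integral>x. cnj (f x) * f x \<partial>M) = of_real (\<integral>x. (cmod (f x))\<^sup>2 \<partial>M)"
  proof -
    have "cnj z * z = of_real ((cmod z)\<^sup>2)" for z
      by (metis complex_norm_square mult.commute)
    then show ?thesis by (simp only: integral_complex_of_real)
  qed
  moreover have "(Lnorm 2 M f)\<^sup>2 = ennreal (\<integral>x. (cmod (f x))\<^sup>2 \<partial>M)"
    unfolding Lnorm_2_power2 by (rule nn_integral_eq_integral[OF L2_integrable_square[OF assms]]) simp
  ultimately show "ennreal (Re (\<integral>x. cnj (f x) * f x \<partial>M)) = (Lnorm 2 M f)\<^sup>2"
    "(\<integral>x. cnj (f x) * f x \<partial>M) = of_real (Re (\<integral>x. cnj (f x) * f x \<partial>M))" by auto
qed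

section \<open>Orthonormal systems in a function space and the Christoffel function\<close>

lemma sum_fun_apply: "(\<Sum>i\<in>A. f i) x = (\<Sum>i\<in>A. f i x)"
  for f :: "'i \<Rightarrow> 'a \<Rightarrow> 'b::comm_monoid_add"
  by (induction A rule: infinite_finite_induct) auto

lemma cfun_subspace_lincomb:
  assumes P: "cfun.subspace P" and g: "\<And>i. i \<in> A \<Longrightarrow> g i \<in> P"
  shows "(\<lambda>x. \<Sum>i\<in>A. c i * g i x) \<in> P"
proof -
  have "(\<Sum>i\<in>A. (\<lambda>x. c i * g i x)) \<in> P"
    by (intro cfun.subspace_sum[OF P] cfun.subspace_scale[OF P] g)
  moreover have "(\<Sum>i\<in>A. (\<lambda>x. c i * g i x)) = (\<lambda>x. \<Sum>i\<in>A. c i * g i x)"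
    by (simp add: fun_eq_iff sum_fun_apply)
  ultimately show ?thesis by simp
qed

lemma cfun_subspace_diff: "cfun.subspace P \<Longrightarrow> p \<in> P \<Longrightarrow> q \<in> P \<Longrightarrow> (\<lambda>x. p x - q x) \<in> P"
  using cfun.subspace_diff[of P p q] by (simp add: fun_diff_def)

lemma cfun_subspace_add: "cfun.subspace P \<Longrightarrow> p \<in> P \<Longrightarrow> q \<in> P \<Longrightarrow> (\<lambda>x. p x + q x) \<in> P"
  using cfun.subspace_add[of P p q] by (simp add: plus_fun_def)

definition orthonormal :: "'a measure \<Rightarrow> nat \<Rightarrow> (nat \<Rightarrow> 'a \<Rightarrow> complex) \<Rightarrow> bool" where
  "orthonormal M d g \<longleftrightarrow> (\<forall>i<d. g i \<in> L2 M) \<and>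
     (\<forall>i<d. \<forall>j<d. (\<integral>x. cnj (g i x) * g j x \<partial>M) = (if i = j then 1 else 0))"

lemma integral_cnj_lincomb:
  assumes "h \<in> L2 M" and g: "\<And>i. i < d \<Longrightarrow> g i \<in> L2 M"
  shows "(\<integral>x. cnj (h x) * (\<Sum>i<d. c i * g i x) \<partial>M) = (\<Sum>i<d. c i * (\<integral>x. cnj (h x) * g i x \<partial>M))"
proof -
  have "(\<integral>x. cnj (h x) * (\<Sum>i<d. c i * g i x) \<partial>M) = (\<integral>x. (\<Sum>i<d. c i * (cnj (h x) * g i x)) \<partial>M)"
    by (simp add: sum_distrib_left mult.left_commute)
  also have "\<dots> = (\<Sum>i<d. \<integral>x. c i * (cnj (h x) * g i x) \<partial>M)"
    by (intro Bochner_Integration.integral_sum integrable_mult_right L2_integrable_mult assms) auto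
  finally show ?thesis by simp
qed

lemma orthonormal_coeff:
  assumes "orthonormal M d g" "j < d"
  shows "(\<integral>x. cnj (g j x) * (\<Sum>i<d. c i * g i x) \<partial>M) = c j"
proof -
  have "(\<integral>x. cnj (g j x) * (\<Sum>i<d. c i * g i x) \<partial>M) = (\<Sum>i<d. c i * (\<integral>x. cnj (g j x) * g i x \<partial>M))"
    using assms unfolding orthonormal_def by (intro integral_cnj_lincomb) auto
  also have "\<dots> = (\<Sum>i<d. if i = j then c i else 0)"
    using assms unfolding orthonormal_def by (intro sum.cong refl) auto
  finally show ?thesis using assms(2) by simp
qed

lemma orthonormal_Parseval:
  assumes g: "orthonormal M d g" and L2: "(\<lambda>x. \<Sum>i<d. c i * g i x) \<in> L2 M"
  shows "(Lnorm 2 M (\<lambda>x. \<Sum>i<d. c i * g i x))\<^sup>2 = ennreal (\<Sum>i<d. (cmod (c i))\<^sup>2)"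
proof -
  let ?q = "\<lambda>x. \<Sum>i<d. c i * g i x"
  have gL: "\<And>i. i < d \<Longrightarrow> g i \<in> L2 M" using g unfolding orthonormal_def by blast
  have "(\<integral>x. cnj (?q x) * ?q x \<partial>M) = (\<Sum>i<d. c i * (\<integral>x. cnj (?q x) * g i x \<partial>M))"
    by (rule integral_cnj_lincomb[OF L2 gL])
  also have "\<dots> = (\<Sum>i<d. c i * cnj (c i))"
  proof (intro sum.cong refl)
    fix i assume "i \<in> {..<d}"
    then have "cnj (\<integral>x. cnj (g i x) * ?q x \<partial>M) = cnj (c i)"
      using orthonormal_coeff[OF g, of i c] by simp
    then have "(\<integral>x. cnj (cnj (g i x) * ?q x) \<partial>M) = cnj (c i)" by (simp only: Bochner_Integration.integral_cnj)
    then show "c i * (\<integral>x. cnj (?q x) * g i x \<partial>M) = c i * cnj (c i)"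
      by (simp add: mult.commute)
  qed
  also have "\<dots> = of_real (\<Sum>i<d. (cmod (c i))\<^sup>2)"
    unfolding of_real_sum complex_norm_square ..
  finally show ?thesis
    using L2_integral_cnj_self(1)[OF L2] by simp
qed

text \<open>Orthonormal families are linearly independent. The bound guarantees that a longest one
  in \<open>P\<close> exists.\<close>

lemma orthonormal_card_le_dim:
  assumes g: "orthonormal M d g" and gP: "\<And>i. i < d \<Longrightarrow> g i \<in> P" and B: "finite B" "cfun.span B = P"
  shows "d \<le> cfun.dim P"
proof -
  have inj: "inj_on g {..<d}"
  proof (rule inj_onI)
    fix i j assume "i \<in> {..<d}" "j \<in> {..<d}" "g i = g j"
    then have "(\<integral>x. cnj (g i x) * g j x \<partial>M) = 1" "i < d" "j < d"
      using g unfolding orthonormal_def by auto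
    then show "i = j" using g unfolding orthonormal_def by (metis zero_neq_one)
  qed
  have "cfun.independent (g ` {..<d})"
  proof
    assume "cfun.dependent (g ` {..<d})"
    then obtain c where c: "\<exists>v\<in>g ` {..<d}. c v \<noteq> 0" and z: "(\<Sum>v\<in>g ` {..<d}. (\<lambda>x. c v * v x)) = 0"
      unfolding cfun.dependent_finite[OF finite_imageI[OF finite_lessThan]] by auto
    from c obtain j where j: "j < d" "c (g j) \<noteq> 0" by auto
    have "(\<Sum>i<d. (\<lambda>x. c (g i) * g i x)) = 0"
      using z unfolding sum.reindex[OF inj] comp_def .
    then have "(\<Sum>i<d. c (g i) * g i x) = 0" for x
      by (metis (no_types, lifting) sum_fun_apply sum.cong zero_fun_apply)
    then have "c (g j) = 0"
      using orthonormal_coeff[OF g j(1), of "\<lambda>i. c (g i)"] by simp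
    then show False using j by simp
  qed
  moreover obtain B' where B': "B' \<subseteq> P" "cfun.independent B'" "P \<subseteq> cfun.span B'" "card B' = cfun.dim P"
    using cfun.basis_exists by blast
  moreover have "finite B'"
    using cfun.independent_span_bound[OF B(1) B'(2)] B' B(2) by auto
  ultimately have "card (g ` {..<d}) \<le> card B'"
    using gP by (intro cfun.independent_span_bound[THEN conjunct2]) auto
  then show ?thesis using card_image[OF inj] B' by simp
qed

text \<open>A longest orthonormal family spans: otherwise the residual of some element, after
  subtraction of its projection, could be normalised and appended. The hypothesis \<open>def\<close>
  excludes a nonzero residual of norm 0; over \<Omega> it expresses injectivity of the
  restriction.\<close>

lemma orthonormal_basis_exists:
  assumes P: "cfun.subspace P" "finite B" "cfun.span B = P" and PL: "P \<subseteq> L2 M"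
    and def: "\<And>p. p \<in> P \<Longrightarrow> Lnorm 2 M p = 0 \<Longrightarrow> p = (\<lambda>x. 0)"
  obtains d g where "d \<le> cfun.dim P" "orthonormal M d g" "\<And>i. i < d \<Longrightarrow> g i \<in> P"
    "\<And>p. p \<in> P \<Longrightarrow> \<exists>c. p = (\<lambda>x. \<Sum>i<d. c i * g i x)"
proof -
  define D where "D = {d. \<exists>g. orthonormal M d g \<and> (\<forall>i<d. g i \<in> P)}"
  have le: "d \<le> cfun.dim P" if "d \<in> D" for d
    using that orthonormal_card_le_dim[OF _ _ P(2,3)] unfolding D_def by blast
  then have fin: "finite D" by (meson finite_nat_set_iff_bounded_le)
  have "0 \<in> D" unfolding D_def orthonormal_def by simp
  define d where "d = Max D"
  have d: "d \<in> D" unfolding d_def using fin \<open>0 \<in> D\<close> by (intro Max_in) auto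
  have max: "Suc d \<notin> D" using Max_ge[OF fin, of "Suc d"] unfolding d_def by auto
  obtain g where g: "orthonormal M d g" and gP: "\<And>i. i < d \<Longrightarrow> g i \<in> P"
    using d unfolding D_def by auto
  have "\<exists>c. p = (\<lambda>x. \<Sum>i<d. c i * g i x)" if p: "p \<in> P" for p
  proof (rule ccontr)
    assume nex: "\<not> ?thesis"
    define c where "c i = (\<integral>x. cnj (g i x) * p x \<partial>M)" for i
    define s where "s = (\<lambda>x. \<Sum>i<d. c i * g i x)"
    define r where "r = (\<lambda>x. p x - s x)"
    have sP: "s \<in> P" unfolding s_def using gP by (intro cfun_subspace_lincomb[OF P(1)]) auto
    have rP: "r \<in> P" unfolding r_def by (rule cfun_subspace_diff[OF P(1) p sP])
    have rL: "r \<in> L2 M" "s \<in> L2 M" "p \<in> L2 M" using rP sP p PL by auto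
    have orth: "(\<integral>x. cnj (g i x) * r x \<partial>M) = 0" if i: "i < d" for i
    proof -
      have gi: "g i \<in> L2 M" using gP[OF i] PL by auto
      have "(\<integral>x. cnj (g i x) * r x \<partial>M) = (\<integral>x. cnj (g i x) * p x \<partial>M) - (\<integral>x. cnj (g i x) * s x \<partial>M)"
        unfolding r_def right_diff_distrib
        by (rule Bochner_Integration.integral_diff) (intro L2_integrable_mult gi rL)+
      also have "(\<integral>x. cnj (g i x) * s x \<partial>M) = c i"
        unfolding s_def by (rule orthonormal_coeff[OF g i])
      finally show ?thesis by (simp add: c_def)
    qed
    define N where "N = Re (\<integral>x. cnj (r x) * r x \<partial>M)"
    have N: "(\<integral>x. cnj (r x) * r x \<partial>M) = of_real N" "ennreal N = (Lnorm 2 M r)\<^sup>2"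
      unfolding N_def using L2_integral_cnj_self[OF rL(1)] by auto
    have "N > 0"
    proof (rule ccontr)
      assume "\<not> N > 0"
      then have "Lnorm 2 M r = 0" using N(2) by (simp add: ennreal_neg)
      then have "r = (\<lambda>x. 0)" by (rule def[OF rP])
      then have "p = s" by (simp add: r_def fun_eq_iff)
      then show False using nex unfolding s_def by blast
    qed
    define e where "e = (\<lambda>x. of_real (1 / sqrt N) * r x)"
    have eP: "e \<in> P" unfolding e_def by (rule cfun.subspace_scale[OF P(1) rP])
    define h where "h = (\<lambda>i. if i < d then g i else e)"
    have ge: "(\<integral>x. cnj (g i x) * e x \<partial>M) = 0" if "i < d" for i
      using orth[OF that] by (simp add: e_def mult.left_commute)
    have eg: "(\<integral>x. cnj (e x) * g i x \<partial>M) = 0" if "i < d" for i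
    proof -
      have "(\<integral>x. cnj (cnj (g i x) * e x) \<partial>M) = 0"
        unfolding Bochner_Integration.integral_cnj ge[OF that] by simp
      then show ?thesis by (simp add: mult.commute)
    qed
    have ee: "(\<integral>x. cnj (e x) * e x \<partial>M) = 1"
    proof -
      have "(\<lambda>x. cnj (e x) * e x) = (\<lambda>x. of_real (1 / N) * (cnj (r x) * r x))"
      proof
        fix x
        have "cnj (e x) * e x = (of_real (1 / sqrt N) * of_real (1 / sqrt N)) * (cnj (r x) * r x)"
          unfolding e_def by simp
        also have "of_real (1 / sqrt N) * of_real (1 / sqrt N) = (of_real (1 / N) :: complex)"
          using \<open>N > 0\<close> by (simp flip: of_real_mult)
        finally show "cnj (e x) * e x = of_real (1 / N) * (cnj (r x) * r x)" .
      qed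
      then have "(\<integral>x. cnj (e x) * e x \<partial>M) = of_real (1 / N) * (\<integral>x. cnj (r x) * r x \<partial>M)"
        by (simp only: integral_mult_right_zero)
      then show ?thesis using N(1) \<open>N > 0\<close> by simp
    qed
    have hP: "\<forall>i<Suc d. h i \<in> P" unfolding h_def using gP eP by auto
    then have "\<forall>i<Suc d. h i \<in> L2 M" using PL by blast
    then have "orthonormal M (Suc d) h"
      using g unfolding orthonormal_def h_def by (auto simp: less_Suc_eq ge eg ee)
    then show False using max hP unfolding D_def by blast
  qed
  then show thesis using that[OF le[OF d] g gP] by blast
qed

lemma orthonormal_le_christoffel:
  assumes P: "cfun.subspace P" "P \<subseteq> L2 M" and g: "orthonormal M d g" "\<And>i. i < d \<Longrightarrow> g i \<in> P"
  shows "ennreal (\<Sum>i<d. (cmod (g i x))\<^sup>2) \<le> christoffel P M x"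
proof (cases "(\<Sum>i<d. (cmod (g i x))\<^sup>2) = 0")
  case False
  define K where "K = (\<Sum>i<d. (cmod (g i x))\<^sup>2)"
  have "0 \<le> K" unfolding K_def by (intro sum_nonneg) auto
  then have K: "0 < K" using False unfolding K_def by linarith
  \<comment> \<open>The normalised reproducing kernel at \<open>x\<close>: it has norm 1 and takes
    the extremal value sqrt K there.\<close>
  define c where "c i = of_real (1 / sqrt K) * cnj (g i x)" for i
  define p where "p = (\<lambda>x. \<Sum>i<d. c i * g i x)"
  have pP: "p \<in> P" unfolding p_def using g(2) by (intro cfun_subspace_lincomb[OF P(1)]) auto
  have "(Lnorm 2 M p)\<^sup>2 = ennreal (\<Sum>i<d. (cmod (c i))\<^sup>2)"
    using pP P(2) unfolding p_def by (intro orthonormal_Parseval[OF g(1)]) auto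
  also have "(\<Sum>i<d. (cmod (c i))\<^sup>2) = (\<Sum>i<d. 1 / K * (cmod (g i x))\<^sup>2)"
    using K by (intro sum.cong refl) (simp add: c_def norm_divide power_divide)
  also have "\<dots> = 1" unfolding sum_distrib_left[symmetric] K_def[symmetric] using K by simp
  finally have n1: "(Lnorm 2 M p)\<^sup>2 = 1" by simp
  have "p x = of_real (1 / sqrt K) * of_real K"
    unfolding p_def c_def K_def of_real_sum complex_norm_square
    by (simp add: sum_distrib_left sum_divide_distrib mult.commute mult.left_commute)
  then have "cmod (p x) = 1 / sqrt K * K" using K by (simp add: norm_mult norm_divide)
  then have "(cmod (p x))\<^sup>2 = K" using K by (simp add: power_mult_distrib power_divide power2_eq_square)
  then show ?thesis
    unfolding christoffel_def K_def[symmetric] using pP n1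
    by (intro SUP_upper2[of p]) auto
qed simp

section \<open>Remez constants\<close>

lemma Lnorm_le_remez:
  assumes P: "cfun.subspace P" "P \<subseteq> L2 M" and \<Omega>: "\<Omega> \<in> sets M" and p: "p \<in> P"
    and q: "q = 2 \<or> q = \<infinity>" and pos: "Lnorm 2 (restrict_space M \<Omega>) p \<noteq> 0"
  shows "Lnorm q M p \<le> remez P M \<Omega> q 2 * Lnorm 2 (restrict_space M \<Omega>) p"
proof -
  let ?N = "Lnorm 2 (restrict_space M \<Omega>) p"
  have "p \<in> L2 (restrict_space M \<Omega>)" using L2_restrict[OF \<Omega>] p P by blast
  then have m: "p \<in> borel_measurable (restrict_space M \<Omega>)" and "?N < \<infinity>"
    unfolding L2_def by auto
  then obtain N where N: "?N = ennreal N" "0 < N"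
    using pos by (cases ?N) (auto simp: less_le)
  \<comment> \<open>By homogeneity the element scaled to norm at most 1 over \<Omega> suffices;
    \<open>pos\<close> keeps it among the elements over which \<open>remez\<close> takes its
    supremum.\<close>
  define r where "r = (\<lambda>x. of_real (1 / N) * p x)"
  have pr: "p = (\<lambda>x. of_real N * r x)" using N by (simp add: r_def fun_eq_iff)
  have rP: "r \<in> P" unfolding r_def by (rule cfun.subspace_scale[OF P(1) p])
  have rL: "r \<in> L2 (restrict_space M \<Omega>)" using L2_restrict[OF \<Omega>] rP P by blast
  have rM: "r \<in> borel_measurable M" using rP P unfolding L2_def by blast
  have "Lnorm 2 (restrict_space M \<Omega>) r \<le> ennreal (cmod (of_real (1 / N))) * ?N"
    unfolding r_def by (rule Lnorm_cmult_le[OF m]) simp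
  also have "\<dots> = ennreal (1 / N * N)"
    unfolding N(1) using N(2) by (subst ennreal_mult) (auto simp: norm_divide)
  also have "\<dots> = 1" using N by simp
  finally have le1: "Lnorm 2 (restrict_space M \<Omega>) r \<le> 1" .
  have "Lnorm 2 (restrict_space M \<Omega>) r \<noteq> 0"
  proof
    assume z: "Lnorm 2 (restrict_space M \<Omega>) r = 0"
    have "?N \<le> ennreal (cmod (of_real N)) * Lnorm 2 (restrict_space M \<Omega>) r"
      unfolding pr using rL unfolding L2_def by (intro Lnorm_cmult_le) auto
    then show False using z pos by simp
  qed
  then have "Lnorm q M r \<le> remez P M \<Omega> q 2"
    unfolding remez_def using rP le1 by (intro SUP_upper) (auto simp: zero_less_iff_neq_zero)
  moreover have "Lnorm q M p \<le> ennreal N * Lnorm q M r"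
    using Lnorm_cmult_le[OF rM q, of "of_real N"] N unfolding pr[symmetric] by simp
  ultimately show ?thesis
    unfolding N(1) by (metis mult.commute mult_left_mono order_trans zero_le)
qed

text \<open>The perturbed constant has the same norm over \<Omega> as 1, which is positive because
  \<Omega> has positive measure and at most 1 because the measure is a probability. The supremum
  norm case reduces to the smaller L^2 norm.\<close>

lemma (in prob_space) remez_finite_imp_injective:
  assumes P: "cfun.subspace P" "P \<subseteq> L2 M" and \<Omega>: "\<Omega> \<in> sets M" "0 < measure M \<Omega>"
    and one: "one \<in> P" "AE x in M. one x = 1"
    and q: "q = 2 \<or> q = \<infinity>" and fin: "remez P M \<Omega> q 2 < \<infinity>"
    and p: "p \<in> P" "Lnorm 2 (restrict_space M \<Omega>) p = 0"
  shows "Lnorm 2 M p = 0"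
proof (rule ccontr)
  assume np: "Lnorm 2 M p \<noteq> 0"
  let ?R = "restrict_space M \<Omega>"
  have \<Omega>M: "\<Omega> \<inter> space M \<in> sets M" using \<Omega>(1) by auto
  have L2M: "p \<in> L2 M" "one \<in> L2 M" using p one P by auto
  then have meas [measurable]: "p \<in> borel_measurable M" "one \<in> borel_measurable M" unfolding L2_def by auto
  have "Lnorm 2 M p < \<infinity>" using L2M unfolding L2_def by simp
  then obtain N where N: "Lnorm 2 M p = ennreal N" "0 < N" using np by (cases "Lnorm 2 M p") (auto simp: less_le)
  obtain R where R: "remez P M \<Omega> q 2 = ennreal R" "0 \<le> R" using fin by (cases "remez P M \<Omega> q 2") auto
  have one1: "Lnorm 2 M one = 1"
  proof -
    have "(Lnorm 2 M one)\<^sup>2 = (\<integral>\<^sup>+x. 1 \<partial>M)"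
      unfolding Lnorm_2_power2 using one(2) by (intro nn_integral_cong_AE) auto
    also have "\<dots> = 1\<^sup>2" by (simp add: emeasure_space_1)
    finally have e: "(Lnorm 2 M one)\<^sup>2 = 1\<^sup>2" .
    show ?thesis by (rule antisym; rule ennreal_power2_le_imp_le; simp add: e)
  qed
  \<comment> \<open>Then \<open>t * p\<close> has norm R + 2, whereas the difference of
    \<open>h\<close> and \<open>one\<close> has norm at most R + 1.\<close>
  define t where "t = (R + 2) / N"
  have t0: "0 < t" using R N by (simp add: t_def)
  define h where "h = (\<lambda>x. one x + of_real t * p x)"
  have hP: "h \<in> P" unfolding h_def by (intro cfun_subspace_add[OF P(1) one(1)] cfun.subspace_scale[OF P(1) p(1)])
  have pR: "AE x in ?R. p x = 0"
    using p(2) Lnorm_2_eq_0_iff[of p ?R] L2_restrict[OF \<Omega>(1) L2M(1)] unfolding L2_def by auto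
  have "Lnorm 2 ?R h = Lnorm 2 ?R one"
    by (rule Lnorm_2_cong_AE, use pR in eventually_elim) (simp add: h_def)
  moreover have "Lnorm 2 ?R one \<le> 1" using Lnorm_2_restrict_le[OF \<Omega>(1), of one] one1 by simp
  moreover have "Lnorm 2 ?R one \<noteq> 0"
  proof
    assume "Lnorm 2 ?R one = 0"
    then have "AE x in ?R. one x = 0"
      using Lnorm_2_eq_0_iff[of one ?R] L2_restrict[OF \<Omega>(1) L2M(2)] unfolding L2_def by auto
    then have "AE x in M. x \<notin> \<Omega>"
      using one(2) unfolding AE_restrict_space_iff[OF \<Omega>M] by eventually_elim auto
    then have "emeasure M \<Omega> = 0"
      using \<Omega>(1) by (subst (asm) AE_iff_measurable[OF \<Omega>(1)]) (auto dest: sets.sets_into_space)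
    then show False using \<Omega>(2) by (simp add: measure_def)
  qed
  ultimately have "Lnorm q M h \<le> ennreal R"
    unfolding R(1)[symmetric] remez_def using hP by (intro SUP_upper) (auto simp: zero_less_iff_neq_zero)
  moreover have "Lnorm 2 M h \<le> Lnorm q M h" using q Lnorm_2_le_infinity by auto
  ultimately have h: "Lnorm 2 M h \<le> ennreal R" by (meson order_trans)
  have hm: "h \<in> borel_measurable M" using hP P unfolding L2_def by blast
  have "p = (\<lambda>x. of_real (1 / t) * (h x + (-1) * one x))"
    using t0 by (simp add: h_def fun_eq_iff)
  then have "ennreal N \<le> ennreal (cmod (of_real (1 / t))) * Lnorm 2 M (\<lambda>x. h x + (-1) * one x)"
    unfolding N(1)[symmetric] using hm Lnorm_cmult_le[of "\<lambda>x. h x + (-1) * one x" M 2 "of_real (1 / t)"] by simp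
  also have "\<dots> \<le> ennreal (cmod (of_real (1 / t))) * (Lnorm 2 M h + Lnorm 2 M (\<lambda>x. (-1) * one x))"
    using hm by (intro mult_left_mono Lnorm_2_triangle) auto
  also have "\<dots> \<le> ennreal (cmod (of_real (1 / t))) * (ennreal R + 1)"
    using h Lnorm_cmult_le[of one M 2 "-1"] one1 by (intro mult_left_mono add_mono) auto
  also have "\<dots> = ennreal (1 / t * (R + 1))"
  proof -
    have "ennreal (cmod (of_real (1 / t))) = ennreal (1 / t)" "ennreal R + 1 = ennreal (R + 1)"
      using t0 R by (simp_all add: norm_divide)
    moreover have "ennreal (1 / t) * ennreal (R + 1) = ennreal (1 / t * (R + 1))"
      using t0 R by (intro ennreal_mult[symmetric]) auto
    ultimately show ?thesis by simp
  qed
  finally have "N \<le> 1 / t * (R + 1)" using R t0 by (subst (asm) ennreal_le_iff) auto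
  also have "\<dots> = N * ((R + 1) / (R + 2))" using R N by (simp add: t_def)
  also have "\<dots> < N * 1" using R N by (intro mult_strict_left_mono) (auto simp: divide_less_eq)
  finally show False by simp
qed

section \<open>Weighted least squares\<close>

text \<open>The product of \<open>v\<close> and its inverse is at most 1, being 0 where
  \<open>v\<close> is 0 or infinite, whence an inequality only. Infinite weights at zeros of
  \<open>v\<close> thus add nothing to the integral under the sampling measure.\<close>

lemma nn_integral_density_inverse_le:
  assumes [measurable]: "v \<in> borel_measurable M" "h \<in> borel_measurable M"
  shows "(\<integral>\<^sup>+x. inverse (v x) * h x \<partial>density M v) \<le> (\<integral>\<^sup>+x. h x \<partial>M)"
proof -
  have le: "a * (inverse a * b) \<le> b" for a b :: ennreal
  proof -
    have "a * inverse a \<le> 1"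
    proof (cases a)
      case (real r)
      then show ?thesis by (cases "r = 0") (auto simp: inverse_ennreal ennreal_mult[symmetric])
    qed simp
    then have "(a * inverse a) * b \<le> 1 * b" by (intro mult_right_mono) auto
    then show ?thesis by (simp add: mult.assoc)
  qed
  have "(\<integral>\<^sup>+x. inverse (v x) * h x \<partial>density M v) = (\<integral>\<^sup>+x. v x * (inverse (v x) * h x) \<partial>M)"
    by (rule nn_integral_density) measurable
  also have "\<dots> \<le> (\<integral>\<^sup>+x. h x \<partial>M)" by (intro nn_integral_mono le)
  finally show ?thesis .
qed

text \<open>The strict inequality covers c = 0, where \<open>Q\<close> vanishes almost everywhere;
  this occurs when \<open>f\<close> agrees almost everywhere with its best approximation.\<close>

lemma nn_integral_Markov_strict:
  assumes [measurable]: "Q \<in> borel_measurable S" and Q: "(\<integral>\<^sup>+s. Q s \<partial>S) \<le> ennreal c" and t: "0 < t"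
  shows "emeasure S {s \<in> space S. ennreal (t * c) < Q s} \<le> ennreal (1 / t)"
proof (cases "0 < c")
  case False
  then have "(\<integral>\<^sup>+s. Q s \<partial>S) = 0" using Q by (simp add: ennreal_neg)
  then have "AE s in S. Q s = 0" by (subst (asm) nn_integral_0_iff_AE) auto
  moreover have "ennreal (t * c) = 0" using False t by (simp add: ennreal_neg mult_le_0_iff)
  ultimately have "emeasure S {s \<in> space S. ennreal (t * c) < Q s} = 0"
    by (intro emeasure_eq_0_AE) auto
  then show ?thesis by simp
next
  case True
  have "emeasure S {s \<in> space S. ennreal (t * c) < Q s} \<le> emeasure S {s \<in> space S. 1 \<le> ennreal (1 / (t * c)) * Q s}"
  proof (intro emeasure_mono subsetI)
    fix s assume "s \<in> {s \<in> space S. ennreal (t * c) < Q s}"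
    then have s: "s \<in> space S" "ennreal (t * c) \<le> Q s" by auto
    have "ennreal (1 / (t * c)) * ennreal (t * c) \<le> ennreal (1 / (t * c)) * Q s"
      by (intro mult_left_mono s) auto
    moreover have "ennreal (1 / (t * c)) * ennreal (t * c) = 1"
      using t True by (subst ennreal_mult[symmetric]) auto
    ultimately show "s \<in> {s \<in> space S. 1 \<le> ennreal (1 / (t * c)) * Q s}" using s by simp
  qed measurable
  also have "\<dots> \<le> ennreal (1 / (t * c)) * (\<integral>\<^sup>+s. Q s * indicator (space S) s \<partial>S)"
    using nn_integral_Markov_inequality[of Q "space S" S "ennreal (1 / (t * c))"] by auto
  also have "(\<integral>\<^sup>+s. Q s * indicator (space S) s \<partial>S) = (\<integral>\<^sup>+s. Q s \<partial>S)"
    by (intro nn_integral_cong) simp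
  also have "ennreal (1 / (t * c)) * \<dots> \<le> ennreal (1 / (t * c)) * ennreal c"
    by (intro mult_left_mono Q) auto
  also have "\<dots> = ennreal (1 / t)" using t True by (subst ennreal_mult[symmetric]) auto
  finally show ?thesis .
qed

lemma emeasure_empirical_mean_gt:
  assumes X: "\<And>i. i < m \<Longrightarrow> X i \<in> S \<rightarrow>\<^sub>M N" "\<And>i. i < m \<Longrightarrow> distr S N (X i) = N" and m: "0 < m"
    and h [measurable]: "h \<in> borel_measurable N" and c: "(\<integral>\<^sup>+x. h x \<partial>N) \<le> ennreal c" and t: "0 < t"
  defines "B \<equiv> {s \<in> space S. ennreal (t * c) < ennreal (1 / real m) * (\<Sum>i<m. h (X i s))}"
  shows "B \<in> sets S" and "emeasure S B \<le> ennreal (1 / t)"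
proof -
  have hX: "(\<lambda>s. h (X i s)) \<in> borel_measurable S" if "i < m" for i
    using X(1)[OF that] h by (rule measurable_compose)
  then have Q: "(\<lambda>s. ennreal (1 / real m) * (\<Sum>i<m. h (X i s))) \<in> borel_measurable S"
    by (intro borel_measurable_times_ennreal borel_measurable_sum) auto
  then show "B \<in> sets S" unfolding B_def by measurable
  have "(\<integral>\<^sup>+s. ennreal (1 / real m) * (\<Sum>i<m. h (X i s)) \<partial>S) = ennreal (1 / real m) * (\<Sum>i<m. \<integral>\<^sup>+s. h (X i s) \<partial>S)"
  proof -
    have "(\<lambda>s. \<Sum>i<m. h (X i s)) \<in> borel_measurable S"
      using hX by (intro borel_measurable_sum) auto
    moreover have "(\<integral>\<^sup>+s. (\<Sum>i<m. h (X i s)) \<partial>S) = (\<Sum>i<m. \<integral>\<^sup>+s. h (X i s) \<partial>S)"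
      using hX by (intro nn_integral_sum) auto
    ultimately show ?thesis by (simp add: nn_integral_cmult)
  qed
  also have "(\<Sum>i<m. \<integral>\<^sup>+s. h (X i s) \<partial>S) = (\<Sum>i<m. \<integral>\<^sup>+x. h x \<partial>N)"
  proof (rule sum.cong[OF refl])
    fix i assume "i \<in> {..<m}"
    then have i: "i < m" by simp
    have "(\<integral>\<^sup>+x. h x \<partial>distr S N (X i)) = (\<integral>\<^sup>+s. h (X i s) \<partial>S)"
      by (rule nn_integral_distr[OF X(1)[OF i]]) measurable
    then show "(\<integral>\<^sup>+s. h (X i s) \<partial>S) = (\<integral>\<^sup>+x. h x \<partial>N)" unfolding X(2)[OF i] by simp
  qed
  also have "ennreal (1 / real m) * \<dots> \<le> ennreal (1 / real m) * (of_nat m * ennreal c)"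
    using c by (intro mult_left_mono) (auto intro: mult_left_mono)
  also have "\<dots> = ennreal (1 / real m) * ennreal (real m) * ennreal c"
    by (simp add: ennreal_of_nat_eq_real_of_nat mult.assoc)
  also have "ennreal (1 / real m) * ennreal (real m) = 1"
    using m by (subst ennreal_mult[symmetric]) auto
  finally have "(\<integral>\<^sup>+s. ennreal (1 / real m) * (\<Sum>i<m. h (X i s)) \<partial>S) \<le> ennreal c" by simp
  then show "emeasure S B \<le> ennreal (1 / t)"
    unfolding B_def by (rule nn_integral_Markov_strict[OF Q _ t])
qed

text \<open>Pythagoras at the samples: with a the residual of \<open>q\<close> and b = p - q,
  minimality along the segment from \<open>q\<close> to \<open>p\<close> makes the weighted inner
  product C of a and b nonpositive, so |a - b|^2 = |a|^2 - 2 C + |b|^2 is at least |b|^2.\<close>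

lemma wls_minimizer_sum_le:
  assumes P: "cfun.subspace P" and p: "p \<in> P" and m: "0 < m" and fin: "\<And>i. i < m \<Longrightarrow> w (x i) < \<infinity>"
    and min: "wls_minimizer P m w x y q"
  shows "(\<Sum>i<m. enn2real (w (x i)) * (cmod (p (x i) - q (x i)))\<^sup>2)
    \<le> (\<Sum>i<m. enn2real (w (x i)) * (cmod (y i - p (x i)))\<^sup>2)"
proof -
  let ?W = "\<lambda>i. enn2real (w (x i))"
  define l where "l r = (\<Sum>i<m. ?W i * (cmod (y i - r (x i)))\<^sup>2)" for r
  have l0: "0 \<le> l r" for r unfolding l_def by (intro sum_nonneg) auto
  have loss: "wls_loss m w x y r = ennreal (1 / real m * l r)" for r
  proof -
    have "(\<Sum>i<m. w (x i) * ennreal ((cmod (y i - r (x i)))\<^sup>2)) = (\<Sum>i<m. ennreal (?W i * (cmod (y i - r (x i)))\<^sup>2))"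
    proof (rule sum.cong[OF refl])
      fix i assume "i \<in> {..<m}"
      then have "w (x i) = ennreal (?W i)" using fin[of i] by simp
      then show "w (x i) * ennreal ((cmod (y i - r (x i)))\<^sup>2) = ennreal (?W i * (cmod (y i - r (x i)))\<^sup>2)"
        by (metis ennreal_mult' enn2real_nonneg)
    qed
    also have "\<dots> = ennreal (l r)" unfolding l_def by (rule sum_ennreal) auto
    finally show ?thesis unfolding wls_loss_def using l0[of r] by (subst ennreal_mult) auto
  qed
  have qP: "q \<in> P" and ge: "l q \<le> l r" if "r \<in> P" for r
  proof -
    from min have "q \<in> P" and "\<not> wls_loss m w x y r < wls_loss m w x y q"
      using that unfolding wls_minimizer_def is_arg_min_def by auto
    then show "q \<in> P" and "l q \<le> l r"
      using m l0[of r] l0[of q] unfolding loss by (auto simp: not_less ennreal_le_iff divide_le_cancel)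
  qed
  have qP: "q \<in> P" using qP p by blast
  define a where "a i = y i - q (x i)" for i
  define b where "b i = p (x i) - q (x i)" for i
  define D where "D = (\<Sum>i<m. ?W i * (cmod (b i))\<^sup>2)"
  define C where "C = (\<Sum>i<m. ?W i * (a i \<bullet> b i))"
  have exp: "l (\<lambda>z. q z + of_real t * (p z - q z)) = l q - 2 * t * C + t\<^sup>2 * D" for t :: real
  proof -
    have "(cmod (u - of_real t * v))\<^sup>2 = (cmod u)\<^sup>2 - 2 * t * (u \<bullet> v) + t\<^sup>2 * (cmod v)\<^sup>2" for u v
      unfolding cmod_power2 inner_complex_def by (simp add: algebra_simps power2_eq_square)
    from this[of "a _" "b _"] have "l (\<lambda>z. q z + of_real t * (p z - q z))
        = (\<Sum>i<m. ?W i * ((cmod (a i))\<^sup>2 - 2 * t * (a i \<bullet> b i) + t\<^sup>2 * (cmod (b i))\<^sup>2))"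
      unfolding l_def a_def b_def by (simp add: diff_diff_eq)
    also have "\<dots> = l q - 2 * t * C + t\<^sup>2 * D"
      unfolding l_def C_def D_def a_def[symmetric]
      by (simp add: algebra_simps sum.distrib sum_subtractf sum_distrib_left)
    finally show ?thesis .
  qed
  have var: "2 * C \<le> t * D" if "0 < t" for t :: real
  proof -
    have "(\<lambda>z. p z - q z) \<in> P" using cfun.subspace_diff[OF P p qP] by (simp add: fun_diff_def)
    then have "(\<lambda>z. of_real t * (p z - q z)) \<in> P" by (rule cfun.subspace_scale[OF P])
    from cfun.subspace_add[OF P qP this] have "(\<lambda>z. q z + of_real t * (p z - q z)) \<in> P"
      by (simp add: plus_fun_def)
    from ge[OF this] have "t * (2 * C) \<le> t * (t * D)" unfolding exp by (simp add: power2_eq_square)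
    then show ?thesis using that by simp
  qed
  have D0: "0 \<le> D" unfolding D_def by (intro sum_nonneg) auto
  \<comment> \<open>A positive C is contradicted by a small t; the denominator D + 1 allows D = 0,
    that is, p and q agreeing at all samples of nonzero weight.\<close>
  have "C \<le> 0"
  proof (rule ccontr)
    assume "\<not> C \<le> 0"
    then have C: "0 < C" by simp
    have "2 * C \<le> C / (D + 1) * D" using var[of "C / (D + 1)"] C D0 by simp
    also have "\<dots> \<le> C" using C D0 by (simp add: divide_le_eq)
    finally show False using C by simp
  qed
  \<comment> \<open>At t = 1 the segment has reached \<open>p\<close>.\<close>
  then have "D \<le> l (\<lambda>z. q z + of_real 1 * (p z - q z))"
    unfolding exp[of 1] using l0[of q] by simp
  then show ?thesis unfolding D_def l_def b_def by simp
qed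

text \<open>The frame bound controls N by the weighted distance of \<open>p\<close> and
  \<open>q\<close> at the samples, optimality of \<open>q\<close> bounds that by the weighted
  residual of \<open>p\<close>, and Minkowski's inequality splits the residual into approximation
  error and noise.\<close>

lemma wls_error_bound:
  assumes P: "cfun.subspace P" and p: "p \<in> P" and m: "0 < m" and \<epsilon>: "0 < \<epsilon>"
    and min: "wls_minimizer P m w x (\<lambda>i. f (x i) + e i) q"
    and meanf: "ennreal (1 / real m) * (\<Sum>i<m. w (x i) * ennreal ((cmod (f (x i) - p (x i)))\<^sup>2)) \<le> ennreal (4 / \<epsilon> * G\<^sup>2)"
    and meanw: "ennreal (1 / real m) * (\<Sum>i<m. w (x i)) \<le> ennreal (4 / \<epsilon>)"
    and frame: "real m / 16 * N\<^sup>2 \<le> (\<Sum>i<m. enn2real (w (x i)) * (cmod (p (x i) - q (x i)))\<^sup>2)"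
    and G: "0 \<le> G"
  shows "N \<le> 8 / sqrt \<epsilon> * (G + L2_set (\<lambda>i. cmod (e i)) {..<m})"
proof -
  let ?W = "\<lambda>i. enn2real (w (x i))"
  let ?E = "L2_set (\<lambda>i. cmod (e i)) {..<m}"
  \<comment> \<open>A finite mean forces every sampled weight to be finite, so
    \<open>enn2real\<close> returns the true weights.\<close>
  have "ennreal (1 / real m) * (\<Sum>i<m. w (x i)) < \<infinity>" using meanw by (rule le_less_trans) simp
  then have fin: "w (x i) < \<infinity>" if "i < m" for i
    using that m by (auto simp: ennreal_mult_less_top)
  then have W: "w (x i) = ennreal (?W i)" if "i < m" for i using that by simp
  have "ennreal (1 / real m) * (\<Sum>i<m. w (x i)) = ennreal (1 / real m * (\<Sum>i<m. ?W i))"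
  proof -
    have "(\<Sum>i<m. w (x i)) = (\<Sum>i<m. ennreal (?W i))" using W by (intro sum.cong) auto
    then show ?thesis by (subst ennreal_mult) (auto intro: sum_nonneg)
  qed
  then have mw: "(\<Sum>i<m. ?W i) \<le> 4 / \<epsilon> * real m"
    using meanw m \<epsilon> by (simp add: ennreal_le_iff divide_le_eq)
  have "ennreal (1 / real m) * (\<Sum>i<m. w (x i) * ennreal ((cmod (f (x i) - p (x i)))\<^sup>2))
      = ennreal (1 / real m * (\<Sum>i<m. ?W i * (cmod (f (x i) - p (x i)))\<^sup>2))"
  proof -
    have "(\<Sum>i<m. w (x i) * ennreal ((cmod (f (x i) - p (x i)))\<^sup>2)) = (\<Sum>i<m. ennreal (?W i * (cmod (f (x i) - p (x i)))\<^sup>2))"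
      using W by (intro sum.cong refl) (metis lessThan_iff ennreal_mult' enn2real_nonneg)
    then show ?thesis by (subst ennreal_mult) (auto intro: sum_nonneg)
  qed
  then have mf: "(\<Sum>i<m. ?W i * (cmod (f (x i) - p (x i)))\<^sup>2) \<le> 4 / \<epsilon> * real m * G\<^sup>2"
    using meanf m \<epsilon> by (simp add: ennreal_le_iff divide_le_eq mult_ac)
  \<comment> \<open>Every |e_i| is at most the Euclidean norm of \<open>e\<close>, so the mean of
    the weights alone controls the noise, without any bound on a single weight.\<close>
  have we: "(\<Sum>i<m. ?W i * (cmod (e i))\<^sup>2) \<le> 4 / \<epsilon> * real m * ?E\<^sup>2"
  proof -
    have "(\<Sum>i<m. ?W i * (cmod (e i))\<^sup>2) \<le> (\<Sum>i<m. ?W i * ?E\<^sup>2)"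
    proof (intro sum_mono mult_left_mono)
      fix i assume "i \<in> {..<m}"
      then show "(cmod (e i))\<^sup>2 \<le> ?E\<^sup>2"
        unfolding L2_set_def by (subst real_sqrt_pow2) (auto intro!: sum_nonneg member_le_sum)
    qed auto
    also have "\<dots> \<le> 4 / \<epsilon> * real m * ?E\<^sup>2"
      unfolding sum_distrib_right[symmetric] by (intro mult_right_mono mw) auto
    finally show ?thesis .
  qed
  let ?k = "2 / sqrt \<epsilon> * sqrt (real m)"
  have k2: "?k\<^sup>2 = 4 / \<epsilon> * real m" using \<epsilon> by (simp add: power_mult_distrib power_divide)
  have k0: "0 \<le> ?k" using \<epsilon> by simp
  have root: "sqrt z \<le> ?k * r" if "z \<le> 4 / \<epsilon> * real m * r\<^sup>2" "0 \<le> r" for z r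
  proof (rule real_le_lsqrt)
    show "0 \<le> ?k * r" using mult_nonneg_nonneg[OF k0 that(2)] .
    show "z \<le> (?k * r)\<^sup>2" unfolding power_mult_distrib[of ?k r] k2 by (rule that(1))
  qed
  have "sqrt (\<Sum>i<m. ?W i * (cmod (f (x i) + e i - p (x i)))\<^sup>2)
      = L2_set (\<lambda>i. sqrt (?W i) * cmod (f (x i) + e i - p (x i))) {..<m}"
    unfolding L2_set_def by (simp add: power_mult_distrib)
  also have "\<dots> \<le> L2_set (\<lambda>i. sqrt (?W i) * cmod (f (x i) - p (x i)) + sqrt (?W i) * cmod (e i)) {..<m}"
  proof (rule L2_set_mono)
    fix i
    have "f (x i) + e i - p (x i) = (f (x i) - p (x i)) + e i" by simp
    then have "cmod (f (x i) + e i - p (x i)) \<le> cmod (f (x i) - p (x i)) + cmod (e i)"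
      by (metis norm_triangle_ineq)
    then show "sqrt (?W i) * cmod (f (x i) + e i - p (x i)) \<le> sqrt (?W i) * cmod (f (x i) - p (x i)) + sqrt (?W i) * cmod (e i)"
      unfolding distrib_left[symmetric] by (rule mult_left_mono) simp
  qed simp
  also have "\<dots> \<le> L2_set (\<lambda>i. sqrt (?W i) * cmod (f (x i) - p (x i))) {..<m} + L2_set (\<lambda>i. sqrt (?W i) * cmod (e i)) {..<m}"
    by (rule L2_set_triangle_ineq)
  also have "\<dots> = sqrt (\<Sum>i<m. ?W i * (cmod (f (x i) - p (x i)))\<^sup>2) + sqrt (\<Sum>i<m. ?W i * (cmod (e i))\<^sup>2)"
    unfolding L2_set_def by (simp add: power_mult_distrib)
  also have "\<dots> \<le> ?k * G + ?k * ?E"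
    by (intro add_mono root mf we G L2_set_nonneg)
  finally have res: "sqrt (\<Sum>i<m. ?W i * (cmod (f (x i) + e i - p (x i)))\<^sup>2) \<le> ?k * (G + ?E)"
    by (simp add: distrib_left)
  have "real m / 16 * N\<^sup>2 \<le> (\<Sum>i<m. ?W i * (cmod (f (x i) + e i - p (x i)))\<^sup>2)"
    using frame wls_minimizer_sum_le[OF P p m fin min] by linarith
  also have "\<dots> = (sqrt (\<Sum>i<m. ?W i * (cmod (f (x i) + e i - p (x i)))\<^sup>2))\<^sup>2"
    by (subst real_sqrt_pow2) (auto intro: sum_nonneg)
  also have "\<dots> \<le> (?k * (G + ?E))\<^sup>2"
    by (intro power_mono res) (auto intro: sum_nonneg)
  \<comment> \<open>The square of \<open>?k\<close> is 4 m / \<epsilon>, which is m / 16 times 64 /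
    \<epsilon>; this yields the factor 8.\<close>
  also have "\<dots> = real m / 16 * (8 / sqrt \<epsilon> * (G + ?E))\<^sup>2"
  proof -
    have "(?k * z)\<^sup>2 = real m / 16 * (8 / sqrt \<epsilon> * z)\<^sup>2" for z
      using \<epsilon> by (simp add: power_mult_distrib power_divide)
    then show ?thesis .
  qed
  finally have "N\<^sup>2 \<le> (8 / sqrt \<epsilon> * (G + ?E))\<^sup>2" using m by simp
  then show ?thesis
    by (rule power2_le_imp_le) (use \<epsilon> G in \<open>auto intro!: mult_nonneg_nonneg add_nonneg_nonneg L2_set_nonneg\<close>)
qed

lemma density_enn2real:
  assumes [measurable]: "v \<in> borel_measurable M" and "AE x in M. v x < \<infinity>"
  shows "density M v = density M (\<lambda>x. ennreal (enn2real (v x)))"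
  using assms by (intro density_cong) auto

text \<open>The second condition in the definition of the vectors holds almost everywhere; it makes the
  norm bound valid at every point.\<close>

lemma isotropic_vectors_weighted_basis:
  assumes prob: "prob_space (density M v)"
    and v: "v \<in> borel_measurable M" and \<Omega>: "\<Omega> \<in> sets M"
    and vpos: "AE x in M. x \<in> \<Omega> \<longrightarrow> 0 < v x"
    and g: "orthonormal (restrict_space M \<Omega>) d g" and gM: "\<And>i. i < d \<Longrightarrow> g i \<in> borel_measurable M"
    and K: "AE x in M. x \<in> \<Omega> \<longrightarrow> inverse (v x) * ennreal (\<Sum>i<d. (cmod (g i x))\<^sup>2) \<le> ennreal K" "0 \<le> K"
  defines "W \<equiv> \<lambda>x. enn2real (inverse (v x))"
  shows "isotropic_vectors (density M v)
    (\<lambda>x i. if x \<in> \<Omega> \<and> W x * (\<Sum>i<d. (cmod (g i x))\<^sup>2) \<le> K then of_real (sqrt (W x)) * cnj (g i x) else 0) d K"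
    (is "isotropic_vectors _ ?u _ _")
proof -
  interpret prob_space "density M v" by (rule prob)
  note [measurable] = v \<Omega>
  \<comment> \<open>The density has integral 1. At a point with infinite \<open>v\<close> the weight
    \<open>W\<close> would be 0, and the cancellation of v against W below would fail.\<close>
  have vfin: "AE x in M. v x < \<infinity>"
  proof -
    have "(\<integral>\<^sup>+x. v x \<partial>M) = 1"
      using emeasure_space_1 by (simp add: emeasure_density cong: nn_integral_cong)
    then show ?thesis using nn_integral_PInf_AE[of v M] by (auto simp: less_top)
  qed
  let ?s = "\<lambda>x. \<Sum>i<d. (cmod (g i x))\<^sup>2"
  have sM [measurable]: "?s \<in> borel_measurable M"
  proof (rule borel_measurable_sum)
    fix i assume "i \<in> {..<d}"
    then have [measurable]: "g i \<in> borel_measurable M" using gM by simp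
    show "(\<lambda>x. (cmod (g i x))\<^sup>2) \<in> borel_measurable M" by measurable
  qed
  have WM [measurable]: "W \<in> borel_measurable M" unfolding W_def by measurable
  have uM: "(\<lambda>x. ?u x i) \<in> borel_measurable M" if "i < d" for i
  proof -
    have [measurable]: "(\<lambda>x. cnj (g i x)) \<in> borel_measurable M" by (rule measurable_cnj[OF gM[OF that]])
    show ?thesis by measurable
  qed
  show ?thesis
  proof
    show "(\<lambda>x. ?u x i) \<in> borel_measurable (density M v)" if "i < d" for i
      using uM[OF that] by simp
    show "(\<Sum>i<d. (cmod (?u x i))\<^sup>2) \<le> K" for x
    proof (cases "x \<in> \<Omega> \<and> W x * ?s x \<le> K")
      case True
      then have "(\<Sum>i<d. (cmod (?u x i))\<^sup>2) = W x * ?s x"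
        by (simp add: norm_mult power_mult_distrib sum_distrib_left W_def)
      then show ?thesis using True by simp
    qed (use K in auto)
    show "(\<integral>x. cnj (?u x i) * ?u x j \<partial>density M v) = (if i = j then 1 else 0)" if ij: "i < d" "j < d" for i j
    proof -
      have m: "(\<lambda>x. cnj (?u x i) * ?u x j) \<in> borel_measurable M"
        by (intro borel_measurable_times measurable_cnj[of "\<lambda>x. ?u x i"] uM ij)
      have gm: "(\<lambda>x. cnj (g j x) * g i x) \<in> borel_measurable M"
        by (intro borel_measurable_times measurable_cnj[of "g j"] gM ij)
      have "(\<integral>x. cnj (?u x i) * ?u x j \<partial>density M v) = (\<integral>x. enn2real (v x) *\<^sub>R (cnj (?u x i) * ?u x j) \<partial>M)"
        unfolding density_enn2real[OF v vfin] by (rule integral_density[OF m]) auto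
      \<comment> \<open>\<open>v\<close> cancels the two square roots of \<open>W\<close>. The
        conjugate in the vectors interchanges i and j, which the Kronecker delta does not
        notice.\<close>
      also have "\<dots> = (\<integral>x. indicator \<Omega> x *\<^sub>R (cnj (g j x) * g i x) \<partial>M)"
      proof (rule integral_cong_AE)
        show "AE x in M. enn2real (v x) *\<^sub>R (cnj (?u x i) * ?u x j) = indicator \<Omega> x *\<^sub>R (cnj (g j x) * g i x)"
          using vfin vpos K(1)
        proof eventually_elim
          case (elim x)
          show ?case
          proof (cases "x \<in> \<Omega>")
            case True
            then obtain r where r: "v x = ennreal r" "0 < r"
              using elim by (cases "v x") auto
            have W: "inverse (v x) = ennreal (W x)" "W x = inverse r"
              using r by (simp_all add: W_def inverse_ennreal)
            have "0 \<le> ?s x" by (intro sum_nonneg) auto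
            then have "ennreal (W x * ?s x) \<le> ennreal K"
              using elim(3) True unfolding W(1) by (simp add: ennreal_mult' W_def)
            then have "W x * ?s x \<le> K" using K(2) by (simp add: ennreal_le_iff)
            then have "cnj (?u x i) * ?u x j = (of_real (sqrt (W x)) * of_real (sqrt (W x))) * (cnj (g j x) * g i x)"
              using True by simp
            also have "of_real (sqrt (W x)) * of_real (sqrt (W x)) = (of_real (inverse r) :: complex)"
              using r W(2) by (simp flip: of_real_mult)
            finally show ?thesis using True r by (simp add: scaleR_conv_of_real)
          qed simp
        qed
      qed (use m gm in measurable)
      also have "\<dots> = (\<integral>x. cnj (g j x) * g i x \<partial>restrict_space M \<Omega>)"
        by (rule integral_restrict_space[symmetric]) measurable
      also have "\<dots> = (if i = j then 1 else 0)" using g ij unfolding orthonormal_def by auto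
      finally show ?thesis .
    qed
  qed
qed

theorem theorem2:
  fixes \<rho> \<mu> :: "'a measure"
    and S :: "'s measure"
    and P :: "('a \<Rightarrow> complex) set"
    and v w :: "'a \<Rightarrow> ennreal"
    and f f\<^sub>n :: "'a \<Rightarrow> complex"
    and X :: "nat \<Rightarrow> 's \<Rightarrow> 'a"
    and \<epsilon> :: real
    and n m :: nat
  assumes "prob_space \<rho>"
    and "L2_subspace \<rho> n P"
    and "\<exists>p\<in>P. AE x in \<rho>. p x = 1"
    and "prob_space \<mu>" and "sets \<mu> = sets \<rho>" and "absolutely_continuous \<rho> \<mu>"
    and "v \<in> borel_measurable \<rho>" and "\<mu> = density \<rho> v"
    and "w = (\<lambda>x. inverse (v x))"
    and "\<Omega> \<in> sets \<rho>" and "measure \<rho> \<Omega> > 0"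
    and "AE x in restrict_space \<rho> \<Omega>. v x > 0"
    and "f \<in> L2 \<rho>"
    and "best_L2_approx \<rho> P f f\<^sub>n"
    and "0 < \<epsilon>" and "\<epsilon> < 1"
    and "of_nat m \<ge> 8 * kappa w P (restrict_space \<rho> \<Omega>) * ennreal (ln (3 * real n / \<epsilon>))"
    and "prob_space S"
    and "prob_space.indep_vars S (\<lambda>_. \<mu>) X {..<m}"
    and "\<And>i. i < m \<Longrightarrow> distr S \<mu> (X i) = \<mu>"
  shows "\<exists>A\<in>sets S. measure S A \<ge> 1 - \<epsilon> \<and>
    (\<forall>s\<in>A. \<forall>(e :: nat \<Rightarrow> complex) fhat.
       wls_minimizer P m w (\<lambda>i. X i s) (\<lambda>i. f (X i s) + e i) fhat \<longrightarrow>
       (remez P \<rho> \<Omega> 2 2 < \<infinity> \<longrightarrow>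
          Lnorm 2 \<rho> (\<lambda>x. f x - fhat x)
            \<le> Lnorm 2 \<rho> (\<lambda>x. f x - f\<^sub>n x)
              + 8 * remez P \<rho> \<Omega> 2 2 / ennreal (sqrt \<epsilon>)
                * (Lnorm 2 \<rho> (\<lambda>x. f x - f\<^sub>n x) + ennreal (L2_set (\<lambda>i. cmod (e i)) {..<m}))) \<and>
       (remez P \<rho> \<Omega> \<infinity> 2 < \<infinity> \<longrightarrow>
          Lnorm \<infinity> \<rho> (\<lambda>x. f x - fhat x)
            \<le> Lnorm \<infinity> \<rho> (\<lambda>x. f x - f\<^sub>n x)
              + 8 * remez P \<rho> \<Omega> \<infinity> 2 / ennreal (sqrt \<epsilon>)
                * (Lnorm 2 \<rho> (\<lambda>x. f x - f\<^sub>n x) + ennreal (L2_set (\<lambda>i. cmod (e i)) {..<m}))))"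
proof (cases "remez P \<rho> \<Omega> 2 2 < \<infinity> \<or> remez P \<rho> \<Omega> \<infinity> 2 < \<infinity>")
  case False
  interpret S: prob_space S by fact
  show ?thesis using False \<open>0 < \<epsilon>\<close> by (intro bexI[of _ "space S"]) (auto simp: S.prob_space)
next
  \<comment> \<open>Either finite constant makes \<open>P\<close> injective on \<Omega>, and one
    event serves both bounds; if both constants are infinite, both bounds are vacuous.\<close>
  case remez: True
  interpret \<rho>: prob_space \<rho> by fact
  interpret S: prob_space S by fact
  let ?\<nu> = "restrict_space \<rho> \<Omega>"
  note \<epsilon> = \<open>0 < \<epsilon>\<close> \<open>\<epsilon> < 1\<close> and \<Omega> = \<open>\<Omega> \<in> sets \<rho>\<close> and \<mu> = \<open>\<mu> = density \<rho> v\<close> and w = \<open>w = (\<lambda>x. inverse (v x))\<close>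
    and [measurable] = \<open>v \<in> borel_measurable \<rho>\<close>
  have \<Omega>s: "\<Omega> \<inter> space \<rho> \<in> sets \<rho>" using \<Omega> by auto
  obtain B where P: "cfun.subspace P" "P \<subseteq> L2 \<rho>" and B: "finite B" "cfun.span B = P" and dim: "cfun.dim P = n"
    and uniq: "\<And>p q. p \<in> P \<Longrightarrow> q \<in> P \<Longrightarrow> AE x in \<rho>. p x = q x \<Longrightarrow> p = q"
    using \<open>L2_subspace \<rho> n P\<close> unfolding L2_subspace_def by blast
  obtain one where one: "one \<in> P" "AE x in \<rho>. one x = 1" using assms(3) by blast
  have zeroP: "(\<lambda>x. 0) \<in> P" using cfun.subspace_0[OF P(1)] by (simp add: zero_fun_def)
  have fnP: "f\<^sub>n \<in> P" using \<open>best_L2_approx \<rho> P f f\<^sub>n\<close> unfolding best_L2_approx_def is_arg_min_def by simp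
  have PM: "p \<in> borel_measurable \<rho>" if "p \<in> P" for p using that P(2) unfolding L2_def by blast
  have fM: "f \<in> borel_measurable \<rho>" using \<open>f \<in> L2 \<rho>\<close> unfolding L2_def by simp
  \<comment> \<open>A vanishing norm gives p = 0 only almost everywhere; the uniqueness of
    representatives in \<open>L2_subspace\<close> turns this into equality of functions.\<close>
  have inj: "p = (\<lambda>x. 0)" if p: "p \<in> P" "Lnorm 2 ?\<nu> p = 0" for p
  proof -
    obtain q where "q = 2 \<or> q = \<infinity>" "remez P \<rho> \<Omega> q 2 < \<infinity>" using remez by blast
    from \<rho>.remez_finite_imp_injective[OF P \<Omega> \<open>measure \<rho> \<Omega> > 0\<close> one this p]
    have "AE x in \<rho>. p x = 0" using Lnorm_2_eq_0_iff[OF PM[OF p(1)]] by simp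
    then show ?thesis by (intro uniq p zeroP)
  qed
  have PL\<nu>: "P \<subseteq> L2 ?\<nu>" using L2_restrict[OF \<Omega>] P(2) by blast
  obtain d g where d: "d \<le> n" and g: "orthonormal ?\<nu> d g" and gP: "\<And>i. i < d \<Longrightarrow> g i \<in> P"
    and span: "\<And>p. p \<in> P \<Longrightarrow> \<exists>c. p = (\<lambda>x. \<Sum>i<d. c i * g i x)"
    using orthonormal_basis_exists[OF P(1) B PL\<nu> inj] unfolding dim by blast
  have d0: "0 < d"
  proof (rule ccontr)
    assume "\<not> 0 < d"
    then have "one = (\<lambda>x. 0)" using span[OF one(1)] by simp
    then have "AE x in \<rho>. False" using one(2) by simp
    then show False by simp
  qed
  define l where "l = ln (3 * real n / \<epsilon>)"
  have l0: "0 < l"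
    unfolding l_def using d d0 \<epsilon> by (intro ln_gt_zero) (simp add: less_divide_eq)
  have mK: "8 * kappa w P ?\<nu> * ennreal l \<le> ennreal (real m)"
    using assms(17) unfolding l_def ennreal_of_nat_eq_real_of_nat .
  \<comment> \<open>As l is positive, an infinite value would contradict the finite sample
    size.\<close>
  have "kappa w P ?\<nu> \<noteq> \<infinity>"
  proof
    assume "kappa w P ?\<nu> = \<infinity>"
    then have "8 * kappa w P ?\<nu> * ennreal l = \<infinity>" using l0 by (simp add: ennreal_mult_top ennreal_top_mult)
    then show False using mK by (simp add: top_unique)
  qed
  then obtain K where K: "kappa w P ?\<nu> = ennreal K" "0 \<le> K" by (cases "kappa w P ?\<nu>") auto
  have m8: "8 * K * l \<le> real m"
  proof -
    have "8 * kappa w P ?\<nu> * ennreal l = ennreal (8 * K * l)"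
      unfolding K(1) using K(2) l0 by (simp add: ennreal_mult)
    then show ?thesis using mK K(2) l0 by (simp add: ennreal_le_iff)
  qed
  have KAE: "AE x in \<rho>. x \<in> \<Omega> \<longrightarrow> inverse (v x) * ennreal (\<Sum>i<d. (cmod (g i x))\<^sup>2) \<le> ennreal K"
  proof -
    have "AE x in ?\<nu>. w x * christoffel P ?\<nu> x \<le> kappa w P ?\<nu>"
      unfolding kappa_def by (rule esssup_AE)
    then have "AE x in ?\<nu>. inverse (v x) * ennreal (\<Sum>i<d. (cmod (g i x))\<^sup>2) \<le> ennreal K"
    proof eventually_elim
      case (elim x)
      have "inverse (v x) * ennreal (\<Sum>i<d. (cmod (g i x))\<^sup>2) \<le> w x * christoffel P ?\<nu> x"
        unfolding w by (intro mult_left_mono orthonormal_le_christoffel[OF P(1) PL\<nu> g gP]) auto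
      then show ?case using elim unfolding K(1) by (rule order_trans)
    qed
    then show ?thesis unfolding AE_restrict_space_iff[OF \<Omega>s] .
  qed
  \<comment> \<open>Where \<open>v\<close> is 0 the weight is infinite and \<open>W\<close> takes
    the default value 0. On the final event all sampled weights are finite, so \<open>W\<close> is
    the true weight at the samples.\<close>
  define W where "W x = enn2real (inverse (v x))" for x
  define u where "u x i = (if x \<in> \<Omega> \<and> W x * (\<Sum>i<d. (cmod (g i x))\<^sup>2) \<le> K then of_real (sqrt (W x)) * cnj (g i x) else 0)" for x i
  have W0: "0 \<le> W x" for x by (simp add: W_def)
  interpret u: isotropic_vectors \<mu> u d K
    unfolding u_def W_def \<mu>
    using assms(4) assms(12) KAE K(2) g gP PM
    unfolding \<mu> AE_restrict_space_iff[OF \<Omega>s]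
    by (intro isotropic_vectors_weighted_basis \<Omega>) auto
  have K1: "1 \<le> K" by (rule u.one_le_\<kappa>[OF d0])
  have m0: "0 < m" using m8 K1 l0 by (cases m) (auto simp: mult_le_0_iff)
  obtain B0 where B0: "B0 \<in> sets S" "emeasure S B0 \<le> ennreal (\<epsilon> / 2)"
    and frame: "\<And>s y. s \<in> space S - B0 \<Longrightarrow> real m / 16 * (\<Sum>i<d. (cmod (y i))\<^sup>2) \<le> (\<Sum>j<m. (cmod (cdot d (u (X j s)) y))\<^sup>2)"
    using u.sample_lower_frame_bound[OF assms(18) assms(19) assms(20) _ d K1 \<epsilon>] m8 d d0 unfolding l_def by force
  have Xm: "X i \<in> S \<rightarrow>\<^sub>M \<mu>" if "i < m" for i
    using assms(19) that unfolding S.indep_vars_def by auto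
  define h where "h x = ennreal ((cmod (f x - f\<^sub>n x))\<^sup>2)" for x
  have hM [measurable]: "h \<in> borel_measurable \<rho>"
    using fM PM[OF fnP] unfolding h_def by measurable
  have resL: "Lnorm 2 \<rho> (\<lambda>x. f x - f\<^sub>n x) < \<infinity>"
  proof -
    have "Lnorm 2 \<rho> (\<lambda>x. f x + (-1) * f\<^sub>n x) \<le> Lnorm 2 \<rho> f + Lnorm 2 \<rho> (\<lambda>x. (-1) * f\<^sub>n x)"
      using fM PM[OF fnP] by (intro Lnorm_2_triangle) auto
    also have "\<dots> \<le> Lnorm 2 \<rho> f + 1 * Lnorm 2 \<rho> f\<^sub>n"
      using Lnorm_cmult_le[OF PM[OF fnP], of 2 "-1"] by (intro add_mono) auto
    also have "\<dots> < \<infinity>" using \<open>f \<in> L2 \<rho>\<close> fnP P(2) unfolding L2_def by auto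
    finally show ?thesis by simp
  qed
  then obtain G where G: "Lnorm 2 \<rho> (\<lambda>x. f x - f\<^sub>n x) = ennreal G" "0 \<le> G"
    by (cases "Lnorm 2 \<rho> (\<lambda>x. f x - f\<^sub>n x)") auto
  have hG: "(\<integral>\<^sup>+x. w x * h x \<partial>\<mu>) \<le> ennreal (G\<^sup>2)"
  proof -
    have "(\<integral>\<^sup>+x. w x * h x \<partial>\<mu>) \<le> (\<integral>\<^sup>+x. h x \<partial>\<rho>)"
      unfolding w \<mu> by (rule nn_integral_density_inverse_le) measurable
    also have "\<dots> = (Lnorm 2 \<rho> (\<lambda>x. f x - f\<^sub>n x))\<^sup>2" unfolding h_def Lnorm_2_power2 ..
    also have "\<dots> = ennreal (G\<^sup>2)" unfolding G(1) by (rule ennreal_power[OF G(2)])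
    finally show ?thesis .
  qed
  have w1: "(\<integral>\<^sup>+x. w x \<partial>\<mu>) \<le> ennreal 1"
  proof -
    have "(\<integral>\<^sup>+x. inverse (v x) * 1 \<partial>density \<rho> v) \<le> (\<integral>\<^sup>+x. 1 \<partial>\<rho>)"
      by (rule nn_integral_density_inverse_le) measurable
    then show ?thesis unfolding w \<mu> by (simp add: \<rho>.emeasure_space_1)
  qed
  have wM: "w \<in> borel_measurable \<mu>" "(\<lambda>x. w x * h x) \<in> borel_measurable \<mu>" unfolding w \<mu> by measurable
  define B1 where "B1 = {s \<in> space S. ennreal (4 / \<epsilon> * G\<^sup>2) < ennreal (1 / real m) * (\<Sum>i<m. w (X i s) * h (X i s))}"
  define B2 where "B2 = {s \<in> space S. ennreal (4 / \<epsilon> * 1) < ennreal (1 / real m) * (\<Sum>i<m. w (X i s))}"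
  \<comment> \<open>Exceeding the mean by the factor 4 / \<epsilon> has probability at most
    \<epsilon> / 4 for each of \<open>B1\<close> and \<open>B2\<close>; \<open>B0\<close> takes the
    remaining \<epsilon> / 2.\<close>
  have t0: "0 < 4 / \<epsilon>" using \<epsilon> by simp
  have B1: "B1 \<in> sets S" "emeasure S B1 \<le> ennreal (\<epsilon> / 4)"
    using emeasure_empirical_mean_gt[where X = X and m = m and S = S and N = \<mu> and h = "\<lambda>x. w x * h x"
        and c = "G\<^sup>2" and t = "4 / \<epsilon>", OF Xm assms(20) m0 wM(2) hG t0, folded B1_def]
    by simp_all
  have B2: "B2 \<in> sets S" "emeasure S B2 \<le> ennreal (\<epsilon> / 4)"
    using emeasure_empirical_mean_gt[where X = X and m = m and S = S and N = \<mu> and h = "w"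
        and c = "1" and t = "4 / \<epsilon>", OF Xm assms(20) m0 wM(1) w1 t0, folded B2_def]
    by simp_all
  define A where "A = space S - (B0 \<union> B1 \<union> B2)"
  have AS: "A \<in> sets S" unfolding A_def using B0 B1 B2 by auto
  have mA: "1 - \<epsilon> \<le> measure S A"
  proof -
    have r: "measure S C \<le> c" if "emeasure S C \<le> ennreal c" "0 \<le> c" for C c
      using that by (simp add: S.emeasure_eq_measure)
    have "measure S (B0 \<union> B1 \<union> B2) \<le> measure S (B0 \<union> B1) + measure S B2"
      using B0 B1 B2 by (intro measure_Un_le) auto
    also have "measure S (B0 \<union> B1) \<le> measure S B0 + measure S B1"
      using B0 B1 by (intro measure_Un_le) auto
    finally have "measure S (B0 \<union> B1 \<union> B2) \<le> \<epsilon> / 2 + \<epsilon> / 4 + \<epsilon> / 4"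
      using r[OF B0(2)] r[OF B1(2)] r[OF B2(2)] \<epsilon> by simp
    then show ?thesis
      unfolding A_def using B0 B1 B2 by (subst S.prob_compl) auto
  qed
  have err: "Lnorm q \<rho> (\<lambda>x. f x - fhat x) \<le> Lnorm q \<rho> (\<lambda>x. f x - f\<^sub>n x)
      + 8 * remez P \<rho> \<Omega> q 2 / ennreal (sqrt \<epsilon>)
        * (Lnorm 2 \<rho> (\<lambda>x. f x - f\<^sub>n x) + ennreal (L2_set (\<lambda>i. cmod (e i)) {..<m}))"
    if s: "s \<in> A" and min: "wls_minimizer P m w (\<lambda>i. X i s) (\<lambda>i. f (X i s) + e i) fhat"
      and q: "q = 2 \<or> q = \<infinity>" and fin: "remez P \<rho> \<Omega> q 2 < \<infinity>" for s e fhat q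
  proof -
    let ?E = "L2_set (\<lambda>i. cmod (e i)) {..<m}"
    have fhP: "fhat \<in> P" using min unfolding wls_minimizer_def is_arg_min_def by simp
    define p where "p = (\<lambda>x. f\<^sub>n x - fhat x)"
    have pP: "p \<in> P" unfolding p_def by (rule cfun_subspace_diff[OF P(1) fnP fhP])
    obtain R where R: "remez P \<rho> \<Omega> q 2 = ennreal R" "0 \<le> R" using fin by (cases "remez P \<rho> \<Omega> q 2") auto
    obtain c where c: "p = (\<lambda>x. \<Sum>i<d. c i * g i x)" using span[OF pP] by blast
    define N where "N = sqrt (\<Sum>i<d. (cmod (c i))\<^sup>2)"
    have N0: "0 \<le> N" unfolding N_def by (intro real_sqrt_ge_zero sum_nonneg) auto
    have N2: "N\<^sup>2 = (\<Sum>i<d. (cmod (c i))\<^sup>2)" unfolding N_def by (intro real_sqrt_pow2 sum_nonneg) auto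
    have NL: "Lnorm 2 ?\<nu> p = ennreal N"
    proof -
      have "(Lnorm 2 ?\<nu> p)\<^sup>2 = ennreal (\<Sum>i<d. (cmod (c i))\<^sup>2)"
        unfolding c by (rule orthonormal_Parseval[OF g]) (use pP PL\<nu> c in auto)
      then have e: "(Lnorm 2 ?\<nu> p)\<^sup>2 = (ennreal N)\<^sup>2" by (simp add: N2[symmetric] ennreal_power[OF N0])
      show ?thesis by (rule antisym; rule ennreal_power2_le_imp_le; simp add: e)
    qed
    \<comment> \<open>Samples outside \<Omega> have a zero vector \<open>u\<close> and a nonnegative
      term on the right, so the frame bound over \<Omega> passes to the full weighted sum. The
      conjugate in \<open>u\<close> makes \<open>cdot d (u x) c\<close> a multiple of p x
      itself.\<close>
    have fr: "real m / 16 * N\<^sup>2 \<le> (\<Sum>i<m. enn2real (w (X i s)) * (cmod (f\<^sub>n (X i s) - fhat (X i s)))\<^sup>2)"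
    proof -
      have "real m / 16 * N\<^sup>2 \<le> (\<Sum>j<m. (cmod (cdot d (u (X j s)) c))\<^sup>2)"
        unfolding N2 using s unfolding A_def by (intro frame) auto
      also have "\<dots> \<le> (\<Sum>i<m. enn2real (w (X i s)) * (cmod (f\<^sub>n (X i s) - fhat (X i s)))\<^sup>2)"
      proof (rule sum_mono)
        fix j
        let ?x = "X j s"
        have "(cmod (cdot d (u ?x) c))\<^sup>2 \<le> W ?x * (cmod (p ?x))\<^sup>2"
        proof (cases "?x \<in> \<Omega> \<and> W ?x * (\<Sum>i<d. (cmod (g i ?x))\<^sup>2) \<le> K")
          case True
          then have "cdot d (u ?x) c = of_real (sqrt (W ?x)) * p ?x"
            unfolding cdot_def u_def c by (simp add: sum_distrib_left mult_ac)
          then show ?thesis using W0 by (simp add: norm_mult power_mult_distrib)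
        next
          case False
          then have "u ?x i = 0" for i unfolding u_def by (rule if_not_P)
          then have "cdot d (u ?x) c = 0" unfolding cdot_def by simp
          then show ?thesis using W0 by simp
        qed
        then show "(cmod (cdot d (u ?x) c))\<^sup>2 \<le> enn2real (w ?x) * (cmod (f\<^sub>n ?x - fhat ?x))\<^sup>2"
          unfolding W_def w p_def .
      qed
      finally show ?thesis .
    qed
    have NB: "N \<le> 8 / sqrt \<epsilon> * (G + ?E)"
    proof (rule wls_error_bound[OF P(1) fnP m0 \<epsilon>(1) min _ _ fr G(2)])
      show "ennreal (1 / real m) * (\<Sum>i<m. w (X i s) * ennreal ((cmod (f (X i s) - f\<^sub>n (X i s)))\<^sup>2)) \<le> ennreal (4 / \<epsilon> * G\<^sup>2)"
        using s unfolding A_def B1_def h_def by (auto simp: not_less)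
      show "ennreal (1 / real m) * (\<Sum>i<m. w (X i s)) \<le> ennreal (4 / \<epsilon>)"
        using s unfolding A_def B2_def by (auto simp: not_less)
    qed
    have pq: "Lnorm q \<rho> p \<le> ennreal R * ennreal N"
    proof (cases "Lnorm 2 ?\<nu> p = 0")
      case False
      from Lnorm_le_remez[OF P \<Omega> pP q this] show ?thesis unfolding R(1) NL .
    next
      case True
      \<comment> \<open>Elements of norm 0 over \<Omega> lie outside the supremum in
        \<open>remez\<close>; by injectivity only 0 remains, written as a multiple of
        \<open>one\<close> so that \<open>Lnorm_cmult_le\<close> yields norm 0.\<close>
      then have "p = (\<lambda>x. of_real 0 * one x)" using inj[OF pP] by simp
      then have "Lnorm q \<rho> p \<le> ennreal (cmod (of_real 0)) * Lnorm q \<rho> one"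
        using Lnorm_cmult_le[OF PM[OF one(1)] q, of "of_real 0"] by simp
      also have "\<dots> = 0" by simp
      finally show ?thesis by simp
    qed
    have "Lnorm q \<rho> (\<lambda>x. f x - fhat x) = Lnorm q \<rho> (\<lambda>x. (f x - f\<^sub>n x) + p x)"
      by (simp add: p_def)
    also have "\<dots> \<le> Lnorm q \<rho> (\<lambda>x. f x - f\<^sub>n x) + Lnorm q \<rho> p"
      using q Lnorm_2_triangle[of "\<lambda>x. f x - f\<^sub>n x" \<rho> p] Lnorm_infinity_triangle[of "\<lambda>x. f x - f\<^sub>n x" \<rho> p]
        fM PM[OF fnP] PM[OF pP] by auto
    also have "\<dots> \<le> Lnorm q \<rho> (\<lambda>x. f x - f\<^sub>n x) + ennreal (R * (8 / sqrt \<epsilon> * (G + ?E)))"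
    proof (intro add_left_mono order_trans[OF pq])
      show "ennreal R * ennreal N \<le> ennreal (R * (8 / sqrt \<epsilon> * (G + ?E)))"
        unfolding ennreal_mult[OF R(2) N0, symmetric] by (intro ennreal_leI mult_left_mono NB R(2))
    qed
    also have "ennreal (R * (8 / sqrt \<epsilon> * (G + ?E)))
        = 8 * remez P \<rho> \<Omega> q 2 / ennreal (sqrt \<epsilon>) * (Lnorm 2 \<rho> (\<lambda>x. f x - f\<^sub>n x) + ennreal ?E)"
    proof -
      have E0: "0 \<le> ?E" by (rule L2_set_nonneg)
      have "8 * remez P \<rho> \<Omega> q 2 / ennreal (sqrt \<epsilon>) = ennreal (8 * R / sqrt \<epsilon>)"
      proof -
        have "8 * ennreal R = ennreal (8 * R)" using R(2) by (simp add: ennreal_mult)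
        then show ?thesis unfolding R(1) using R(2) \<epsilon> by (simp add: divide_ennreal)
      qed
      moreover have "Lnorm 2 \<rho> (\<lambda>x. f x - f\<^sub>n x) + ennreal ?E = ennreal (G + ?E)"
        unfolding G(1) by (rule ennreal_plus[OF G(2) E0, symmetric])
      moreover have "ennreal (8 * R / sqrt \<epsilon>) * ennreal (G + ?E) = ennreal (8 * R / sqrt \<epsilon> * (G + ?E))"
        using R(2) G(2) E0 \<epsilon> by (intro ennreal_mult[symmetric]) auto
      ultimately show ?thesis by (simp add: mult_ac)
    qed
    finally show ?thesis .
  qed
  show ?thesis
  proof (rule bexI[OF _ AS], rule conjI[OF mA], intro ballI allI impI)
    fix s e fhat
    assume s: "s \<in> A" "wls_minimizer P m w (\<lambda>i. X i s) (\<lambda>i. f (X i s) + e i) fhat"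
    show "(remez P \<rho> \<Omega> 2 2 < \<infinity> \<longrightarrow>
          Lnorm 2 \<rho> (\<lambda>x. f x - fhat x)
            \<le> Lnorm 2 \<rho> (\<lambda>x. f x - f\<^sub>n x)
              + 8 * remez P \<rho> \<Omega> 2 2 / ennreal (sqrt \<epsilon>)
                * (Lnorm 2 \<rho> (\<lambda>x. f x - f\<^sub>n x) + ennreal (L2_set (\<lambda>i. cmod (e i)) {..<m}))) \<and>
       (remez P \<rho> \<Omega> \<infinity> 2 < \<infinity> \<longrightarrow>
          Lnorm \<infinity> \<rho> (\<lambda>x. f x - fhat x)
            \<le> Lnorm \<infinity> \<rho> (\<lambda>x. f x - f\<^sub>n x)
              + 8 * remez P \<rho> \<Omega> \<infinity> 2 / ennreal (sqrt \<epsilon>)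
                * (Lnorm 2 \<rho> (\<lambda>x. f x - f\<^sub>n x) + ennreal (L2_set (\<lambda>i. cmod (e i)) {..<m})))"
      by (intro conjI impI err[OF s]) auto
  qed
qed

end
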